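(* Let $b$ be a prime, $m\in\mathbb{N}$, $N=b^m$, $s\in\mathbb{N}$, $\alpha>1$, and let $(\gamma_{\mathfrak{u}})$ be positive weights, indexed by finite sets $\mathfrak{u}\subset\mathbb{N}$, with $\gamma_\emptyset=1$. Let $\boldsymbol{g}^0\in(\mathbb{F}_b[x])^s$ be an arbitrary initial vector. Then the successive coordinate search (SCS) algorithm for polynomial lattice rules with modulus $x^m$ (defined in the context), started from $\boldsymbol{g}^0$, constructs $\boldsymbol{g}=(g_1,\ldots,g_s)$ such that, for every $\lambda\in(\frac1\alpha,1]$, the squared worst-case error in the weighted Walsh space satisfies $$e_{N,s}^2((g_1,\ldots,g_s))\le\left(\sum_{\emptyset\ne\mathfrak{u}\subseteq[s]}|\mathfrak{u}|\,\gamma_{\mathfrak{u}}^\lambda\,\frac{2\,(\mu_b(\alpha\lambda))^{|\mathfrak{u}|}}{b^m}\right)^{1/\lambda}.$$ In particular, $e_{N,s}(\boldsymbol{g})\in\mathcal{O}(N^{-\alpha/2+\delta})$ for $\delta\in(0,\frac{\alpha-1}{2}]$ arbitrarily close to zero, where the implied constant is independent of $s$ if $$C_\delta:=\sup_{s\in\mathbb{N}}\left[2\sum_{\emptyset\ne\mathfrak{u}\subseteq[s]}|\mathfrak{u}|\,\gamma_{\mathfrak{u}}^{\frac{1}{\alpha-2\delta}}\left(\mu_b\left(\tfrac{\alpha}{\alpha-2\delta}\right)\right)^{|\mathfrak{u}|}\right]<\infty.$$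
   Context: Notation: $[s]=\{1,\ldots,s\}$; for a vector $\boldsymbol{x}$ and $\mathfrak{u}\subseteq[s]$, $\boldsymbol{x}_{\mathfrak{u}}=(x_j)_{j\in\mathfrak{u}}$; $\mathbb{F}_b$ is the field with $b$ elements, identified with $\{0,\ldots,b-1\}$. For $h\in\mathbb{N}$, $\psi_b(h)=\lfloor\log_b h\rfloor$ and $r_\alpha(h)=b^{-\alpha\psi_b(h)}$; for vectors $r_\alpha(\boldsymbol{h})=\prod_j r_\alpha(h_j)$. For $\beta>1$, $\mu_b(\beta)=\sum_{h=1}^\infty r_\beta(h)=\frac{b^\beta(b-1)}{b^\beta-b}$. Walsh functions: for $h=h_0+h_1b+\cdots+h_ab^a$ (base-$b$ digits) and $x=\frac{x_1}{b}+\frac{x_2}{b^2}+\cdots\in[0,1)$ (with infinitely many digits $x_i\neq b-1$), $\mathrm{wal}_h(x)=\mathrm{e}^{2\pi\mathrm{i}(x_1h_0+\cdots+x_{a+1}h_a)/b}$; $\mathrm{wal}_{\boldsymbol{h}}(\boldsymbol{x})=\prod_j\mathrm{wal}_{h_j}(x_j)$. Weighted Walsh space: $\mathcal{H}(K^{\mathrm{wal}}_{s,\alpha,\boldsymbol{\gamma}})$ is the reproducing kernel Hilbert space with kernel $$K^{\mathrm{wal}}_{s,\alpha,\boldsymbol{\gamma}}(\boldsymbol{x},\boldsymbol{y})=1+\sum_{\emptyset\ne\mathfrak{u}\subseteq[s]}\gamma_{\mathfrak{u}}\sum_{\boldsymbol{h}_{\mathfrak{u}}\in\mathbb{N}^{|\mathfrak{u}|}}r_\alpha(\boldsymbol{h}_{\mathfrak{u}})\,\mathrm{wal}_{\boldsymbol{h}_{\mathfrak{u}}}(\boldsymbol{x}_{\mathfrak{u}})\,\overline{\mathrm{wal}_{\boldsymbol{h}_{\mathfrak{u}}}(\boldsymbol{y}_{\mathfrak{u}})}.$$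 Polynomial lattice rule with modulus $x^m$: for $v\in\mathbb{F}_b[x]$ with $v\equiv a_0+a_1x+\cdots+a_{m-1}x^{m-1}\pmod{x^m}$ put $\nu(v/x^m)=\frac{a_{m-1}}{b}+\cdots+\frac{a_1}{b^{m-1}}+\frac{a_0}{b^m}\in[0,1)$. For $\boldsymbol{g}=(g_1,\ldots,g_s)\in(\mathbb{F}_b[x])^s$ the node set consists of the $b^m$ points $\boldsymbol{x}_n=(\nu(ng_1/x^m),\ldots,\nu(ng_s/x^m))$, $n\in\mathbb{F}_b[x]$, $\deg(n)<m$. Worst-case error: $e_{N,s}(\boldsymbol{g})$ is the supremum of the absolute integration error $\left|\int_{[0,1]^s}f-\frac1{b^m}\sum_nf(\boldsymbol{x}_n)\right|$ over the unit ball of $\mathcal{H}(K^{\mathrm{wal}}_{s,\alpha,\boldsymbol{\gamma}})$. It is known that $$e_{N,s}^2(\boldsymbol{g})=\sum_{\emptyset\ne\mathfrak{u}\subseteq[s]}\gamma_{\mathfrak{u}}\sum_{\boldsymbol{h}_{\mathfrak{u}}\in\mathcal{D}_{\mathfrak{u}}}\prod_{j\in\mathfrak{u}}b^{-\alpha\psi_b(h_j)},\qquad \mathcal{D}_{\mathfrak{u}}=\Big\{\boldsymbol{h}_{\mathfrak{u}}\in\mathbb{N}^{|\mathfrak{u}|}:\sum_{j\in\mathfrak{u}}\mathrm{tr}_m(h_j)g_j\equiv0\ (\mathrm{mod}\ x^m)\Big\},$$ where $\mathrm{tr}_m(h)=h_0+h_1x+\cdots+h_{m-1}x^{m-1}\in\mathbb{F}_b[x]$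 for $h=\sum_ih_ib^i$. SCS algorithm: let $\mathcal{G}_N=\{g\in\mathbb{F}_b[x]:0\le\deg(g)<m,\ \gcd(g,x^m)=1\}$. Given $\boldsymbol{g}^0=(g_1^0,\ldots,g_s^0)$, for $d=1,\ldots,s$ successively, with $g_1,\ldots,g_{d-1}$ already selected, choose $g_d\in\mathcal{G}_N$ such that $e_{N,s}^2((g_1,\ldots,g_{d-1},g_d,g_{d+1}^0,\ldots,g_s^0))$ is minimized as a function of $g_d$ over $\mathcal{G}_N$. The output is $\boldsymbol{g}=(g_1,\ldots,g_s)$. The $\mathcal{O}$-statement refers to $N=b^m$ with $m$ varying. *)

theory Defs
  imports
    "HOL-Analysis.Analysis"
    "HOL-Library.Landau_Symbols"
    "Berlekamp_Zassenhaus.Finite_Field"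
begin

text \<open>
  The base \<open>b\<close> is \<open>CARD('p)\<close> for a type \<open>'p\<close> of class \<open>prime_card\<close>, so that
  \<open>'p mod_ring\<close> is the field with \<open>b\<close> elements and \<open>to_int_mod_ring\<close> identifies it
  with \<open>{0, ..., b - 1}\<close>. Coordinates are numbered from 1, so \<open>[s]\<close> is \<open>{1..s}\<close>, and
  a vector indexed by a finite set \<open>u\<close> is a function on \<open>u\<close>.
\<close>

text \<open>
  Functions on \<open>D\<close> are represented by functions on the whole type that vanish off \<open>D\<close>.
  The inner product is linear in its first argument.
\<close>

locale function_hilbert_space =
  fixes D :: "'x set"
    and H :: "('x \<Rightarrow> complex) set"
    and ip :: "('x \<Rightarrow> complex) \<Rightarrow> ('x \<Rightarrow> complex) \<Rightarrow> complex"
  assumes vanish: "f \<in> H \<Longrightarrow> x \<notin> D \<Longrightarrow> f x = 0"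
    and zero_mem: "(\<lambda>x. 0) \<in> H"
    and add_mem: "f \<in> H \<Longrightarrow> g \<in> H \<Longrightarrow> (\<lambda>x. f x + g x) \<in> H"
    and scale_mem: "f \<in> H \<Longrightarrow> (\<lambda>x. c * f x) \<in> H"
    and ip_add: "f \<in> H \<Longrightarrow> g \<in> H \<Longrightarrow> h \<in> H \<Longrightarrow> ip (\<lambda>x. f x + g x) h = ip f h + ip g h"
    and ip_scale: "f \<in> H \<Longrightarrow> g \<in> H \<Longrightarrow> ip (\<lambda>x. c * f x) g = c * ip f g"
    and ip_cnj: "f \<in> H \<Longrightarrow> g \<in> H \<Longrightarrow> ip g f = cnj (ip f g)"
    and ip_nonneg: "f \<in> H \<Longrightarrow> Re (ip f f) \<ge> 0"
    and ip_definite: "f \<in> H \<Longrightarrow> ip f f = 0 \<Longrightarrow> f = (\<lambda>x. 0)"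
    and complete:
      "(\<And>n::nat. X n \<in> H) \<Longrightarrow>
       (\<And>e::real. e > 0 \<Longrightarrow> \<exists>M. \<forall>i\<ge>M. \<forall>j\<ge>M.
          sqrt (Re (ip (\<lambda>x. X i x - X j x) (\<lambda>x. X i x - X j x))) < e) \<Longrightarrow>
       \<exists>f\<in>H. (\<lambda>n. sqrt (Re (ip (\<lambda>x. X n x - f x) (\<lambda>x. X n x - f x)))) \<longlonglongrightarrow> 0"

locale rkhs = function_hilbert_space D H ip
  for D :: "'x set"
    and K :: "'x \<Rightarrow> 'x \<Rightarrow> complex"
    and H :: "('x \<Rightarrow> complex) set"
    and ip :: "('x \<Rightarrow> complex) \<Rightarrow> ('x \<Rightarrow> complex) \<Rightarrow> complex" +
  assumes kernel_mem: "y \<in> D \<Longrightarrow> (\<lambda>x. if x \<in> D then K x y else 0) \<in> H"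
    and reproducing: "f \<in> H \<Longrightarrow> y \<in> D \<Longrightarrow> f y = ip f (\<lambda>x. if x \<in> D then K x y else 0)"

text \<open>
  By the Moore--Aronszajn theorem a positive semidefinite kernel has exactly one reproducing
  kernel Hilbert space, so the existential quantifier below only names that space.
\<close>

definition rkhs_unit_ball :: "'x set \<Rightarrow> ('x \<Rightarrow> 'x \<Rightarrow> complex) \<Rightarrow> ('x \<Rightarrow> complex) set" where
  "rkhs_unit_ball D K = {f. \<exists>H ip. rkhs D K H ip \<and> f \<in> H \<and> sqrt (Re (ip f f)) \<le> 1}"

definition psi :: "nat \<Rightarrow> nat \<Rightarrow> nat" where
  "psi b h = nat \<lfloor>log (real b) (real h)\<rfloor>"

definition r_wal :: "nat \<Rightarrow> real \<Rightarrow> nat \<Rightarrow> real" where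
  "r_wal b \<alpha> h = real b powr (- \<alpha> * real (psi b h))"

definition mu :: "nat \<Rightarrow> real \<Rightarrow> real" where
  "mu b \<beta> = (\<Sum>\<^sub>\<infinity>h\<in>{1..}. r_wal b \<beta> h)"

text \<open>
  The floor formula yields, for \<open>x \<in> [0,1)\<close>, the digits of the expansion in which infinitely
  many digits differ from \<open>b - 1\<close>.
\<close>

definition real_digit :: "nat \<Rightarrow> real \<Rightarrow> nat \<Rightarrow> int" where
  "real_digit b x i = \<lfloor>x * real b ^ i\<rfloor> mod int b"

definition nat_digit :: "nat \<Rightarrow> nat \<Rightarrow> nat \<Rightarrow> nat" where
  "nat_digit b h i = h div b ^ i mod b"

definition wal :: "nat \<Rightarrow> nat \<Rightarrow> real \<Rightarrow> complex" where
  "wal b h x =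
     exp (2 * of_real pi * \<i> *
       of_int (\<Sum>i\<le>psi b h. real_digit b x (Suc i) * int (nat_digit b h i)) / of_nat b)"

definition K_wal ::
  "nat \<Rightarrow> nat \<Rightarrow> real \<Rightarrow> (nat set \<Rightarrow> real) \<Rightarrow> (nat \<Rightarrow> real) \<Rightarrow> (nat \<Rightarrow> real) \<Rightarrow> complex" where
  "K_wal b s \<alpha> \<gamma> x y =
     1 + (\<Sum>u\<in>Pow {1..s} - {{}}. of_real (\<gamma> u) *
           (\<Sum>\<^sub>\<infinity>h\<in>u \<rightarrow>\<^sub>E {1..}.
              of_real (\<Prod>j\<in>u. r_wal b \<alpha> (h j)) *
              (\<Prod>j\<in>u. wal b (h j) (x j)) * cnj (\<Prod>j\<in>u. wal b (h j) (y j))))"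

definition nu :: "nat \<Rightarrow> 'p::prime_card mod_ring poly \<Rightarrow> real" where
  "nu m v = (\<Sum>k<m. of_int (to_int_mod_ring (Polynomial.coeff v k)) / real CARD('p) ^ (m - k))"

definition node ::
  "nat \<Rightarrow> nat \<Rightarrow> (nat \<Rightarrow> 'p::prime_card mod_ring poly) \<Rightarrow> 'p mod_ring poly \<Rightarrow> nat \<Rightarrow> real" where
  "node m s g n = (\<lambda>j\<in>{1..s}. nu m (n * g j))"

text \<open>
  For \<open>m \<ge> 1\<close> the set \<open>{n. degree n < m}\<close> contains the zero polynomial.
\<close>

definition lattice_rule ::
  "nat \<Rightarrow> nat \<Rightarrow> (nat \<Rightarrow> 'p::prime_card mod_ring poly) \<Rightarrow> ((nat \<Rightarrow> real) \<Rightarrow> complex) \<Rightarrow> complex" where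
  "lattice_rule m s g f =
     (\<Sum>n\<in>{n :: 'p mod_ring poly. Polynomial.degree n < m}. f (node m s g n)) / of_nat (CARD('p) ^ m)"

text \<open>
  Walsh functions live on \<open>[0,1)\<close>, so the space consists of functions on \<open>[0,1)^s\<close>, extended
  by 0 as above; this does not affect the integral over \<open>[0,1]^s\<close>, since \<open>[0,1)^s\<close>
  differs from \<open>[0,1]^s\<close> by a null set.
\<close>

definition worst_case_error ::
  "real \<Rightarrow> (nat set \<Rightarrow> real) \<Rightarrow> nat \<Rightarrow> nat \<Rightarrow> (nat \<Rightarrow> 'p::prime_card mod_ring poly) \<Rightarrow> real" where
  "worst_case_error \<alpha> \<gamma> m s g =
     (SUP f\<in>rkhs_unit_ball ({1..s} \<rightarrow>\<^sub>E {0..<1}) (K_wal CARD('p) s \<alpha> \<gamma>).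
        cmod ((LINT x:({1..s} \<rightarrow>\<^sub>E {0..1})|Pi\<^sub>M {1..s} (\<lambda>_. lborel). f x) - lattice_rule m s g f))"

definition G_N :: "nat \<Rightarrow> 'p::prime_card mod_ring poly set" where
  "G_N m = {g. g \<noteq> 0 \<and> Polynomial.degree g < m \<and> coprime g (Polynomial.monom 1 m)}"

text \<open>
  Minimizers need not be unique; \<open>scs_output\<close> describes every vector that the search can return.
  Only the components of \<open>g\<close> with index in \<open>{1..s}\<close> matter.
\<close>

definition scs_output ::
  "real \<Rightarrow> (nat set \<Rightarrow> real) \<Rightarrow> nat \<Rightarrow> nat \<Rightarrow>
   (nat \<Rightarrow> 'p::prime_card mod_ring poly) \<Rightarrow> (nat \<Rightarrow> 'p mod_ring poly) \<Rightarrow> bool" where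
  "scs_output \<alpha> \<gamma> m s g0 g \<longleftrightarrow>
     (\<forall>d\<in>{1..s}.
        is_arg_min
          (\<lambda>q. (worst_case_error \<alpha> \<gamma> m s
                   (\<lambda>j. if j < d then g j else if j = d then q else g0 j))\<^sup>2)
          (\<lambda>q. q \<in> G_N m)
          (g d))"

definition C_const :: "nat \<Rightarrow> real \<Rightarrow> (nat set \<Rightarrow> real) \<Rightarrow> real \<Rightarrow> ereal" where
  "C_const b \<alpha> \<gamma> \<delta> =
     (SUP s\<in>{1..}. ereal (2 * (\<Sum>u\<in>Pow {1..s} - {{}}.
        real (card u) * \<gamma> u powr (1 / (\<alpha> - 2 * \<delta>)) * mu b (\<alpha> / (\<alpha> - 2 * \<delta>)) ^ card u)))"

end

theory Submission
  imports Defs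
begin

text \<open>
  The kernel is \<open>\<Sum> \<rho> i * \<phi> i x * cnj (\<phi> i y)\<close> for products \<open>\<phi> i\<close> of Walsh functions. In any of
  its reproducing kernel Hilbert spaces the Cauchy--Schwarz inequality bounds a finite combination of
  point evaluations of \<open>f\<close> by the norm of \<open>f\<close> times the root of \<open>\<Sum> \<rho> i * |\<Sum> a k * \<phi> i (p k)|^2\<close>.
  Truncating digits makes \<open>f\<close> a uniform limit of step functions, so the integral is a limit of averages
  over grids, and the bound passes to the integration error. The extremal function lives in the space of
  series with weighted square-summable coefficients, hence the squared worst-case error is the sum of
  the weights over the dual lattice.

  For step \<open>d\<close> of the search let \<open>T d\<close> be the part of this sum over the sets \<open>u\<close> that contain \<open>d\<close>.
  The choice of the generator \<open>g d\<close> minimizes \<open>T d\<close>, so \<open>T d powr \<theta>\<close> is at most the average over all units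
  of the same sum with weights raised to the power \<open>\<theta>\<close>. For fixed other frequencies
  the condition \<open>tr(k) * q + w \<equiv> 0 (mod x^m)\<close>, with \<open>w\<close> of valuation \<open>v\<close>, holds with probability at most
  \<open>2 * b^(v - m)\<close>, and only if \<open>b^v\<close> divides \<open>k\<close>; as these \<open>k\<close> carry weight \<open>b^(- \<beta> * v) * \<mu>\<close> with
  \<open>\<beta> = \<alpha> * \<theta> > 1\<close>, the average is at most \<open>2 * \<mu>^|u| / b^m\<close> for each \<open>u\<close>. Finally a set \<open>u\<close>
  with largest element \<open>d\<close> only sees generators that are fixed after step \<open>d\<close>, so
  the squared error is at most the sum of the \<open>T d\<close>, and each \<open>u\<close> is counted \<open>|u|\<close> times.
\<close>

section \<open>The worst-case error in a kernel space with an explicit expansion\<close>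

text \<open>Dominated convergence for unordered sums whose terms are eventually constant in
  \<open>n\<close>. Outside a finite set \<open>F\<close> the dominating sum is small, and on
  \<open>F\<close> the finitely many stabilization indices have a common bound, beyond which the
  terms over \<open>F\<close> cancel.\<close>

lemma tendsto_infsum_eventually_eq:
  fixes a :: "nat \<Rightarrow> 'i \<Rightarrow> 'b::banach"
  assumes G: "G summable_on I"
    and le: "\<And>n i. i \<in> I \<Longrightarrow> norm (a n i) \<le> G i"
    and ev: "\<And>i. i \<in> I \<Longrightarrow> \<forall>\<^sub>F n in sequentially. a n i = c i"
  shows "(\<lambda>n. \<Sum>\<^sub>\<infinity>i\<in>I. a n i) \<longlonglongrightarrow> (\<Sum>\<^sub>\<infinity>i\<in>I. c i)"
proof (rule metric_LIMSEQ_I)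
  fix e :: real assume e: "e > 0"
  have cle: "norm (c i) \<le> G i" if i: "i \<in> I" for i
  proof -
    obtain n where "a n i = c i"
      using eventually_happens'[OF _ ev[OF i]] by auto
    with le[OF i, of n] show ?thesis by simp
  qed
  have suma: "a n summable_on I" for n
    by (rule abs_summable_summable, rule summable_on_comparison_test[OF G]) (use le in auto)
  have sumc: "c summable_on I"
    by (rule abs_summable_summable, rule summable_on_comparison_test[OF G]) (use cle in auto)
  \<comment> \<open>The tail of \<open>G\<close> enters twice, once for \<open>a n\<close> and once
    for \<open>c\<close>, so a tail of at most \<open>e / 4\<close> leaves a strict margin below
    \<open>e\<close>.\<close>
  obtain F where F: "finite F" "F \<subseteq> I" "dist (sum G F) (infsum G I) \<le> e / 4"
    using infsum_finite_approximation[OF G, of "e/4"] e by auto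
  have GF: "infsum G (I - F) \<le> e / 4"
  proof -
    have "infsum G (I - F) = infsum G I - sum G F"
      using infsum_Diff[OF G _ F(2)] F(1) by simp
    then show ?thesis using F(3) unfolding dist_real_def by linarith
  qed
  have "\<forall>\<^sub>F n in sequentially. \<forall>i\<in>F. a n i = c i"
    using F ev by (intro eventually_ball_finite) auto
  then obtain N where N: "\<And>n i. n \<ge> N \<Longrightarrow> i \<in> F \<Longrightarrow> a n i = c i"
    by (auto simp: eventually_sequentially)
  have G2: "(\<lambda>i. 2 * G i) summable_on (I - F)"
    by (intro summable_on_cmult_right summable_on_subset_banach[OF G]) auto
  have "dist (infsum (a n) I) (infsum c I) < e" if n: "n \<ge> N" for n
  proof -
    have "infsum (a n) I - infsum c I = (\<Sum>\<^sub>\<infinity>i\<in>I. a n i - c i)"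
      using infsum_add[OF suma[of n] summable_on_uminus[THEN iffD2, OF sumc]]
      by (simp add: infsum_uminus)
    also have "\<dots> = (\<Sum>\<^sub>\<infinity>i\<in>I - F. a n i - c i)"
      by (rule infsum_cong_neutral) (use N n in auto)
    finally have "dist (infsum (a n) I) (infsum c I) = norm (\<Sum>\<^sub>\<infinity>i\<in>I - F. a n i - c i)"
      by (simp add: dist_norm)
    also have "\<dots> \<le> (\<Sum>\<^sub>\<infinity>i\<in>I - F. 2 * G i)"
    proof (rule norm_infsum_le[OF has_sum_infsum has_sum_infsum[OF G2]])
      show "(\<lambda>i. a n i - c i) summable_on I - F"
        using summable_on_add[OF suma[of n] summable_on_uminus[THEN iffD2, OF sumc]]
        by (auto intro: summable_on_subset_banach)
    next
      fix i assume "i \<in> I - F"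
      then show "norm (a n i - c i) \<le> 2 * G i"
        using norm_triangle_ineq4[of "a n i" "c i"] le[of i n] cle[of i] by auto
    qed
    also have "\<dots> = 2 * infsum G (I - F)"
      by (rule infsum_cmult_right')
    also have "\<dots> < e" using GF e by simp
    finally show ?thesis .
  qed
  then show "\<exists>N. \<forall>n\<ge>N. dist (infsum (a n) I) (infsum c I) < e" by blast
qed

section \<open>Elementary Hilbert space geometry\<close>

context function_hilbert_space
begin

lemma sum_mem:
  assumes "finite A" "\<And>k. k \<in> A \<Longrightarrow> F k \<in> H"
  shows "(\<lambda>x. \<Sum>k\<in>A. a k * F k x) \<in> H"
  using assms
proof (induction A rule: finite_induct)
  case (insert k A)
  then show ?case
    using add_mem[of "\<lambda>x. a k * F k x" "\<lambda>x. \<Sum>k\<in>A. a k * F k x"] by (simp add: scale_mem)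
qed (simp add: zero_mem)

lemma ip_zero_left: "g \<in> H \<Longrightarrow> ip (\<lambda>x. 0) g = 0"
  using ip_scale[OF zero_mem, of g 0] by simp

lemma ip_sum_left:
  assumes "finite A" "\<And>k. k \<in> A \<Longrightarrow> F k \<in> H" "g \<in> H"
  shows "ip (\<lambda>x. \<Sum>k\<in>A. a k * F k x) g = (\<Sum>k\<in>A. a k * ip (F k) g)"
  using assms
proof (induction A rule: finite_induct)
  case (insert k A)
  then show ?case
    using ip_add[of "\<lambda>x. a k * F k x" "\<lambda>x. \<Sum>k\<in>A. a k * F k x" g]
    by (simp add: scale_mem sum_mem ip_scale)
qed (simp add: ip_zero_left)

lemma ip_self: "f \<in> H \<Longrightarrow> ip f f = of_real (Re (ip f f))"
  using ip_cnj[of f f] by (simp add: complex_eq_iff)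

lemma Cauchy_Schwarz:
  assumes f: "f \<in> H" and g: "g \<in> H"
  shows "(cmod (ip f g))\<^sup>2 \<le> Re (ip f f) * Re (ip g g)"
proof (cases "ip g g = 0")
  case True
  then have "g = (\<lambda>x. 0)" using g by (rule ip_definite[rotated])
  then have "ip f g = 0"
    using ip_cnj[OF zero_mem f] ip_zero_left[OF f] by simp
  then show ?thesis using ip_nonneg[OF f] ip_nonneg[OF g] by simp
next
  case False
  define n where "n = Re (ip g g)"
  have gg: "ip g g = of_real n" using ip_self[OF g] by (simp add: n_def)
  have "n \<ge> 0" using ip_nonneg[OF g] by (simp add: n_def)
  moreover have "n \<noteq> 0" using False gg by auto
  ultimately have n: "n > 0" by simp
  \<comment> \<open>This scalar makes \<open>v\<close>, which is \<open>f\<close> plus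
    \<open>t\<close> times \<open>g\<close>, orthogonal to \<open>g\<close>. The inequality is then
    nonnegativity of the squared norm of this projection residual.\<close>
  define t where "t = - ip f g / of_real n"
  define w where "w = (\<lambda>x. t * g x)"
  have w: "w \<in> H" unfolding w_def by (rule scale_mem[OF g])
  define v where "v = (\<lambda>x. f x + w x)"
  have v: "v \<in> H" unfolding v_def by (rule add_mem[OF f w])
  have wk: "ip w k = t * ip g k" if "k \<in> H" for k
    unfolding w_def by (rule ip_scale[OF g that])
  have "ip f v = cnj (ip v f)" by (rule ip_cnj[OF v f])
  also have "ip v f = ip f f + t * ip g f"
    unfolding v_def using ip_add[OF f w f] wk[OF f] by simp
  also have "cnj \<dots> = ip f f + cnj t * ip f g"
    using ip_cnj[OF f f] ip_cnj[OF f g] by simp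
  finally have fv: "ip f v = ip f f + cnj t * ip f g" .
  have "ip g v = cnj (ip v g)" by (rule ip_cnj[OF v g])
  also have "ip v g = ip f g + t * ip g g"
    unfolding v_def using ip_add[OF f w g] wk[OF g] by simp
  also have "\<dots> = 0" using n by (simp add: t_def gg)
  finally have gv: "ip g v = 0" by simp
  have "ip v v = ip f v + ip w v"
    using ip_add[OF f w v] by (simp add: v_def)
  also have "ip w v = 0" using wk[OF v] gv by simp
  finally have "ip v v = ip f f - of_real ((cmod (ip f g))\<^sup>2 / n)"
    unfolding fv t_def complex_norm_square of_real_divide by (simp add: mult.commute)
  then have "Re (ip f f) - (cmod (ip f g))\<^sup>2 / n \<ge> 0"
    using ip_nonneg[OF v] by simp
  then show ?thesis using n by (simp add: field_simps n_def)
qed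

end

text \<open>The functional is represented by a combination \<open>g\<close> of kernel sections, and
  the double sum is the squared norm of \<open>g\<close>, so the Cauchy-Schwarz inequality
  applies.\<close>

lemma (in rkhs) point_functional_bound:
  assumes A: "finite A" and p: "\<And>k. k \<in> A \<Longrightarrow> p k \<in> D" and f: "f \<in> H"
  shows "(cmod (\<Sum>k\<in>A. a k * f (p k)))\<^sup>2
    \<le> Re (ip f f) * Re (\<Sum>k\<in>A. \<Sum>l\<in>A. a k * cnj (a l) * K (p k) (p l))"
proof -
  define \<kappa> where "\<kappa> k = (\<lambda>x. if x \<in> D then K x (p k) else 0)" for k
  have \<kappa>: "\<kappa> k \<in> H" if "k \<in> A" for k unfolding \<kappa>_def by (rule kernel_mem[OF p[OF that]])
  \<comment> \<open>The coefficients are conjugated because the inner product is conjugate-linear in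
    its second argument.\<close>
  define g where "g = (\<lambda>x. \<Sum>k\<in>A. cnj (a k) * \<kappa> k x)"
  have g: "g \<in> H" unfolding g_def by (rule sum_mem[OF A \<kappa>])
  have ipg: "ip h g = (\<Sum>k\<in>A. a k * h (p k))" if h: "h \<in> H" for h
  proof -
    have "ip h g = cnj (ip g h)" by (rule ip_cnj[OF g h])
    also have "\<dots> = (\<Sum>k\<in>A. a k * cnj (ip (\<kappa> k) h))"
      unfolding g_def using ip_sum_left[OF A \<kappa> h] by simp
    also have "\<dots> = (\<Sum>k\<in>A. a k * h (p k))"
    proof (intro sum.cong refl)
      fix k assume k: "k \<in> A"
      show "a k * cnj (ip (\<kappa> k) h) = a k * h (p k)"
        using reproducing[OF h p[OF k]] ip_cnj[OF \<kappa>[OF k] h] by (simp add: \<kappa>_def)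
    qed
    finally show ?thesis .
  qed
  have "ip g g = (\<Sum>k\<in>A. \<Sum>l\<in>A. a k * cnj (a l) * K (p k) (p l))"
    unfolding ipg[OF g] by (intro sum.cong refl)
      (simp add: g_def \<kappa>_def p sum_distrib_left mult.assoc)
  then show ?thesis using Cauchy_Schwarz[OF f g] ipg[OF f] by simp
qed

section \<open>Kernels expanded in a discretely orthogonal system\<close>

lemma has_sum_sum:
  fixes f :: "'k \<Rightarrow> 'i \<Rightarrow> 'b::topological_comm_monoid_add"
  assumes "finite A" "\<And>k. k \<in> A \<Longrightarrow> (f k has_sum s k) I"
  shows "((\<lambda>i. \<Sum>k\<in>A. f k i) has_sum (\<Sum>k\<in>A. s k)) I"
  using assms by (induction A rule: finite_induct) (auto intro!: has_sum_add)

text \<open>The maps \<open>t n\<close> round points of \<open>D\<close> to finite grids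
  \<open>Z n\<close>. Each \<open>\<phi> i\<close> is constant on the cells of all fine enough
  grids, and distinct \<open>\<phi> i\<close> are orthogonal on them, so grid averages take the
  place of integrals before any measure is introduced.\<close>

locale kernel_expansion =
  fixes D :: "'x set" and I :: "'i set" and \<rho> :: "'i \<Rightarrow> real" and \<phi> :: "'i \<Rightarrow> 'x \<Rightarrow> complex"
    and K :: "'x \<Rightarrow> 'x \<Rightarrow> complex"
    and Z :: "nat \<Rightarrow> 'x set" and t :: "nat \<Rightarrow> 'x \<Rightarrow> 'x"
  assumes rho_pos: "i \<in> I \<Longrightarrow> \<rho> i > 0"
    and rho_summable: "\<rho> summable_on I"
    and phi_norm: "i \<in> I \<Longrightarrow> x \<in> D \<Longrightarrow> cmod (\<phi> i x) = 1"
    and K_eq: "x \<in> D \<Longrightarrow> y \<in> D \<Longrightarrow> K x y = (\<Sum>\<^sub>\<infinity>i\<in>I. of_real (\<rho> i) * \<phi> i x * cnj (\<phi> i y))"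
    and finite_Z: "finite (Z n)" and Z_nonempty: "Z n \<noteq> {}" and Z_subset: "Z n \<subseteq> D"
    and t_mem: "x \<in> D \<Longrightarrow> t n x \<in> Z n"
    and phi_t: "i \<in> I \<Longrightarrow> \<forall>\<^sub>F n in sequentially. \<forall>x\<in>D. \<phi> i (t n x) = \<phi> i x"
    and phi_ortho: "i \<in> I \<Longrightarrow> k \<in> I \<Longrightarrow> i \<noteq> k \<Longrightarrow>
      \<forall>\<^sub>F n in sequentially. (\<Sum>z\<in>Z n. \<phi> i z * cnj (\<phi> k z)) = 0"
begin

definition avg :: "nat \<Rightarrow> ('x \<Rightarrow> complex) \<Rightarrow> complex" where
  "avg n f = (\<Sum>z\<in>Z n. f z) / of_nat (card (Z n))"

lemma card_Z: "card (Z n) > 0"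
  using finite_Z Z_nonempty by (simp add: card_gt_0_iff)

lemma kernel_has_sum:
  assumes "x \<in> D" "y \<in> D"
  shows "((\<lambda>i. of_real (\<rho> i) * \<phi> i x * cnj (\<phi> i y)) has_sum K x y) I"
proof -
  have "(\<lambda>i. of_real (\<rho> i) * \<phi> i x * cnj (\<phi> i y)) summable_on I"
    by (rule abs_summable_summable, rule summable_on_comparison_test[OF rho_summable])
      (use assms in \<open>auto simp: norm_mult phi_norm less_imp_le[OF rho_pos]\<close>)
  then show ?thesis using K_eq[OF assms] by simp
qed

lemma functional_summable:
  fixes a :: "'k \<Rightarrow> complex"
  assumes "\<And>k. k \<in> A \<Longrightarrow> p k \<in> D"
  shows "(\<lambda>i. \<rho> i * (cmod (\<Sum>k\<in>A. a k * \<phi> i (p k)))\<^sup>2) summable_on I"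
proof (rule summable_on_comparison_test)
  show "(\<lambda>i. \<rho> i * (\<Sum>k\<in>A. cmod (a k))\<^sup>2) summable_on I"
    by (rule summable_on_cmult_left[OF rho_summable])
  fix i assume i: "i \<in> I"
  have "cmod (\<Sum>k\<in>A. a k * \<phi> i (p k)) \<le> (\<Sum>k\<in>A. cmod (a k))"
    by (rule sum_norm_le) (simp add: norm_mult phi_norm i assms)
  then show "\<rho> i * (cmod (\<Sum>k\<in>A. a k * \<phi> i (p k)))\<^sup>2 \<le> \<rho> i * (\<Sum>k\<in>A. cmod (a k))\<^sup>2"
    using rho_pos[OF i] by (intro mult_left_mono power_mono) auto
  show "0 \<le> \<rho> i * (cmod (\<Sum>k\<in>A. a k * \<phi> i (p k)))\<^sup>2"
    using rho_pos[OF i] by simp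
qed

text \<open>Inserting the expansion of \<open>K\<close> and exchanging the finite sums with the
  series leaves, for each \<open>i\<close>, the product of a finite sum with its own
  conjugate.\<close>

lemma kernel_quadratic_form:
  assumes A: "finite A" and p: "\<And>k. k \<in> A \<Longrightarrow> p k \<in> D"
  shows "(\<Sum>k\<in>A. \<Sum>l\<in>A. a k * cnj (a l) * K (p k) (p l))
    = of_real (\<Sum>\<^sub>\<infinity>i\<in>I. \<rho> i * (cmod (\<Sum>k\<in>A. a k * \<phi> i (p k)))\<^sup>2)"
proof -
  let ?g = "\<lambda>i. \<rho> i * (cmod (\<Sum>k\<in>A. a k * \<phi> i (p k)))\<^sup>2"
  have 1: "((\<lambda>i. \<Sum>k\<in>A. \<Sum>l\<in>A. a k * cnj (a l) * (of_real (\<rho> i) * \<phi> i (p k) * cnj (\<phi> i (p l))))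
      has_sum (\<Sum>k\<in>A. \<Sum>l\<in>A. a k * cnj (a l) * K (p k) (p l))) I"
    by (intro has_sum_sum A has_sum_cmult_right kernel_has_sum p)
  have 2: "(\<Sum>k\<in>A. \<Sum>l\<in>A. a k * cnj (a l) * (of_real (\<rho> i) * \<phi> i (p k) * cnj (\<phi> i (p l))))
      = of_real (?g i)" for i
    unfolding of_real_mult complex_norm_square cnj_sum sum_product
    by (simp only: sum_distrib_left) (intro sum.cong refl, simp add: mult_ac)
  have 3: "((\<lambda>i. of_real (?g i)) has_sum (of_real (infsum ?g I) :: complex)) I"
    by (rule has_sum_of_real[OF has_sum_infsum[OF functional_summable[OF p]]])
  show ?thesis using has_sum_unique[OF 1[unfolded 2] 3] .
qed

text \<open>Only the kernel enters the series on the right, so the bound takes the same form in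
  every space over which \<open>rkhs_unit_ball\<close> ranges.\<close>

lemma rkhs_functional_bound:
  assumes "rkhs D K H ip" "finite A" "\<And>k. k \<in> A \<Longrightarrow> p k \<in> D" "f \<in> H"
  shows "(cmod (\<Sum>k\<in>A. a k * f (p k)))\<^sup>2
    \<le> Re (ip f f) * (\<Sum>\<^sub>\<infinity>i\<in>I. \<rho> i * (cmod (\<Sum>k\<in>A. a k * \<phi> i (p k)))\<^sup>2)"
  using rkhs.point_functional_bound[OF assms(1,2) _ assms(4), of p a] assms(3)
  by (simp add: kernel_quadratic_form[OF assms(2,3)])

text \<open>Indices whose \<open>\<phi> i\<close> is already constant on the cells of level
  \<open>n\<close> cost nothing. For the others the values at \<open>x\<close> and
  \<open>t n x\<close> have modulus 1 and differ by at most 2, whence the factor 4 after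
  squaring.\<close>

definition trunc_err :: "nat \<Rightarrow> real" where
  "trunc_err n = (\<Sum>\<^sub>\<infinity>i\<in>I. if \<forall>x\<in>D. \<phi> i (t n x) = \<phi> i x then 0 else 4 * \<rho> i)"

lemma trunc_err_tendsto: "trunc_err \<longlonglongrightarrow> 0"
proof -
  have "trunc_err \<longlonglongrightarrow> (\<Sum>\<^sub>\<infinity>i\<in>I. 0)"
    unfolding trunc_err_def
  proof (rule tendsto_infsum_eventually_eq)
    show "(\<lambda>i. 4 * \<rho> i) summable_on I" by (rule summable_on_cmult_right[OF rho_summable])
  next
    fix i assume i: "i \<in> I"
    show "\<forall>\<^sub>F n in sequentially. (if \<forall>x\<in>D. \<phi> i (t n x) = \<phi> i x then 0 else 4 * \<rho> i) = 0"
      using phi_t[OF i] by eventually_elim simp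
  next
    fix i n assume "i \<in> I"
    then show "norm (if \<forall>x\<in>D. \<phi> i (t n x) = \<phi> i x then 0 else 4 * \<rho> i) \<le> 4 * \<rho> i"
      using rho_pos[of i] by simp
  qed
  then show ?thesis by simp
qed

text \<open>The right-hand side does not depend on \<open>x\<close>, so together with
  \<open>trunc_err_tendsto\<close> every member of the space is a uniform limit of step functions on
  the cells.\<close>

lemma rkhs_trunc_bound:
  assumes "rkhs D K H ip" "f \<in> H" "x \<in> D"
  shows "(cmod (f x - f (t n x)))\<^sup>2 \<le> Re (ip f f) * trunc_err n"
proof -
  interpret rkhs D K H ip by fact
  \<comment> \<open>The difference of the values at \<open>x\<close> and \<open>t n x\<close> is a
    two-point functional, indexed by \<open>bool\<close>, with weights 1 and -1.\<close>
  define p where "p k = (if k then x else t n x)" for k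
  define a :: "bool \<Rightarrow> complex" where "a k = (if k then 1 else -1)" for k
  have p: "p k \<in> D" for k using assms(3) t_mem[OF assms(3), of n] Z_subset[of n] by (auto simp: p_def)
  have S: "(\<Sum>k\<in>UNIV. a k * h (p k)) = h x - h (t n x)" for h :: "'x \<Rightarrow> complex"
    by (simp add: UNIV_bool p_def a_def)
  have "(cmod (\<Sum>k\<in>UNIV. a k * f (p k)))\<^sup>2
      \<le> Re (ip f f) * (\<Sum>\<^sub>\<infinity>i\<in>I. \<rho> i * (cmod (\<Sum>k\<in>UNIV. a k * \<phi> i (p k)))\<^sup>2)"
    by (rule rkhs_functional_bound[OF assms(1) finite p assms(2)])
  also have "\<dots> \<le> Re (ip f f) * trunc_err n"
  proof (rule mult_left_mono[OF _ ip_nonneg[OF assms(2)]])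
    show "(\<Sum>\<^sub>\<infinity>i\<in>I. \<rho> i * (cmod (\<Sum>k\<in>UNIV. a k * \<phi> i (p k)))\<^sup>2) \<le> trunc_err n"
      unfolding trunc_err_def
    proof (rule infsum_mono[OF functional_summable[OF p]])
      show "(\<lambda>i. if \<forall>x\<in>D. \<phi> i (t n x) = \<phi> i x then 0 else 4 * \<rho> i) summable_on I"
        by (rule summable_on_comparison_test[OF summable_on_cmult_right[OF rho_summable, of 4]])
          (auto simp: less_imp_le[OF rho_pos])
      fix i assume i: "i \<in> I"
      have "cmod (\<phi> i x - \<phi> i (t n x)) \<le> 2"
        using norm_triangle_ineq4[of "\<phi> i x" "\<phi> i (t n x)"] p[of True] p[of False] phi_norm[OF i]
        by (simp add: p_def)
      then have "(cmod (\<phi> i x - \<phi> i (t n x)))\<^sup>2 \<le> 2\<^sup>2" by (intro power_mono) auto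
      then show "\<rho> i * (cmod (\<Sum>k\<in>UNIV. a k * \<phi> i (p k)))\<^sup>2
          \<le> (if \<forall>x\<in>D. \<phi> i (t n x) = \<phi> i x then 0 else 4 * \<rho> i)"
        unfolding S using rho_pos[OF i] assms(3) by auto
    qed
  qed
  finally show ?thesis unfolding S .
qed

section \<open>The space of series with weighted square-summable coefficients\<close>

definition l2 :: "('i \<Rightarrow> complex) \<Rightarrow> bool" where
  "l2 c \<longleftrightarrow> (\<lambda>i. (cmod (c i))\<^sup>2 / \<rho> i) summable_on I"

definition syn :: "('i \<Rightarrow> complex) \<Rightarrow> 'x \<Rightarrow> complex" where
  "syn c = (\<lambda>x. if x \<in> D then \<Sum>\<^sub>\<infinity>i\<in>I. c i * \<phi> i x else 0)"

text \<open>A Fourier coefficient, obtained as a limit of grid averages. Reading coefficients off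
  the function makes \<open>wip\<close> depend on functions rather than on a chosen representation
  by \<open>syn\<close>.\<close>

definition coef :: "('x \<Rightarrow> complex) \<Rightarrow> 'i \<Rightarrow> complex" where
  "coef f i = lim (\<lambda>n. avg n (\<lambda>z. f z * cnj (\<phi> i z)))"

definition wip :: "('x \<Rightarrow> complex) \<Rightarrow> ('x \<Rightarrow> complex) \<Rightarrow> complex" where
  "wip f g = (\<Sum>\<^sub>\<infinity>i\<in>I. coef f i * cnj (coef g i) / of_real (\<rho> i))"

definition wspace :: "('x \<Rightarrow> complex) set" where
  "wspace = {syn c | c. l2 c}"

text \<open>The term \<open>cmod (c i)\<close> is dominated by its square divided by
  \<open>\<rho> i\<close> plus \<open>\<rho> i\<close>, by the inequality between arithmetic and
  geometric means. As \<open>\<phi> i\<close> has modulus 1 on \<open>D\<close>, the series in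
  \<open>syn\<close> converges absolutely.\<close>

lemma l2_norm_summable:
  assumes "l2 c"
  shows "(\<lambda>i. cmod (c i)) summable_on I"
proof (rule summable_on_comparison_test)
  show "(\<lambda>i. (cmod (c i))\<^sup>2 / \<rho> i + \<rho> i) summable_on I"
    using assms rho_summable unfolding l2_def by (rule summable_on_add)
  fix i assume i: "i \<in> I"
  have "cmod (c i) * \<rho> i \<le> (cmod (c i))\<^sup>2 + \<rho> i * \<rho> i"
    using sum_squares_bound[of "cmod (c i)" "\<rho> i"] mult_nonneg_nonneg[OF norm_ge_zero[of "c i"] less_imp_le[OF rho_pos[OF i]]]
    unfolding power2_eq_square mult.assoc by linarith
  then show "cmod (c i) \<le> (cmod (c i))\<^sup>2 / \<rho> i + \<rho> i"
    using rho_pos[OF i] by (simp add: field_simps)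
qed simp

lemma syn_has_sum:
  assumes "l2 c" "x \<in> D"
  shows "((\<lambda>i. c i * \<phi> i x) has_sum syn c x) I"
proof -
  have "(\<lambda>i. c i * \<phi> i x) summable_on I"
    by (rule abs_summable_summable, rule summable_on_comparison_test[OF l2_norm_summable[OF assms(1)]])
      (use assms(2) in \<open>auto simp: norm_mult phi_norm\<close>)
  then show ?thesis using assms(2) by (simp add: syn_def)
qed

lemma l2_scale: "l2 c \<Longrightarrow> l2 (\<lambda>i. a * c i)"
  unfolding l2_def
  by (drule summable_on_cmult_right[of _ _ "(cmod a)\<^sup>2"]) (simp add: norm_mult power_mult_distrib)

lemma l2_add:
  assumes "l2 c" "l2 d"
  shows "l2 (\<lambda>i. c i + d i)"
  unfolding l2_def
proof (rule summable_on_comparison_test)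
  show "(\<lambda>i. 2 * ((cmod (c i))\<^sup>2 / \<rho> i + (cmod (d i))\<^sup>2 / \<rho> i)) summable_on I"
    using assms unfolding l2_def by (intro summable_on_cmult_right summable_on_add)
  fix i assume i: "i \<in> I"
  have "(cmod (c i + d i))\<^sup>2 \<le> (cmod (c i) + cmod (d i))\<^sup>2"
    by (intro power_mono norm_triangle_ineq) auto
  also have "\<dots> \<le> 2 * ((cmod (c i))\<^sup>2 + (cmod (d i))\<^sup>2)"
    using sum_squares_bound[of "cmod (c i)" "cmod (d i)"] by (simp add: power2_sum)
  finally show "(cmod (c i + d i))\<^sup>2 / \<rho> i \<le> 2 * ((cmod (c i))\<^sup>2 / \<rho> i + (cmod (d i))\<^sup>2 / \<rho> i)"
    using rho_pos[OF i] by (simp add: field_simps)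
  show "0 \<le> (cmod (c i + d i))\<^sup>2 / \<rho> i" using rho_pos[OF i] by simp
qed

lemma l2_diff: "l2 c \<Longrightarrow> l2 d \<Longrightarrow> l2 (\<lambda>i. c i - d i)"
  using l2_add[of c "\<lambda>i. (-1) * d i"] l2_scale[of d "-1"] by simp

lemma syn_add: "l2 c \<Longrightarrow> l2 d \<Longrightarrow> syn (\<lambda>i. c i + d i) = (\<lambda>x. syn c x + syn d x)"
proof
  fix x assume cd: "l2 c" "l2 d"
  show "syn (\<lambda>i. c i + d i) x = syn c x + syn d x"
  proof (cases "x \<in> D")
    case True
    have "((\<lambda>i. (c i + d i) * \<phi> i x) has_sum (syn c x + syn d x)) I"
      using has_sum_add[OF syn_has_sum[OF cd(1) True] syn_has_sum[OF cd(2) True]]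
      by (simp add: distrib_right)
    then show ?thesis using has_sum_unique syn_has_sum[OF l2_add[OF cd] True] by blast
  qed (simp add: syn_def)
qed

lemma syn_scale: "l2 c \<Longrightarrow> syn (\<lambda>i. a * c i) = (\<lambda>x. a * syn c x)"
  by (auto simp: syn_def fun_eq_iff mult.assoc infsum_cmult_right')

lemma syn_diff: "l2 c \<Longrightarrow> l2 d \<Longrightarrow> syn (\<lambda>i. c i - d i) = (\<lambda>x. syn c x - syn d x)"
  using syn_add[of c "\<lambda>i. (-1) * d i"] l2_scale[of d "-1"] syn_scale[of d "-1"] by simp

text \<open>For each \<open>i\<close> the grid average of \<open>\<phi> i\<close> against the
  conjugate of \<open>\<phi> k\<close> is eventually 1 or 0, and it is bounded by 1, so the series
  passes to the limit under the dominating function \<open>cmod (c i)\<close>. Hence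
  \<open>syn\<close> determines its coefficients on \<open>I\<close>.\<close>

lemma avg_syn_tendsto:
  assumes c: "l2 c" and k: "k \<in> I"
  shows "(\<lambda>n. avg n (\<lambda>z. syn c z * cnj (\<phi> k z))) \<longlonglongrightarrow> c k"
proof -
  let ?a = "\<lambda>n i. c i * avg n (\<lambda>z. \<phi> i z * cnj (\<phi> k z))"
  have eq: "avg n (\<lambda>z. syn c z * cnj (\<phi> k z)) = (\<Sum>\<^sub>\<infinity>i\<in>I. ?a n i)" for n
  proof -
    have "((\<lambda>i. (\<Sum>z\<in>Z n. (c i * \<phi> i z) * cnj (\<phi> k z)) / of_nat (card (Z n))) has_sum
        avg n (\<lambda>z. syn c z * cnj (\<phi> k z))) I"
      unfolding avg_def divide_inverse
      by (intro has_sum_cmult_left has_sum_sum finite_Z syn_has_sum[OF c]) (use Z_subset in auto)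
    then have "((\<lambda>i. ?a n i) has_sum avg n (\<lambda>z. syn c z * cnj (\<phi> k z))) I"
      by (simp add: avg_def sum_distrib_left mult.assoc)
    then show ?thesis by (simp add: infsumI)
  qed
  have "(\<lambda>n. \<Sum>\<^sub>\<infinity>i\<in>I. ?a n i) \<longlonglongrightarrow> (\<Sum>\<^sub>\<infinity>i\<in>I. if i = k then c i else 0)"
  proof (rule tendsto_infsum_eventually_eq[OF l2_norm_summable[OF c]])
    fix n i assume i: "i \<in> I"
    have "cmod (\<Sum>z\<in>Z n. \<phi> i z * cnj (\<phi> k z)) \<le> (\<Sum>z\<in>Z n. 1)"
      by (rule sum_norm_le) (use Z_subset[of n] in \<open>auto simp: norm_mult subset_eq phi_norm i k\<close>)
    then have "cmod (avg n (\<lambda>z. \<phi> i z * cnj (\<phi> k z))) \<le> 1"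
      using card_Z[of n] by (simp add: avg_def norm_divide)
    then show "norm (?a n i) \<le> cmod (c i)"
      by (simp add: norm_mult mult_left_le)
  next
    fix i assume i: "i \<in> I"
    show "\<forall>\<^sub>F n in sequentially. ?a n i = (if i = k then c i else 0)"
    proof (cases "i = k")
      case True
      have "(\<Sum>z\<in>Z n. \<phi> k z * cnj (\<phi> k z)) = of_nat (card (Z n))" for n
      proof -
        have "(\<Sum>z\<in>Z n. \<phi> k z * cnj (\<phi> k z)) = (\<Sum>z\<in>Z n. 1)"
          using Z_subset[of n] phi_norm[OF k] by (intro sum.cong) (auto simp: subset_eq complex_norm_square[symmetric] simp del: of_real_power)
        then show ?thesis by simp
      qed
      then show ?thesis using True card_Z by (simp add: avg_def)
    next
      case False
      show ?thesis
        using phi_ortho[OF i k False] by eventually_elim (use False in \<open>simp add: avg_def\<close>)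
    qed
  qed
  also have "(\<Sum>\<^sub>\<infinity>i\<in>I. if i = k then c i else 0) = (\<Sum>\<^sub>\<infinity>i\<in>{k}. c i)"
    by (rule infsum_cong_neutral) (use k in auto)
  finally show ?thesis using eq by simp
qed

lemma coef_syn: "l2 c \<Longrightarrow> k \<in> I \<Longrightarrow> coef (syn c) k = c k"
  unfolding coef_def by (rule limI[OF avg_syn_tendsto])

lemma wip_syn: "l2 c \<Longrightarrow> l2 d \<Longrightarrow> wip (syn c) (syn d) = (\<Sum>\<^sub>\<infinity>i\<in>I. c i * cnj (d i) / of_real (\<rho> i))"
  unfolding wip_def by (rule infsum_cong) (simp add: coef_syn)

lemma wip_summable:
  assumes "l2 c" "l2 d"
  shows "(\<lambda>i. c i * cnj (d i) / of_real (\<rho> i)) summable_on I"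
proof (rule abs_summable_summable, rule summable_on_comparison_test)
  show "(\<lambda>i. (cmod (c i))\<^sup>2 / \<rho> i + (cmod (d i))\<^sup>2 / \<rho> i) summable_on I"
    using assms unfolding l2_def by (rule summable_on_add)
  fix i assume i: "i \<in> I"
  have "cmod (c i) * cmod (d i) \<le> (cmod (c i))\<^sup>2 + (cmod (d i))\<^sup>2"
    using sum_squares_bound[of "cmod (c i)" "cmod (d i)"] mult_nonneg_nonneg[OF norm_ge_zero[of "c i"] norm_ge_zero[of "d i"]]
    unfolding mult.assoc by linarith
  then show "cmod (c i * cnj (d i) / of_real (\<rho> i)) \<le> (cmod (c i))\<^sup>2 / \<rho> i + (cmod (d i))\<^sup>2 / \<rho> i"
    using rho_pos[OF i] by (simp add: norm_mult norm_divide field_simps)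
qed simp

lemma wip_self:
  assumes "l2 c"
  shows "wip (syn c) (syn c) = of_real (\<Sum>\<^sub>\<infinity>i\<in>I. (cmod (c i))\<^sup>2 / \<rho> i)"
proof -
  have "((\<lambda>i. of_real ((cmod (c i))\<^sup>2 / \<rho> i)) has_sum
      (of_real (\<Sum>\<^sub>\<infinity>i\<in>I. (cmod (c i))\<^sup>2 / \<rho> i) :: complex)) I"
    using assms unfolding l2_def by (intro has_sum_of_real has_sum_infsum)
  then show ?thesis
    unfolding wip_syn[OF assms assms] of_real_divide complex_norm_square by (rule infsumI)
qed

text \<open>The classical completeness proof for weighted square-summable sequences: the
  coefficients converge one by one, and bounds on finite partial sums survive this limit.\<close>

lemma wspace_complete:
  fixes X :: "nat \<Rightarrow> 'x \<Rightarrow> complex"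
  assumes X: "\<And>n. X n \<in> wspace"
    and cauchy: "\<And>e::real. e > 0 \<Longrightarrow> \<exists>M. \<forall>i\<ge>M. \<forall>j\<ge>M.
        sqrt (Re (wip (\<lambda>x. X i x - X j x) (\<lambda>x. X i x - X j x))) < e"
  shows "\<exists>f\<in>wspace. (\<lambda>n. sqrt (Re (wip (\<lambda>x. X n x - f x) (\<lambda>x. X n x - f x)))) \<longlonglongrightarrow> 0"
proof -
  obtain C where C: "\<And>n. l2 (C n)" "\<And>n. X n = syn (C n)"
    using X unfolding wspace_def by simp metis
  let ?nrm = "\<lambda>c. \<Sum>\<^sub>\<infinity>k\<in>I. (cmod (c k))\<^sup>2 / \<rho> k"
  have nonneg: "0 \<le> (cmod (c k))\<^sup>2 / \<rho> k" if "k \<in> I" for c :: "'i \<Rightarrow> complex" and k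
    using rho_pos[OF that] by simp
  have Xd: "Re (wip (\<lambda>x. X i x - X j x) (\<lambda>x. X i x - X j x)) = ?nrm (\<lambda>k. C i k - C j k)" for i j
    using wip_self[OF l2_diff[OF C(1)[of i] C(1)[of j]]] by (simp add: C(2) syn_diff C(1))
  have fin: "(\<Sum>k\<in>F. (cmod (C i k - C j k))\<^sup>2 / \<rho> k) \<le> ?nrm (\<lambda>k. C i k - C j k)"
    if "finite F" "F \<subseteq> I" for i j F
    using l2_diff[OF C(1)[of i] C(1)[of j]] that unfolding l2_def
    by (intro finite_sum_le_infsum nonneg) auto
  \<comment> \<open>Finite partial sums are continuous in the coefficients, unlike the full series,
    so the Cauchy condition is recorded for them.\<close>
  have cau: "\<exists>M. \<forall>i\<ge>M. \<forall>j\<ge>M. \<forall>F. finite F \<longrightarrow> F \<subseteq> I \<longrightarrow>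
      (\<Sum>k\<in>F. (cmod (C i k - C j k))\<^sup>2 / \<rho> k) \<le> e\<^sup>2" if e: "e > 0" for e
  proof -
    obtain M where M: "\<And>i j. i \<ge> M \<Longrightarrow> j \<ge> M \<Longrightarrow> sqrt (?nrm (\<lambda>k. C i k - C j k)) < e"
      using cauchy[OF e] unfolding Xd by blast
    have "(\<Sum>k\<in>F. (cmod (C i k - C j k))\<^sup>2 / \<rho> k) \<le> e\<^sup>2"
      if "i \<ge> M" "j \<ge> M" "finite F" "F \<subseteq> I" for i j F
    proof -
      have "?nrm (\<lambda>k. C i k - C j k) \<le> e\<^sup>2"
        using M[OF that(1,2)] e by (intro sqrt_le_D less_imp_le)
      then show ?thesis using fin[OF that(3,4), of i j] by simp
    qed
    then show ?thesis by blast
  qed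
  have "convergent (\<lambda>n. C n k)" if k: "k \<in> I" for k
  proof (rule Cauchy_convergent, rule metric_CauchyI)
    fix e :: real assume e: "e > 0"
    \<comment> \<open>The single term for \<open>k\<close> carries the factor
      \<open>1 / \<rho> k\<close>, which this choice undoes; the half turns the resulting weak
      inequality into a strict one.\<close>
    define e' where "e' = e / 2 / sqrt (\<rho> k)"
    have "e' > 0" using e rho_pos[OF k] by (simp add: e'_def)
    from cau[OF this] obtain M where "\<forall>i\<ge>M. \<forall>j\<ge>M. \<forall>F. finite F \<longrightarrow> F \<subseteq> I \<longrightarrow>
      (\<Sum>k\<in>F. (cmod (C i k - C j k))\<^sup>2 / \<rho> k) \<le> e'\<^sup>2" ..
    note M = this[rule_format]
    have "dist (C i k) (C j k) < e" if ij: "i \<ge> M" "j \<ge> M" for i j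
    proof -
      have "(cmod (C i k - C j k))\<^sup>2 \<le> (e / 2)\<^sup>2"
        using M[OF ij, of "{k}"] k rho_pos[OF k]
        by (simp add: e'_def power_divide field_simps)
      then have "cmod (C i k - C j k) \<le> e / 2" using e power2_le_imp_le[of _ "e / 2"] by simp
      then show ?thesis using e by (simp add: dist_norm)
    qed
    then show "\<exists>M. \<forall>m\<ge>M. \<forall>n\<ge>M. dist (C m k) (C n k) < e" by blast
  qed
  then obtain c where c: "\<And>k. k \<in> I \<Longrightarrow> (\<lambda>n. C n k) \<longlonglongrightarrow> c k"
    unfolding convergent_def by metis
  have lim: "\<exists>M. \<forall>i\<ge>M. l2 (\<lambda>k. C i k - c k) \<and> ?nrm (\<lambda>k. C i k - c k) \<le> e\<^sup>2" if e: "e > 0" for e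
  proof -
    from cau[OF e] obtain M where "\<forall>i\<ge>M. \<forall>j\<ge>M. \<forall>F. finite F \<longrightarrow> F \<subseteq> I \<longrightarrow>
      (\<Sum>k\<in>F. (cmod (C i k - C j k))\<^sup>2 / \<rho> k) \<le> e\<^sup>2" ..
    note M = this[rule_format]
    have bd: "(\<Sum>k\<in>F. (cmod (C i k - c k))\<^sup>2 / \<rho> k) \<le> e\<^sup>2"
      if i: "i \<ge> M" and F: "finite F" "F \<subseteq> I" for i F
    proof (rule tendsto_upperbound)
      show "(\<lambda>j. \<Sum>k\<in>F. (cmod (C i k - C j k))\<^sup>2 / \<rho> k) \<longlonglongrightarrow> (\<Sum>k\<in>F. (cmod (C i k - c k))\<^sup>2 / \<rho> k)"
        using F(2) c rho_pos by (intro tendsto_intros) force+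
      show "\<forall>\<^sub>F j in sequentially. (\<Sum>k\<in>F. (cmod (C i k - C j k))\<^sup>2 / \<rho> k) \<le> e\<^sup>2"
        using M[OF i _ F] by (auto simp: eventually_sequentially)
    qed simp
    have "l2 (\<lambda>k. C i k - c k)" if i: "i \<ge> M" for i
      unfolding l2_def
      by (rule nonneg_bdd_above_summable_on[OF nonneg]) (use bd[OF i] in \<open>auto intro!: bdd_aboveI\<close>)
    moreover have "?nrm (\<lambda>k. C i k - c k) \<le> e\<^sup>2" if i: "i \<ge> M" for i
      using calculation[OF i] bd[OF i] unfolding l2_def by (intro infsum_le_finite_sums)
    ultimately show ?thesis by blast
  qed
  obtain M where "l2 (\<lambda>k. C M k - c k)" using lim[of 1] by auto
  \<comment> \<open>The limit \<open>c\<close> is the difference of \<open>C M\<close> and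
    \<open>C M - c\<close>, both of which are square-summable.\<close>
  from l2_diff[OF C(1)[of M] this] have c2: "l2 c" by simp
  have Xc: "Re (wip (\<lambda>x. X i x - syn c x) (\<lambda>x. X i x - syn c x)) = ?nrm (\<lambda>k. C i k - c k)" for i
    using wip_self[OF l2_diff[OF C(1)[of i] c2]] by (simp add: C(2) syn_diff C(1) c2)
  show ?thesis
  proof (intro bexI[of _ "syn c"] LIMSEQ_I)
    fix e :: real assume e: "e > 0"
    then obtain M where M: "\<And>i. i \<ge> M \<Longrightarrow> ?nrm (\<lambda>k. C i k - c k) \<le> (e/2)\<^sup>2"
      using lim[of "e/2"] by auto
    have "sqrt (?nrm (\<lambda>k. C i k - c k)) < e" if "i \<ge> M" for i
      using real_sqrt_le_mono[OF M[OF that]] e by simp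
    moreover have "?nrm (\<lambda>k. C i k - c k) \<ge> 0" for i
      by (rule infsum_nonneg[OF nonneg])
    ultimately show "\<exists>M. \<forall>n\<ge>M. norm (sqrt (Re (wip (\<lambda>x. X n x - syn c x) (\<lambda>x. X n x - syn c x))) - 0) < e"
      unfolding Xc by auto
  qed (use c2 in \<open>auto simp: wspace_def\<close>)
qed

lemma l2_zero: "l2 (\<lambda>i. 0)"
  by (simp add: l2_def)

lemma syn_zero: "syn (\<lambda>i. 0) = (\<lambda>x. 0)"
  by (simp add: syn_def fun_eq_iff)

lemma wspaceE:
  assumes "f \<in> wspace" obtains c where "l2 c" "f = syn c"
  using assms by (auto simp: wspace_def)

text \<open>The coefficients of the section at \<open>y\<close> are \<open>\<rho> i\<close> times
  the conjugate of \<open>\<phi> i y\<close>; their weighted squares reduce to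
  \<open>\<rho> i\<close>, which is summable.\<close>

lemma kernel_section:
  assumes y: "y \<in> D"
  shows "l2 (\<lambda>i. of_real (\<rho> i) * cnj (\<phi> i y))"
    "(\<lambda>x. if x \<in> D then K x y else 0) = syn (\<lambda>i. of_real (\<rho> i) * cnj (\<phi> i y))"
proof -
  show "l2 (\<lambda>i. of_real (\<rho> i) * cnj (\<phi> i y))"
    unfolding l2_def
    by (rule summable_on_cong[THEN iffD1, OF _ rho_summable])
      (use rho_pos in \<open>force simp: norm_mult phi_norm[OF _ y] power2_eq_square\<close>)
  show "(\<lambda>x. if x \<in> D then K x y else 0) = syn (\<lambda>i. of_real (\<rho> i) * cnj (\<phi> i y))"
    by (auto simp: syn_def fun_eq_iff K_eq[OF _ y] mult_ac)
qed

text \<open>This concrete space is the witness that places the extremal function in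
  \<open>rkhs_unit_ball\<close>.\<close>

lemma rkhs_wspace: "rkhs D K wspace wip"
proof unfold_locales
  fix f g h :: "'x \<Rightarrow> complex" and x y :: 'x and a :: complex
  show "(\<lambda>x. 0) \<in> wspace" unfolding wspace_def using l2_zero syn_zero by (metis (mono_tags) mem_Collect_eq)
  show "f x = 0" if "f \<in> wspace" "x \<notin> D" using that by (auto simp: wspace_def syn_def)
  show "(\<lambda>x. f x + g x) \<in> wspace" if fg: "f \<in> wspace" "g \<in> wspace"
  proof -
    obtain c d where "l2 c" "f = syn c" "l2 d" "g = syn d" using fg by (auto elim!: wspaceE)
    then show ?thesis unfolding wspace_def using l2_add[of c d] syn_add[of c d, symmetric] by blast
  qed
  show "(\<lambda>x. a * f x) \<in> wspace" if f: "f \<in> wspace"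
  proof -
    obtain c where "l2 c" "f = syn c" using f by (auto elim!: wspaceE)
    then show ?thesis unfolding wspace_def using l2_scale[of c a] syn_scale[of c a, symmetric] by blast
  qed
  show "wip (\<lambda>x. f x + g x) h = wip f h + wip g h" if fgh: "f \<in> wspace" "g \<in> wspace" "h \<in> wspace"
  proof -
    obtain c d e where *: "l2 c" "f = syn c" "l2 d" "g = syn d" "l2 e" "h = syn e"
      using fgh by (auto elim!: wspaceE)
    show ?thesis
      unfolding * syn_add[OF *(1,3), symmetric]
        wip_syn[OF l2_add[OF *(1,3)] *(5)] wip_syn[OF *(1,5)] wip_syn[OF *(3,5)]
      using infsum_add[OF wip_summable[OF *(1,5)] wip_summable[OF *(3,5)]]
      by (simp add: distrib_right add_divide_distrib)
  qed
  show "wip (\<lambda>x. a * f x) g = a * wip f g" if fg: "f \<in> wspace" "g \<in> wspace"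
  proof -
    obtain c d where *: "l2 c" "f = syn c" "l2 d" "g = syn d" using fg by (auto elim!: wspaceE)
    show ?thesis
      unfolding * syn_scale[OF *(1), symmetric] wip_syn[OF l2_scale[OF *(1)] *(3)] wip_syn[OF *(1,3)]
        infsum_cmult_right'[symmetric] by (simp add: mult.assoc)
  qed
  show "wip g f = cnj (wip f g)" unfolding wip_def infsum_cnj[symmetric] by (simp add: mult.commute)
  show "0 \<le> Re (wip f f)" if f: "f \<in> wspace"
  proof -
    obtain c where *: "l2 c" "f = syn c" using f by (auto elim!: wspaceE)
    show ?thesis unfolding * wip_self[OF *(1)]
      using infsum_nonneg[of I "\<lambda>i. (cmod (c i))\<^sup>2 / \<rho> i"] rho_pos by (simp add: less_imp_le)
  qed
  show "f = (\<lambda>x. 0)" if f: "f \<in> wspace" and 0: "wip f f = 0"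
  proof -
    obtain c where *: "l2 c" "f = syn c" using f by (auto elim!: wspaceE)
    have "(\<Sum>\<^sub>\<infinity>i\<in>I. (cmod (c i))\<^sup>2 / \<rho> i) = 0" using 0 unfolding * wip_self[OF *(1)] by simp
    then have "(cmod (c i))\<^sup>2 / \<rho> i = 0" if "i \<in> I" for i
      using *(1) that rho_pos
      by (intro nonneg_infsum_le_0D[of "\<lambda>i. (cmod (c i))\<^sup>2 / \<rho> i" I]) (auto simp: l2_def less_imp_le)
    then have "c i = 0" if "i \<in> I" for i using that rho_pos[OF that] by fastforce
    then show ?thesis unfolding *(2) syn_def by (auto simp: fun_eq_iff intro!: infsum_0)
  qed
  show "(\<lambda>x. if x \<in> D then K x y else 0) \<in> wspace" if y: "y \<in> D"
    using kernel_section[OF y] by (auto simp: wspace_def)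
  show "f y = wip f (\<lambda>x. if x \<in> D then K x y else 0)" if f: "f \<in> wspace" and y: "y \<in> D"
  proof -
    obtain c where *: "l2 c" "f = syn c" using f by (auto elim!: wspaceE)
    have "(\<Sum>\<^sub>\<infinity>i\<in>I. c i * cnj (of_real (\<rho> i) * cnj (\<phi> i y)) / of_real (\<rho> i)) = (\<Sum>\<^sub>\<infinity>i\<in>I. c i * \<phi> i y)"
      by (rule infsum_cong) (use rho_pos in force)
    then show ?thesis
      unfolding * kernel_section(2)[OF y] wip_syn[OF *(1) kernel_section(1)[OF y]]
      using y by (simp add: syn_def)
  qed
qed (rule wspace_complete)

end

section \<open>Integration and the worst-case error of a quadrature rule\<close>

text \<open>All cells of a level have the same measure, so \<open>avg n f\<close> is the integral
  over \<open>D\<close> of the step function taking the value \<open>f (t n x)\<close> at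
  \<open>x\<close>. The index \<open>i0\<close> belongs to the constant function 1, which every
  equal-weight rule integrates exactly.\<close>

locale kernel_quadrature = kernel_expansion +
  fixes M :: "'a measure" and i0 :: 'b
  assumes cell_sets: "z \<in> Z n \<Longrightarrow> {x \<in> D. t n x = z} \<in> sets M"
    and cell_emeasure: "z \<in> Z n \<Longrightarrow> emeasure M {x \<in> D. t n x = z} = ennreal (1 / real (card (Z n)))"
    and i0: "i0 \<in> I" and phi_i0: "x \<in> D \<Longrightarrow> \<phi> i0 x = 1"
begin

lemma D_sets: "D \<in> sets M"
proof -
  have "D = (\<Union>z\<in>Z 0. {x \<in> D. t 0 x = z})" using t_mem by auto
  also have "\<dots> \<in> sets M" using finite_Z cell_sets by (intro sets.finite_UN) auto
  finally show ?thesis .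
qed

lemma D_finite: "emeasure M D < \<infinity>"
proof -
  have "D = (\<Union>z\<in>Z 0. {x \<in> D. t 0 x = z})" using t_mem by auto
  then have "emeasure M D \<le> (\<Sum>z\<in>Z 0. emeasure M {x \<in> D. t 0 x = z})"
    using emeasure_subadditive_finite[of "Z 0" "\<lambda>z. {x \<in> D. t 0 x = z}" M] finite_Z cell_sets
    by (auto simp: image_subset_iff)
  also have "\<dots> < \<infinity>" using finite_Z by (simp add: cell_emeasure ennreal_mult_less_top of_nat_less_top)
  finally show ?thesis .
qed

text \<open>The integrals of the step functions \<open>st n\<close> are the grid averages, and the
  step functions converge to \<open>f\<close>. Dominated convergence applies once \<open>f\<close>
  is known to be bounded on the set \<open>D\<close> of finite measure.\<close>

lemma avg_tendsto_integral:
  fixes f :: "'a \<Rightarrow> complex"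
  assumes f0: "\<And>x. x \<notin> D \<Longrightarrow> f x = 0"
    and err: "\<And>x n. x \<in> D \<Longrightarrow> cmod (f x - f (t n x)) \<le> \<epsilon> n"
    and lim: "\<epsilon> \<longlonglongrightarrow> 0"
  shows "(\<lambda>n. avg n f) \<longlonglongrightarrow> (LINT x|M. f x)"
proof -
  define st where "st n x = (\<Sum>z\<in>Z n. indicator {x \<in> D. t n x = z} x *\<^sub>R f z)" for n x
  have st: "st n x = (if x \<in> D then f (t n x) else 0)" for n x
  proof (cases "x \<in> D")
    case True
    have "st n x = (\<Sum>z\<in>Z n. if z = t n x then f z else 0)"
      unfolding st_def by (intro sum.cong refl) (use True in \<open>auto simp: indicator_def\<close>)
    also have "\<dots> = f (t n x)" using t_mem[OF True, of n] finite_Z[of n] by simp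
    finally show ?thesis using True by simp
  qed (simp add: st_def)
  have [measurable]: "st n \<in> borel_measurable M" for n
    unfolding st_def
    by (intro borel_measurable_sum borel_measurable_scaleR borel_measurable_indicator cell_sets) auto
  have conv: "(\<lambda>n. st n x) \<longlonglongrightarrow> f x" for x
  proof (cases "x \<in> D")
    case True
    have "(\<lambda>n. f x - f (t n x)) \<longlonglongrightarrow> 0"
      by (rule Lim_null_comparison[OF _ lim]) (use err[OF True] in auto)
    from tendsto_diff[OF tendsto_const[of "f x"] this] show ?thesis using True by (simp add: st)
  qed (simp add: st f0)
  have int: "integral\<^sup>L M (st n) = avg n f" for n
  proof -
    have "integral\<^sup>L M (st n) = (\<Sum>z\<in>Z n. measure M {x \<in> D. t n x = z} *\<^sub>R f z)"
      unfolding st_def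
      by (subst Bochner_Integration.integral_sum)
        (auto intro!: integrable_scaleR_left integrable_real_indicator cell_sets sum.cong
          simp: cell_emeasure sets.Int_space_eq1 cell_sets)
    also have "\<dots> = avg n f"
      by (simp add: avg_def measure_def cell_emeasure sum_divide_distrib scaleR_conv_of_real)
    finally show ?thesis .
  qed
  \<comment> \<open>One grid with error below 1 bounds \<open>f\<close> on \<open>D\<close> by its
    finitely many grid values plus 1.\<close>
  obtain n0 where n0: "\<epsilon> n0 < 1"
    using order_tendstoD(2)[OF lim, of 1] eventually_happens'[of sequentially] by auto
  define B where "B = (\<Sum>z\<in>Z n0. cmod (f z)) + 1"
  have fB: "cmod (f x) \<le> B" if x: "x \<in> D" for x
  proof -
    have "cmod (f (t n0 x)) \<le> (\<Sum>z\<in>Z n0. cmod (f z))"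
      by (rule member_le_sum) (use t_mem[OF x] finite_Z in auto)
    moreover have "cmod (f x) \<le> cmod (f (t n0 x)) + cmod (f x - f (t n0 x))"
      using norm_triangle_ineq[of "f (t n0 x)" "f x - f (t n0 x)"] by simp
    ultimately show ?thesis using err[OF x, of n0] n0 unfolding B_def by linarith
  qed
  have "(\<lambda>n. integral\<^sup>L M (st n)) \<longlonglongrightarrow> integral\<^sup>L M f"
  proof (rule integral_dominated_convergence)
    \<comment> \<open>Measurability of \<open>f\<close> comes from its being a pointwise limit of
      step functions.\<close>
    show "f \<in> borel_measurable M"
      by (rule borel_measurable_LIMSEQ_metric[OF _ conv]) simp
    show "integrable M (\<lambda>x. indicator D x * B)"
      using D_sets D_finite by (intro integrable_mult_left integrable_real_indicator) auto
    show "AE x in M. norm (st n x) \<le> indicator D x * B" for n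
    proof (rule AE_I2)
      fix x
      show "norm (st n x) \<le> indicator D x * B"
        using fB[of "t n x"] t_mem[of x n] Z_subset[of n] by (auto simp: st indicator_def)
    qed
  qed (use conv in auto)
  then show ?thesis by (simp add: int)
qed

lemma rkhs_avg_tendsto_integral:
  assumes "rkhs D K H ip" "f \<in> H"
  shows "(\<lambda>n. avg n f) \<longlonglongrightarrow> (LINT x|M. f x)"
proof (rule avg_tendsto_integral)
  interpret rkhs D K H ip by fact
  show "f x = 0" if "x \<notin> D" for x using vanish[OF assms(2) that] .
  show "cmod (f x - f (t n x)) \<le> sqrt (Re (ip f f) * trunc_err n)" if "x \<in> D" for x n
    using rkhs_trunc_bound[OF assms that, of n] by (rule real_le_rsqrt)
  show "(\<lambda>n. sqrt (Re (ip f f) * trunc_err n)) \<longlonglongrightarrow> 0"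
    using tendsto_real_sqrt[OF tendsto_mult_left[OF trunc_err_tendsto, of "Re (ip f f)"]] by simp
qed

definition qrule :: "'n set \<Rightarrow> ('n \<Rightarrow> 'a) \<Rightarrow> ('a \<Rightarrow> complex) \<Rightarrow> complex" where
  "qrule N p f = (\<Sum>n\<in>N. f (p n)) / of_nat (card N)"

text \<open>The squared norm of the representer of the error functional. The term of
  \<open>i0\<close> is left out because integral and rule agree on constants; every other
  \<open>\<phi> i\<close> has mean 0, so only the value of the rule remains.\<close>

definition sqerr :: "'n set \<Rightarrow> ('n \<Rightarrow> 'a) \<Rightarrow> real" where
  "sqerr N p = (\<Sum>\<^sub>\<infinity>i\<in>I. if i = i0 then 0 else \<rho> i * (cmod (qrule N p (\<phi> i)))\<^sup>2)"

context
  fixes N :: "'n set" and p :: "'n \<Rightarrow> 'a"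
  assumes N: "finite N" "N \<noteq> {}" and p: "\<And>n. n \<in> N \<Longrightarrow> p n \<in> D"
begin

abbreviation "q i \<equiv> qrule N p (\<phi> i)"

lemma q_norm:
  assumes "i \<in> I" shows "cmod (q i) \<le> 1"
proof -
  have "cmod (\<Sum>n\<in>N. \<phi> i (p n)) \<le> (\<Sum>n\<in>N. 1)"
    by (rule sum_norm_le) (simp add: phi_norm[OF assms p])
  moreover have "card N > 0" using N by (simp add: card_gt_0_iff)
  ultimately show ?thesis by (simp add: qrule_def norm_divide)
qed

lemma avg_norm:
  assumes "i \<in> I" shows "cmod (avg n (\<phi> i)) \<le> 1"
proof -
  have "cmod (\<Sum>z\<in>Z n. \<phi> i z) \<le> (\<Sum>z\<in>Z n. 1)"
    by (rule sum_norm_le) (use Z_subset[of n] phi_norm[OF assms] in auto)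
  then show ?thesis using card_Z[of n] by (simp add: avg_def norm_divide)
qed

lemma sqerr_summable: "(\<lambda>i. if i = i0 then 0 else \<rho> i * (cmod (q i))\<^sup>2) summable_on I"
proof (rule summable_on_comparison_test[OF rho_summable])
  fix i assume i: "i \<in> I"
  have "(cmod (q i))\<^sup>2 \<le> 1" using q_norm[OF i] by (simp add: power_le_one)
  then show "(if i = i0 then 0 else \<rho> i * (cmod (q i))\<^sup>2) \<le> \<rho> i"
    using rho_pos[OF i] by (auto simp: mult_left_le)
  show "0 \<le> (if i = i0 then 0 else \<rho> i * (cmod (q i))\<^sup>2)" using rho_pos[OF i] by simp
qed

lemma sqerr_nonneg: "sqerr N p \<ge> 0"
  unfolding sqerr_def by (rule infsum_nonneg) (auto simp: less_imp_le[OF rho_pos])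

lemma avg_error_bound:
  assumes "rkhs D K H ip" "f \<in> H"
  shows "(cmod (avg n f - qrule N p f))\<^sup>2
    \<le> Re (ip f f) * (\<Sum>\<^sub>\<infinity>i\<in>I. \<rho> i * (cmod (avg n (\<phi> i) - q i))\<^sup>2)"
proof -
  \<comment> \<open>The difference of two averages becomes one point functional. A disjoint union
    keeps the weights apart when a node lies on the grid or occurs several times.\<close>
  define A where "A = Z n <+> N"
  define P where "P = case_sum (\<lambda>z. z) p"
  define a :: "'a + 'n \<Rightarrow> complex" where
    "a = case_sum (\<lambda>_. 1 / of_nat (card (Z n))) (\<lambda>_. - 1 / of_nat (card N))"
  have S: "(\<Sum>k\<in>A. a k * h (P k)) = avg n h - qrule N p h" for h
    unfolding A_def P_def a_def using finite_Z[of n] N(1)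
    by (simp add: sum.Plus avg_def qrule_def sum_divide_distrib sum_negf)
  have "(cmod (\<Sum>k\<in>A. a k * f (P k)))\<^sup>2
      \<le> Re (ip f f) * (\<Sum>\<^sub>\<infinity>i\<in>I. \<rho> i * (cmod (\<Sum>k\<in>A. a k * \<phi> i (P k)))\<^sup>2)"
    by (rule rkhs_functional_bound[OF assms(1) _ _ assms(2)])
      (use finite_Z[of n] N(1) Z_subset[of n] p in \<open>auto simp: A_def P_def\<close>)
  then show ?thesis unfolding S .
qed

text \<open>Both sides of \<open>avg_error_bound\<close> converge as \<open>n\<close> grows: on the
  right \<open>avg n (\<phi> i)\<close> is eventually 0 for \<open>i\<close> different from
  \<open>i0\<close>, while for \<open>i0\<close> both averages are 1 and cancel.\<close>

lemma integration_error_bound: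
  assumes H: "rkhs D K H ip" "f \<in> H"
  shows "(cmod ((LINT x|M. f x) - qrule N p f))\<^sup>2 \<le> Re (ip f f) * sqerr N p"
proof (rule LIMSEQ_le)
  show "(\<lambda>n. (cmod (avg n f - qrule N p f))\<^sup>2) \<longlonglongrightarrow> (cmod ((LINT x|M. f x) - qrule N p f))\<^sup>2"
    by (intro tendsto_intros rkhs_avg_tendsto_integral[OF H])
  show "\<exists>k. \<forall>n\<ge>k. (cmod (avg n f - qrule N p f))\<^sup>2
      \<le> Re (ip f f) * (\<Sum>\<^sub>\<infinity>i\<in>I. \<rho> i * (cmod (avg n (\<phi> i) - q i))\<^sup>2)"
    using avg_error_bound[OF H] by blast
  show "(\<lambda>n. Re (ip f f) * (\<Sum>\<^sub>\<infinity>i\<in>I. \<rho> i * (cmod (avg n (\<phi> i) - q i))\<^sup>2)) \<longlonglongrightarrow> Re (ip f f) * sqerr N p"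
    unfolding sqerr_def
  proof (intro tendsto_mult_left tendsto_infsum_eventually_eq)
    show "(\<lambda>i. 4 * \<rho> i) summable_on I" by (rule summable_on_cmult_right[OF rho_summable])
    fix i assume i: "i \<in> I"
    show "norm (\<rho> i * (cmod (avg n (\<phi> i) - q i))\<^sup>2) \<le> 4 * \<rho> i" for n
    proof -
      have "cmod (avg n (\<phi> i) - q i) \<le> 2"
        using norm_triangle_ineq4[of "avg n (\<phi> i)" "q i"] avg_norm[OF i, of n] q_norm[OF i] by linarith
      then have "(cmod (avg n (\<phi> i) - q i))\<^sup>2 \<le> 2\<^sup>2" by (intro power_mono) auto
      then show ?thesis using rho_pos[OF i] by (simp add: abs_mult)
    qed
    show "\<forall>\<^sub>F n in sequentially. \<rho> i * (cmod (avg n (\<phi> i) - q i))\<^sup>2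
        = (if i = i0 then 0 else \<rho> i * (cmod (q i))\<^sup>2)"
    proof (cases "i = i0")
      case True
      have "avg n (\<phi> i0) = 1" for n
      proof -
        have "(\<Sum>z\<in>Z n. \<phi> i0 z) = (\<Sum>z\<in>Z n. 1)" using Z_subset[of n] by (intro sum.cong) (auto simp: phi_i0)
        then show ?thesis using card_Z[of n] by (simp add: avg_def)
      qed
      moreover have "q i0 = 1"
        using N by (simp add: qrule_def phi_i0[OF p])
      ultimately show ?thesis using True by simp
    next
      case False
      show ?thesis using phi_ortho[OF i i0 False]
      proof eventually_elim
        case (elim n)
        have "(\<Sum>z\<in>Z n. \<phi> i z) = (\<Sum>z\<in>Z n. \<phi> i z * cnj (\<phi> i0 z))"
          using Z_subset[of n] by (intro sum.cong) (auto simp: phi_i0)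
        then have "avg n (\<phi> i) = 0" using elim by (simp add: avg_def)
        then show ?case using False by simp
      qed
    qed
  qed
qed

text \<open>The representer of the quadrature rule, with its constant component removed, has
  integral 0, while its quadrature value and its squared norm both equal \<open>sqerr N p\<close>.
  Dividing by the norm gives equality in the error bound.\<close>

lemma extremal_function:
  assumes "sqerr N p \<noteq> 0"
  obtains f where "f \<in> rkhs_unit_ball D K" "cmod ((LINT x|M. f x) - qrule N p f) = sqrt (sqerr N p)"
proof -
  \<comment> \<open>Averaging the coefficients of the kernel sections at the nodes gives
    \<open>\<rho> i\<close> times the conjugate of \<open>q i\<close>.\<close>
  define c where "c i = (if i = i0 then 0 else of_real (\<rho> i) * cnj (q i))" for i
  have c2: "(cmod (c i))\<^sup>2 / \<rho> i = (if i = i0 then 0 else \<rho> i * (cmod (q i))\<^sup>2)" if "i \<in> I" for i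
    using rho_pos[OF that] by (auto simp: c_def norm_mult power_mult_distrib power2_eq_square)
  have l2c: "l2 c" unfolding l2_def using sqerr_summable by (subst summable_on_cong[OF c2])
  have w: "wip (syn c) (syn c) = of_real (sqerr N p)"
    unfolding wip_self[OF l2c] sqerr_def by (simp add: infsum_cong[OF c2])
  have int: "(LINT x|M. syn c x) = 0"
  proof -
    \<comment> \<open>Since \<open>\<phi> i0\<close> is 1, the plain grid averages converge to the
      coefficient at \<open>i0\<close>, which was set to 0.\<close>
    have "(\<lambda>n. avg n (syn c)) \<longlonglongrightarrow> c i0"
    proof -
      have "avg n (\<lambda>z. syn c z * cnj (\<phi> i0 z)) = avg n (syn c)" for n
        unfolding avg_def using Z_subset[of n]
        by (intro arg_cong2[where f = "(/)"] sum.cong) (auto simp: phi_i0)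
      then show ?thesis using avg_syn_tendsto[OF l2c i0] by simp
    qed
    moreover have "(\<lambda>n. avg n (syn c)) \<longlonglongrightarrow> (LINT x|M. syn c x)"
      by (rule rkhs_avg_tendsto_integral[OF rkhs_wspace]) (use l2c in \<open>auto simp: wspace_def\<close>)
    ultimately show ?thesis using LIMSEQ_unique by (fastforce simp: c_def)
  qed
  have quad: "qrule N p (syn c) = of_real (sqerr N p)"
  proof -
    have "((\<lambda>i. (\<Sum>n\<in>N. c i * \<phi> i (p n)) / of_nat (card N)) has_sum qrule N p (syn c)) I"
      unfolding qrule_def divide_inverse
      by (intro has_sum_cmult_left has_sum_sum N syn_has_sum[OF l2c] p)
    moreover have "(\<Sum>n\<in>N. c i * \<phi> i (p n)) / of_nat (card N)
        = of_real (if i = i0 then 0 else \<rho> i * (cmod (q i))\<^sup>2)" for i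
    proof -
      have "(\<Sum>n\<in>N. c i * \<phi> i (p n)) / of_nat (card N) = c i * q i"
        by (simp add: qrule_def sum_distrib_left)
      then show ?thesis by (simp add: c_def complex_norm_square mult_ac del: of_real_power)
    qed
    ultimately have "((\<lambda>i. of_real (if i = i0 then 0 else \<rho> i * (cmod (q i))\<^sup>2)) has_sum qrule N p (syn c)) I"
      by simp
    moreover have "((\<lambda>i. of_real (if i = i0 then 0 else \<rho> i * (cmod (q i))\<^sup>2)) has_sum (of_real (sqerr N p) :: complex)) I"
      unfolding sqerr_def by (rule has_sum_of_real[OF has_sum_infsum[OF sqerr_summable]])
    ultimately show ?thesis by (rule has_sum_unique)
  qed
  define a :: complex where "a = of_real (1 / sqrt (sqerr N p))"
  have pos: "sqerr N p > 0" using assms sqerr_nonneg by simp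
  define f where "f = (\<lambda>x. a * syn c x)"
  interpret W: rkhs D K wspace wip by (rule rkhs_wspace)
  have sc: "syn c \<in> wspace" using l2c by (auto simp: wspace_def)
  have fW: "f \<in> wspace" unfolding f_def by (rule W.scale_mem[OF sc])
  have "wip f f = a * cnj (a * wip (syn c) (syn c))"
    using W.ip_scale[OF sc fW] W.ip_scale[OF sc sc] W.ip_cnj[OF fW sc] unfolding f_def by simp
  also have "\<dots> = of_real (1 / sqrt (sqerr N p) * (1 / sqrt (sqerr N p) * sqerr N p))"
    by (simp only: w a_def complex_cnj_mult complex_cnj_complex_of_real of_real_mult)
  also have "1 / sqrt (sqerr N p) * (1 / sqrt (sqerr N p) * sqerr N p) = 1"
    using pos real_sqrt_mult_self[of "sqerr N p"] by (simp add: field_simps del: real_sqrt_mult_self)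
  finally have "f \<in> rkhs_unit_ball D K"
    unfolding rkhs_unit_ball_def using fW
    by (intro CollectI exI[of _ wspace] exI[of _ wip]) (simp add: rkhs_wspace)
  moreover have "cmod ((LINT x|M. f x) - qrule N p f) = sqrt (sqerr N p)"
  proof -
    have "(LINT x|M. f x) = 0" unfolding f_def using int by simp
    moreover have "qrule N p f = a * qrule N p (syn c)"
      by (simp add: f_def qrule_def sum_distrib_left)
    ultimately have "cmod ((LINT x|M. f x) - qrule N p f) = 1 / sqrt (sqerr N p) * sqerr N p"
      using pos by (simp add: quad a_def norm_mult norm_divide)
    also have "\<dots> = sqrt (sqerr N p)" using pos by (simp add: real_div_sqrt)
    finally show ?thesis .
  qed
  ultimately show ?thesis by (rule that)
qed

theorem worst_case_error_formula:
  "(SUP f\<in>rkhs_unit_ball D K. cmod ((LINT x|M. f x) - qrule N p f)) = sqrt (sqerr N p)"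
proof (rule cSup_eq_maximum)
  show "sqrt (sqerr N p) \<in> (\<lambda>f. cmod ((LINT x|M. f x) - qrule N p f)) ` rkhs_unit_ball D K"
  \<comment> \<open>With \<open>sqerr N p = 0\<close> there is no norm to divide by; the zero
    function then attains the maximum.\<close>
  proof (cases "sqerr N p = 0")
    case True
    interpret W: rkhs D K wspace wip by (rule rkhs_wspace)
    have "(\<lambda>x. 0) \<in> rkhs_unit_ball D K"
      unfolding rkhs_unit_ball_def using rkhs_wspace W.zero_mem W.ip_zero_left[OF W.zero_mem] by force
    then show ?thesis using True by (force simp: qrule_def)
  next
    case False
    then obtain f where "f \<in> rkhs_unit_ball D K" "cmod ((LINT x|M. f x) - qrule N p f) = sqrt (sqerr N p)"
      by (rule extremal_function)
    then show ?thesis by (intro image_eqI) auto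
  qed
next
  fix y assume "y \<in> (\<lambda>f. cmod ((LINT x|M. f x) - qrule N p f)) ` rkhs_unit_ball D K"
  then obtain f H ip where f: "rkhs D K H ip" "f \<in> H" "sqrt (Re (ip f f)) \<le> 1"
    and y: "y = cmod ((LINT x|M. f x) - qrule N p f)"
    unfolding rkhs_unit_ball_def by blast
  have "y\<^sup>2 \<le> Re (ip f f) * sqerr N p" unfolding y by (rule integration_error_bound[OF f(1,2)])
  also have "\<dots> \<le> 1 * sqerr N p" using f(3) by (intro mult_right_mono sqerr_nonneg) simp
  finally show "y \<le> sqrt (sqerr N p)" by (intro real_le_rsqrt) simp
qed

end

end

section \<open>Walsh functions and the dual lattice\<close>

lemma psi_eqI:
  assumes "b \<ge> 2" "b ^ n \<le> h" "h < b ^ (n + 1)"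
  shows "psi b h = n"
  using floor_log_nat_eq_if[of b n h] assms by (simp add: psi_def)

lemma psi_bounds:
  assumes "b \<ge> 2" "h \<ge> 1"
  shows "b ^ psi b h \<le> h" "h < b ^ (psi b h + 1)"
proof -
  obtain n where "b ^ n \<le> h" "h < b ^ (n + 1)" using ex_power_ivl1[OF assms] by auto
  then show "b ^ psi b h \<le> h" "h < b ^ (psi b h + 1)" using psi_eqI[OF assms(1)] by auto
qed

text \<open>Rests on the default value \<open>ln 0 = 0\<close>.\<close>

lemma psi_zero [simp]: "psi b 0 = 0"
  by (simp add: psi_def log_def)

lemma less_power_psi:
  assumes "b \<ge> 2" "psi b h < n"
  shows "h < b ^ n"
proof (cases "h = 0")
  case False
  then have "h < b ^ (psi b h + 1)" using psi_bounds(2)[OF assms(1), of h] by simp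
  also have "\<dots> \<le> b ^ n" using assms by (intro power_increasing) auto
  finally show ?thesis .
qed (use assms in simp)

lemma nat_digit_beyond_psi:
  assumes "b \<ge> 2" "psi b h < i"
  shows "nat_digit b h i = 0"
  using less_power_psi[OF assms] by (simp add: nat_digit_def)

lemma nat_digit_eqI:
  assumes "b > 0" "k < b ^ n" "h < b ^ n" "\<And>i. i < n \<Longrightarrow> nat_digit b k i = nat_digit b h i"
  shows "k = h"
proof -
  have "k mod b ^ n = h mod b ^ n"
    using assms(4)
  proof (induction n)
    case (Suc n)
    then show ?case
      unfolding power_Suc2 mod_mult2_eq by (simp add: nat_digit_def)
  qed simp
  then show ?thesis using assms by simp
qed

text \<open>Division by \<open>B\<close> removes the lowest digit and shifts the others down by one
  place, which drives the induction on \<open>j\<close>.\<close>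

lemma int_digit_sum:
  fixes a :: "nat \<Rightarrow> int"
  assumes "\<And>k. 0 \<le> a k" "\<And>k. a k < B" "j < m"
  shows "(\<Sum>k<m. a k * B ^ k) div B ^ j mod B = a j"
  using assms
proof (induction j arbitrary: a m)
  case 0
  obtain m' where m: "m = Suc m'" using 0(3) by (cases m) auto
  have "(\<Sum>k<m. a k * B ^ k) = a 0 + B * (\<Sum>k<m'. a (Suc k) * B ^ k)"
    unfolding m sum.lessThan_Suc_shift by (simp add: sum_distrib_left mult_ac)
  then show ?case using 0(1,2)[of 0] by simp
next
  case (Suc j)
  obtain m' where m: "m = Suc m'" using Suc.prems(3) by (cases m) auto
  have B: "B > 0" using Suc.prems(1,2)[of 0] by simp
  have "(\<Sum>k<m. a k * B ^ k) = a 0 + B * (\<Sum>k<m'. a (Suc k) * B ^ k)"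
    unfolding m sum.lessThan_Suc_shift by (simp add: sum_distrib_left mult_ac)
  then have "(\<Sum>k<m. a k * B ^ k) div B = (\<Sum>k<m'. a (Suc k) * B ^ k)"
    using Suc.prems(1,2)[of 0] B by simp
  then have "(\<Sum>k<m. a k * B ^ k) div B ^ Suc j = (\<Sum>k<m'. a (Suc k) * B ^ k) div B ^ j"
    using B by (simp add: zdiv_zmult2_eq)
  then show ?case using Suc.IH[of "\<lambda>k. a (Suc k)" m'] Suc.prems m by simp
qed

lemma int_digit_sum_bounds:
  fixes a :: "nat \<Rightarrow> int"
  assumes "\<And>k. 0 \<le> a k" "\<And>k. a k < B"
  shows "0 \<le> (\<Sum>k<m. a k * B ^ k)" "(\<Sum>k<m. a k * B ^ k) < B ^ m"
proof -
  have B: "B > 0" using assms[of 0] by simp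
  show "0 \<le> (\<Sum>k<m. a k * B ^ k)" using assms B by (intro sum_nonneg) auto
  show "(\<Sum>k<m. a k * B ^ k) < B ^ m"
  proof (induction m)
    case (Suc m)
    have "a m * B ^ m \<le> (B - 1) * B ^ m" using assms(2)[of m] B by (intro mult_right_mono) auto
    then show ?case using Suc by (simp add: algebra_simps)
  qed simp
qed

text \<open>The digit at position \<open>i\<close> depends on the number only through its scaled
  floor at level \<open>n\<close>, since the floor at level \<open>i\<close> is an integer quotient
  of that one. Truncation preserves the floor at level \<open>n\<close>.\<close>

lemma real_digit_trunc:
  assumes b: "b > 0" and i: "i \<le> n"
  shows "real_digit b (real_of_int \<lfloor>x * real b ^ n\<rfloor> / real b ^ n) i = real_digit b x i"
proof -
  have *: "\<lfloor>y * real b ^ i\<rfloor> = \<lfloor>y * real b ^ n\<rfloor> div int b ^ (n - i)" for y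
  proof -
    have "y * real b ^ i = (y * real b ^ n) / real_of_int (int b ^ (n - i))"
    proof -
      have "real b ^ n = real b ^ i * real b ^ (n - i)" unfolding power_add[symmetric] using i by simp
      then show ?thesis using b by simp
    qed
    then show ?thesis by (simp only: floor_divide_real_eq_div[of "int b ^ (n - i)"] zero_le_power of_nat_0_le_iff)
  qed
  show ?thesis unfolding real_digit_def * using b by simp
qed

text \<open>Frees the range of summation from \<open>psi b h\<close>, so that frequencies of
  different length can be treated with one common cutoff \<open>n\<close>.\<close>

lemma wal_eq_sum:
  assumes b: "b \<ge> 2" and n: "\<And>i. i \<ge> n \<Longrightarrow> real_digit b x (Suc i) * int (nat_digit b h i) = 0"
  shows "wal b h x = exp (2 * of_real pi * \<i> *
    of_int (\<Sum>i<n. real_digit b x (Suc i) * int (nat_digit b h i)) / of_nat b)"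
proof -
  have "(\<Sum>i\<le>psi b h. real_digit b x (Suc i) * int (nat_digit b h i))
      = (\<Sum>i<n. real_digit b x (Suc i) * int (nat_digit b h i))"
  proof (rule sum.mono_neutral_cong)
    fix i assume "i \<in> {..<n} - {..psi b h}"
    then show "real_digit b x (Suc i) * int (nat_digit b h i) = 0"
      using nat_digit_beyond_psi[OF b, of h i] by simp
  qed (use n in auto)
  then show ?thesis by (simp add: wal_def)
qed

lemma norm_wal [simp]: "cmod (wal b h x) = 1"
  by (simp add: wal_def norm_exp_eq_Re del: of_int_sum)

lemma wal_0 [simp]: "wal b 0 x = 1"
  by (simp add: wal_def nat_digit_def)

lemma wal_trunc:
  assumes b: "b \<ge> 2" and n: "psi b h < n"
  shows "wal b h (real_of_int \<lfloor>x * real b ^ n\<rfloor> / real b ^ n) = wal b h x"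
proof -
  \<comment> \<open>The frequency digit \<open>i\<close> meets the digit \<open>Suc i\<close> of the
    argument, so the strict inequality \<open>psi b h < n\<close> keeps every digit that
    occurs.\<close>
  have "real_digit b (real_of_int \<lfloor>x * real b ^ n\<rfloor> / real b ^ n) (Suc i) = real_digit b x (Suc i)"
    if "i \<le> psi b h" for i
    using b that n by (intro real_digit_trunc) auto
  then have "(\<Sum>i\<le>psi b h. real_digit b (real_of_int \<lfloor>x * real b ^ n\<rfloor> / real b ^ n) (Suc i) * int (nat_digit b h i))
     = (\<Sum>i\<le>psi b h. real_digit b x (Suc i) * int (nat_digit b h i))"
    by (intro sum.cong) auto
  then show ?thesis unfolding wal_def by presburger
qed

section \<open>The additive character of the prime field\<close>

lemma card_p_ge2: "CARD('p::prime_card) \<ge> 2"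
  by (rule prime_ge_2_nat[OF prime_card])

lemma to_int_bounds:
  fixes c :: "'p::prime_card mod_ring"
  shows "0 \<le> to_int_mod_ring c" "to_int_mod_ring c < int CARD('p)"
proof -
  have "to_int_mod_ring c \<in> range (to_int_mod_ring :: 'p mod_ring \<Rightarrow> int)" by simp
  then show "0 \<le> to_int_mod_ring c" "to_int_mod_ring c < int CARD('p)"
    unfolding range_to_int_mod_ring by simp_all
qed

lemma to_int_of_int: "to_int_mod_ring (of_int k :: 'p::prime_card mod_ring) = k mod int CARD('p)"
  by (simp add: of_int_of_int_mod_ring to_int_mod_ring.rep_eq of_int_mod_ring.rep_eq)

lemma of_int_to_int: "of_int (to_int_mod_ring (c :: 'p::prime_card mod_ring)) = c"
  unfolding of_int_of_int_mod_ring by (rule of_int_mod_ring_to_int_mod_ring)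

text \<open>The canonical additive character of the field with \<open>CARD('p)\<close>
  elements.\<close>

definition chi :: "'p::prime_card mod_ring \<Rightarrow> complex" where
  "chi c = exp (2 * of_real pi * \<i> * of_int (to_int_mod_ring c) / of_nat CARD('p))"

text \<open>Reducing \<open>k\<close> modulo \<open>CARD('p)\<close> changes the exponent by an
  integral multiple of the period of \<open>exp\<close>. Integer sums of digit products can thus be
  read as field elements.\<close>

lemma chi_of_int:
  "chi (of_int k :: 'p::prime_card mod_ring) = exp (2 * of_real pi * \<i> * of_int k / of_nat CARD('p))"
proof -
  have b: "CARD('p) > 0" using card_p_ge2[where 'p = 'p] by simp
  have k: "complex_of_int k = of_int (k mod int CARD('p)) + of_nat CARD('p) * of_int (k div int CARD('p))"
    by (metis mod_mult_div_eq of_int_add of_int_mult of_int_of_nat_eq)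
  have "2 * of_real pi * \<i> * of_int k / of_nat CARD('p)
     = 2 * of_real pi * \<i> * of_int (k mod int CARD('p)) / of_nat CARD('p)
       + of_real (of_int (2 * (k div int CARD('p))) * pi) * \<i>"
    unfolding k using b by (simp add: add_divide_distrib distrib_left)
  then have "exp (2 * of_real pi * \<i> * of_int k / of_nat CARD('p))
     = exp (2 * of_real pi * \<i> * of_int (k mod int CARD('p)) / of_nat CARD('p))"
    unfolding exp_eq by blast
  then show ?thesis by (simp add: chi_def to_int_of_int)
qed

lemma chi_0 [simp]: "chi (0 :: 'p::prime_card mod_ring) = 1"
  using chi_of_int[where k = 0 and 'p = 'p] by simp

lemma chi_add:
  fixes c d :: "'p::prime_card mod_ring"
  shows "chi (c + d) = chi c * chi d"
proof -
  have "chi (of_int (to_int_mod_ring c) + of_int (to_int_mod_ring d) :: 'p mod_ring) = chi c * chi d"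
    unfolding of_int_add[symmetric] chi_of_int
    by (simp add: chi_def exp_add[symmetric] add_divide_distrib distrib_left)
  then show ?thesis by (simp add: of_int_to_int)
qed

lemma norm_chi [simp]: "cmod (chi c) = 1"
  by (simp add: chi_def norm_exp_eq_Re)

lemma chi_diff: "chi (c - d) = chi c * cnj (chi d)"
proof -
  have "chi (c - d) * chi d = chi c" by (simp flip: chi_add)
  moreover have "chi d * cnj (chi d) = 1" by (simp add: complex_norm_square[symmetric] del: of_real_power)
  ultimately show ?thesis by (metis mult.assoc mult.right_neutral)
qed

lemma chi_sum: "chi (\<Sum>j\<in>A. f j) = (\<Prod>j\<in>A. chi (f j))"
  by (induction A rule: infinite_finite_induct) (auto simp: chi_add)

lemma chi_eq_1D:
  fixes c :: "'p::prime_card mod_ring"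
  assumes "chi c = 1" shows "c = 0"
proof -
  obtain n :: int where n: "2 * pi * real_of_int (to_int_mod_ring c) / real CARD('p) = of_int (2 * n) * pi"
    using assms unfolding chi_def by (auto simp: exp_eq_1)
  have b: "real CARD('p) > 0" using card_p_ge2[where 'p = 'p] by simp
  have "real_of_int (to_int_mod_ring c) = real_of_int (n * int CARD('p))"
    using n b by (simp add: field_simps)
  then have "to_int_mod_ring c = n * int CARD('p)" by linarith
  then have "of_int (to_int_mod_ring c) = (of_int n * of_nat CARD('p) :: 'p mod_ring)" by simp
  then show ?thesis by (simp only: of_int_to_int of_nat_card_eq_0) simp
qed

section \<open>Residues modulo x^m, their points and character sums\<close>

definition low_polys :: "nat \<Rightarrow> 'p::prime_card mod_ring poly set" where
  "low_polys m = {n. Polynomial.degree n < m}"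

lemma coeff_low_poly: "n \<in> low_polys m \<Longrightarrow> k \<ge> m \<Longrightarrow> Polynomial.coeff n k = 0"
  by (simp add: low_polys_def coeff_eq_0)

lemma low_polysI: "m > 0 \<Longrightarrow> (\<And>k. k \<ge> m \<Longrightarrow> Polynomial.coeff n k = 0) \<Longrightarrow> n \<in> low_polys m"
  unfolding low_polys_def mem_Collect_eq by (rule degree_lessI) simp_all

lemma bij_low_polys:
  assumes "m > 0"
  shows "bij_betw (\<lambda>n. \<lambda>k\<in>{..<m}. Polynomial.coeff n k) (low_polys m :: 'p::prime_card mod_ring poly set)
    ({..<m} \<rightarrow>\<^sub>E UNIV)"
proof (rule bij_betwI')
  fix x y :: "'p mod_ring poly" assume xy: "x \<in> low_polys m" "y \<in> low_polys m"
  show "((\<lambda>k\<in>{..<m}. Polynomial.coeff x k) = (\<lambda>k\<in>{..<m}. Polynomial.coeff y k)) = (x = y)"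
  proof
    assume e: "(\<lambda>k\<in>{..<m}. Polynomial.coeff x k) = (\<lambda>k\<in>{..<m}. Polynomial.coeff y k)"
    show "x = y"
    proof (rule poly_eqI)
      fix k show "Polynomial.coeff x k = Polynomial.coeff y k"
        using fun_cong[OF e, of k] coeff_low_poly[OF xy(1), of k] coeff_low_poly[OF xy(2), of k]
        by (cases "k < m") auto
    qed
  qed simp
next
  fix f :: "nat \<Rightarrow> 'p mod_ring" assume f: "f \<in> {..<m} \<rightarrow>\<^sub>E UNIV"
  define x where "x = (\<Sum>i<m. Polynomial.monom (f i) i)"
  have c: "Polynomial.coeff x k = (if k < m then f k else 0)" for k
    by (simp add: x_def coeff_sum)
  have "x \<in> low_polys m" by (rule low_polysI[OF assms]) (simp add: c)
  moreover have "f = (\<lambda>k\<in>{..<m}. Polynomial.coeff x k)" 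
  proof
    fix k show "f k = (\<lambda>k\<in>{..<m}. Polynomial.coeff x k) k"
      using PiE_arb[OF f, of k] by (simp add: c)
  qed
  ultimately show "\<exists>x\<in>low_polys m. f = (\<lambda>k\<in>{..<m}. Polynomial.coeff x k)" by blast
qed auto

lemma
  assumes "m > 0"
  shows finite_low_polys: "finite (low_polys m :: 'p::prime_card mod_ring poly set)"
    and card_low_polys: "card (low_polys m :: 'p::prime_card mod_ring poly set) = CARD('p) ^ m"
proof -
  have "finite ({..<m} \<rightarrow>\<^sub>E (UNIV :: 'p mod_ring set))" by (intro finite_PiE) auto
  then show "finite (low_polys m :: 'p::prime_card mod_ring poly set)"
    using bij_betw_finite[OF bij_low_polys[OF assms]] by blast
  show "card (low_polys m :: 'p::prime_card mod_ring poly set) = CARD('p) ^ m"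
    using bij_betw_same_card[OF bij_low_polys[OF assms, where 'p = 'p]] by (simp add: card_PiE)
qed

text \<open>The numerator of \<open>nu m v\<close> over the common denominator
  \<open>CARD('p) ^ m\<close>: the coefficients of \<open>v\<close> in ascending order are its
  digits from the lowest upwards.\<close>

definition nu_num :: "nat \<Rightarrow> 'p::prime_card mod_ring poly \<Rightarrow> int" where
  "nu_num m v = (\<Sum>k<m. to_int_mod_ring (Polynomial.coeff v k) * int CARD('p) ^ k)"

lemma nu_eq: "nu m (v :: 'p::prime_card mod_ring poly) = of_int (nu_num m v) / real CARD('p) ^ m"
proof -
  have b: "real CARD('p) > 0" using card_p_ge2[where 'p = 'p] by simp
  show ?thesis
    unfolding nu_def nu_num_def of_int_sum sum_divide_distrib
    by (intro sum.cong refl) (use b in \<open>simp add: power_diff field_simps\<close>)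
qed

lemma nu_num_bounds:
  "0 \<le> nu_num m v" "nu_num m (v :: 'p::prime_card mod_ring poly) < int CARD('p) ^ m"
  unfolding nu_num_def using int_digit_sum_bounds[of "\<lambda>k. to_int_mod_ring (Polynomial.coeff v k)", OF to_int_bounds]
  by blast+

text \<open>The order is reversed, as the leading digit of the point is the coefficient of degree
  \<open>m - 1\<close>. After \<open>m\<close> digits the expansion stops.\<close>

lemma real_digit_nu:
  fixes v :: "'p::prime_card mod_ring poly"
  shows "real_digit CARD('p) (nu m v) (Suc i)
    = (if i < m then to_int_mod_ring (Polynomial.coeff v (m - 1 - i)) else 0)"
proof -
  have b: "real CARD('p) > 0" using card_p_ge2[where 'p = 'p] by simp
  show ?thesis
  proof (cases "i < m")
    case True
    have "nu m v * real CARD('p) ^ Suc i = real_of_int (nu_num m v) / real_of_int (int CARD('p) ^ (m - 1 - i))"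
    proof -
      have "real CARD('p) ^ m = real CARD('p) ^ (m - 1 - i) * real CARD('p) ^ Suc i"
        unfolding power_add[symmetric] using True by simp
      then show ?thesis unfolding nu_eq using b by (simp add: field_simps)
    qed
    then have "\<lfloor>nu m v * real CARD('p) ^ Suc i\<rfloor> = nu_num m v div int CARD('p) ^ (m - 1 - i)"
      by (simp only: floor_divide_of_int_eq)
    then show ?thesis
      unfolding real_digit_def nu_num_def using True
      by (simp add: int_digit_sum[OF to_int_bounds])
  next
    case False
    \<comment> \<open>For \<open>i \<ge> m\<close> the scaled value is an integer multiple of the
      base, because the exponent \<open>Suc i - m\<close> is at least 1; hence its digit is
      0.\<close>
    have "nu m v * real CARD('p) ^ Suc i = real_of_int (nu_num m v * int CARD('p) ^ (Suc i - m))"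
    proof -
      have "real CARD('p) ^ Suc i = real CARD('p) ^ (Suc i - m) * real CARD('p) ^ m"
        unfolding power_add[symmetric] using False by simp
      then show ?thesis unfolding nu_eq using b by simp
    qed
    then have "\<lfloor>nu m v * real CARD('p) ^ Suc i\<rfloor> = nu_num m v * int CARD('p) ^ (Suc i - m)"
      by (simp only: floor_of_int)
    moreover have "Suc i - m = Suc (i - m)" using False by simp
    ultimately show ?thesis using False by (simp add: real_digit_def)
  qed
qed

definition tr :: "nat \<Rightarrow> nat \<Rightarrow> 'p::prime_card mod_ring poly" where
  "tr m h = (\<Sum>i<m. Polynomial.monom (of_nat (nat_digit CARD('p) h i)) i)"

lemma coeff_tr:
  "Polynomial.coeff (tr m h :: 'p::prime_card mod_ring poly) i
    = (if i < m then of_nat (nat_digit CARD('p) h i) else 0)"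
  by (simp add: tr_def coeff_sum)

text \<open>Because the digits of the point are the coefficients of \<open>v\<close> in reverse
  order, the digit pairing inside the Walsh function is a convolution, namely the coefficient of
  degree \<open>m - 1\<close> of a product.\<close>

lemma wal_nu:
  fixes v :: "'p::prime_card mod_ring poly"
  assumes m: "m > 0"
  shows "wal CARD('p) h (nu m v) = chi (Polynomial.coeff (v * tr m h) (m - 1))"
proof -
  have "wal CARD('p) h (nu m v) = chi (of_int
      (\<Sum>i<m. real_digit CARD('p) (nu m v) (Suc i) * int (nat_digit CARD('p) h i)) :: 'p mod_ring)"
    unfolding chi_of_int by (rule wal_eq_sum[OF card_p_ge2]) (simp add: real_digit_nu)
  also have "(of_int (\<Sum>i<m. real_digit CARD('p) (nu m v) (Suc i) * int (nat_digit CARD('p) h i)) :: 'p mod_ring)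
      = (\<Sum>i<m. Polynomial.coeff (tr m h) i * Polynomial.coeff v (m - 1 - i))"
    unfolding of_int_sum
    by (intro sum.cong refl) (simp add: real_digit_nu coeff_tr of_int_to_int)
  also have "\<dots> = Polynomial.coeff (v * tr m h) (m - 1)"
  proof -
    have "{..m - 1} = {..<m}" using m by auto
    then show ?thesis by (simp add: coeff_mult mult.commute[of v])
  qed
  finally show ?thesis .
qed

text \<open>Orthogonality of characters: if some low coefficient of \<open>w\<close> is nonzero, a
  translation of the summation variable multiplies the sum by a number other than 1.\<close>

lemma sum_chi_low_polys:
  fixes w :: "'p::prime_card mod_ring poly"
  assumes m: "m > 0"
  shows "(\<Sum>n\<in>low_polys m. chi (Polynomial.coeff (n * w) (m - 1)))
    = (if \<forall>k<m. Polynomial.coeff w k = 0 then of_nat (CARD('p) ^ m) else 0)"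
proof (cases "\<forall>k<m. Polynomial.coeff w k = 0")
  case True
  have "Polynomial.coeff (n * w) (m - 1) = 0" for n
    unfolding coeff_mult using True m by (intro sum.neutral) auto
  then show ?thesis using True by (simp add: card_low_polys[OF m])
next
  case False
  then obtain k where k: "k < m" "Polynomial.coeff w k \<noteq> 0" by blast
  \<comment> \<open>This monomial moves the nonzero coefficient of \<open>w\<close> at
    \<open>k\<close> to degree \<open>m - 1\<close>, where the character looks.\<close>
  define n0 :: "'p mod_ring poly" where "n0 = Polynomial.monom 1 (m - 1 - k)"
  have n0: "n0 \<in> low_polys m" unfolding n0_def by (rule low_polysI[OF m]) (use m in auto)
  have c0: "Polynomial.coeff (n0 * w) (m - 1) = Polynomial.coeff w k"
    using k by (simp add: n0_def coeff_monom_mult)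
  define S where "S = (\<Sum>n\<in>low_polys m. chi (Polynomial.coeff (n * w) (m - 1)))"
  have "S = (\<Sum>n\<in>low_polys m. chi (Polynomial.coeff ((n + n0) * w) (m - 1)))"
    unfolding S_def
  proof (rule sum.reindex_bij_witness[of _ "\<lambda>n. n + n0" "\<lambda>n. n - n0"])
    fix n :: "'p mod_ring poly" assume n: "n \<in> low_polys m"
    show "n - n0 \<in> low_polys m" "n + n0 \<in> low_polys m"
      by (rule low_polysI[OF m], simp add: coeff_low_poly[OF n] coeff_low_poly[OF n0])+
  qed auto
  also have "\<dots> = S * chi (Polynomial.coeff w k)"
    unfolding S_def distrib_right coeff_add chi_add c0 sum_distrib_right ..
  finally have "S * (chi (Polynomial.coeff w k) - 1) = 0" by (simp add: algebra_simps)
  moreover have "chi (Polynomial.coeff w k) \<noteq> 1" using chi_eq_1D k by blast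
  ultimately have "S = 0" by simp
  then show ?thesis using False unfolding S_def by simp
qed

section \<open>Regular grids and discrete orthogonality\<close>

definition grid :: "nat \<Rightarrow> nat \<Rightarrow> real set" where
  "grid b n = (\<lambda>k. real k / real b ^ n) ` {..<b ^ n}"

lemma finite_grid [simp]: "finite (grid b n)" by (simp add: grid_def)

lemma card_grid: "b > 0 \<Longrightarrow> card (grid b n) = b ^ n"
  unfolding grid_def by (subst card_image) (simp_all add: inj_on_def)

lemma grid_subset:
  assumes "b > 0" shows "grid b n \<subseteq> {0..<1}"
proof
  fix z assume "z \<in> grid b n"
  then obtain k where k: "k < b ^ n" "z = real k / real b ^ n" by (auto simp: grid_def)
  have "real k < real b ^ n" using k(1) by (metis of_nat_less_iff of_nat_power)
  then show "z \<in> {0..<1}" using assms k(2) by simp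
qed

text \<open>Digits recover the coefficients, which gives injectivity; surjectivity follows by
  counting. Sums over the grid thereby become character sums.\<close>

lemma bij_nu:
  assumes n: "n > 0"
  shows "bij_betw (nu n) (low_polys n :: 'p::prime_card mod_ring poly set) (grid CARD('p) n)"
proof -
  have b: "CARD('p) > 0" using card_p_ge2[where 'p = 'p] by simp
  have inj: "inj_on (nu n) (low_polys n :: 'p mod_ring poly set)"
  proof (rule inj_onI)
    fix x y :: "'p mod_ring poly" assume xy: "x \<in> low_polys n" "y \<in> low_polys n" and e: "nu n x = nu n y"
    show "x = y"
    proof (rule poly_eqI)
      fix k
      show "Polynomial.coeff x k = Polynomial.coeff y k"
      proof (cases "k < n")
        case True
        then have "to_int_mod_ring (Polynomial.coeff x k) = to_int_mod_ring (Polynomial.coeff y k)"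
          using real_digit_nu[of n x "n - 1 - k"] real_digit_nu[of n y "n - 1 - k"] e by simp
        then show ?thesis by (metis of_int_to_int)
      qed (use coeff_low_poly[OF xy(1), of k] coeff_low_poly[OF xy(2), of k] in simp)
    qed
  qed
  have sub: "nu n ` (low_polys n :: 'p mod_ring poly set) \<subseteq> grid CARD('p) n"
  proof
    fix z assume "z \<in> nu n ` (low_polys n :: 'p mod_ring poly set)"
    then obtain v :: "'p mod_ring poly" where z: "z = nu n v" by blast
    have "nat (nu_num n v) < CARD('p) ^ n" using nu_num_bounds[of n v] by (simp add: nat_less_iff)
    then show "z \<in> grid CARD('p) n" unfolding z nu_eq grid_def using nu_num_bounds(1)[of n v]
      by (intro image_eqI[of _ _ "nat (nu_num n v)"]) auto
  qed
  have "nu n ` (low_polys n :: 'p mod_ring poly set) = grid CARD('p) n"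
    by (rule card_subset_eq[OF finite_grid sub])
      (simp add: card_image[OF inj] card_low_polys[OF n] card_grid[OF b])
  with inj show ?thesis by (simp add: bij_betw_def)
qed

text \<open>The sum is a character sum for \<open>tr n k - tr n h\<close>. Distinct numbers below
  \<open>CARD('p) ^ n\<close> differ in one of the first \<open>n\<close> digits, and distinct
  digits stay distinct in the field.\<close>

lemma wal_orthogonal:
  assumes n: "psi CARD('p) k < n" "psi CARD('p) h < n" and kh: "k \<noteq> h"
  shows "(\<Sum>z\<in>grid CARD('p::prime_card) n. wal CARD('p) k z * cnj (wal CARD('p) h z)) = 0"
proof -
  have n0: "n > 0" using n by simp
  let ?w = "tr n k - tr n h :: 'p mod_ring poly"
  have "(\<Sum>z\<in>grid CARD('p) n. wal CARD('p) k z * cnj (wal CARD('p) h z))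
     = (\<Sum>v\<in>(low_polys n :: 'p mod_ring poly set). wal CARD('p) k (nu n v) * cnj (wal CARD('p) h (nu n v)))"
    by (rule sum.reindex_bij_betw[OF bij_nu[OF n0], symmetric])
  also have "\<dots> = (\<Sum>v\<in>low_polys n. chi (Polynomial.coeff (v * ?w) (n - 1)))"
    by (simp add: wal_nu[OF n0] right_diff_distrib chi_diff)
  also have "\<dots> = 0"
  proof -
    have "\<not> (\<forall>i<n. Polynomial.coeff ?w i = 0)"
    proof
      assume a: "\<forall>i<n. Polynomial.coeff ?w i = 0"
      have "nat_digit CARD('p) k i = nat_digit CARD('p) h i" if i: "i < n" for i
      proof -
        have "(of_nat (nat_digit CARD('p) k i) :: 'p mod_ring) = of_nat (nat_digit CARD('p) h i)"
          using a i by (simp add: coeff_tr)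
        then have "to_int_mod_ring (of_int (int (nat_digit CARD('p) k i)) :: 'p mod_ring)
            = to_int_mod_ring (of_int (int (nat_digit CARD('p) h i)) :: 'p mod_ring)" by simp
        then show ?thesis unfolding to_int_of_int nat_digit_def by (simp flip: zmod_int)
      qed
      then have "k = h"
        using less_power_psi[OF card_p_ge2 n(1)] less_power_psi[OF card_p_ge2 n(2)]
          card_p_ge2[where 'p = 'p] by (intro nat_digit_eqI[of "CARD('p)" k n h]) auto
      with kh show False ..
    qed
    then show ?thesis unfolding sum_chi_low_polys[OF n0] by simp
  qed
  finally show ?thesis .
qed

section \<open>Summability of the weights\<close>

lemma r_wal_pos: "b \<ge> 2 \<Longrightarrow> r_wal b \<beta> h > 0"
  by (simp add: r_wal_def)

lemma r_wal_powr: "r_wal b \<alpha> h powr \<theta> = r_wal b (\<alpha> * \<theta>) h"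
  by (simp add: r_wal_def powr_powr mult_ac)

text \<open>Since \<open>h\<close> is below the power of \<open>b\<close> with exponent
  \<open>psi b h + 1\<close>, the weight is at most \<open>b powr \<beta>\<close> times
  \<open>h powr - \<beta>\<close>, a convergent series.\<close>

lemma r_wal_summable:
  assumes b: "b \<ge> 2" and \<beta>: "\<beta> > 1"
  shows "r_wal b \<beta> summable_on {1..}"
proof -
  have "(\<lambda>n. real n powr - \<beta>) summable_on (UNIV :: nat set)"
    using \<beta> by (intro norm_summable_imp_summable_on) (simp add: summable_real_powr_iff)
  then have "(\<lambda>n. real b powr \<beta> * real n powr - \<beta>) summable_on {1..}"
    by (intro summable_on_cmult_right) (rule summable_on_subset_banach, auto)
  then show ?thesis
  proof (rule summable_on_comparison_test)
    fix h :: nat assume "h \<in> {1..}"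
    then have h: "h \<ge> 1" by simp
    have "h \<le> b ^ (psi b h + 1)" using psi_bounds(2)[OF b h] by simp
    then have "real h \<le> real b ^ (psi b h + 1)" by (metis of_nat_le_iff of_nat_power)
    also have "\<dots> = real b powr (real (psi b h) + 1)"
      using b powr_realpow[of "real b" "psi b h + 1"] by (simp add: add.commute)
    finally have "(real b powr (real (psi b h) + 1)) powr - \<beta> \<le> real h powr - \<beta>"
      using h \<beta> by (intro powr_mono2') auto
    then have "real b powr \<beta> * real b powr ((real (psi b h) + 1) * - \<beta>) \<le> real b powr \<beta> * real h powr - \<beta>"
      using b by (intro mult_left_mono) (simp_all add: powr_powr)
    also have "real b powr \<beta> * real b powr ((real (psi b h) + 1) * - \<beta>) = r_wal b \<beta> h"
      unfolding r_wal_def powr_add[symmetric] by (simp add: algebra_simps)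
    finally show "r_wal b \<beta> h \<le> real b powr \<beta> * real h powr - \<beta>" .
    show "0 \<le> r_wal b \<beta> h" by (simp add: r_wal_def)
  qed
qed

lemma mu_nonneg: "mu b \<beta> \<ge> 0"
  unfolding mu_def by (rule infsum_nonneg) (simp add: r_wal_def)

lemma r_wal_nonneg [simp]: "r_wal b \<beta> h \<ge> 0"
  by (simp add: r_wal_def)

lemma summable_on_prod_PiE:
  fixes f :: "nat \<Rightarrow> real"
  assumes "finite u" "f summable_on A" "\<And>x. f x \<ge> 0"
  shows "(\<lambda>h. \<Prod>j\<in>u. f (h j)) summable_on (u \<rightarrow>\<^sub>E A)"
proof -
  have "Infinite_Sum.abs_summable_on f A" using assms(2,3) by simp
  then have "Infinite_Set_Sum.abs_summable_on f A" by (simp only: abs_summable_equivalent)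
  then have "Infinite_Set_Sum.abs_summable_on (\<lambda>h. \<Prod>j\<in>u. f (h j)) (u \<rightarrow>\<^sub>E A)"
    by (intro abs_summable_on_prod_PiE assms(1)) auto
  then have "Infinite_Sum.abs_summable_on (\<lambda>h. \<Prod>j\<in>u. f (h j)) (u \<rightarrow>\<^sub>E A)"
    by (simp only: abs_summable_equivalent)
  then show ?thesis by (rule abs_summable_summable)
qed

lemma prod_r_wal_summable:
  assumes "finite u" "b \<ge> 2" "\<beta> > 1"
  shows "(\<lambda>h. \<Prod>j\<in>u. r_wal b \<beta> (h j)) summable_on (u \<rightarrow>\<^sub>E {1..})"
  by (rule summable_on_prod_PiE[OF assms(1) r_wal_summable[OF assms(2,3)]]) simp

lemma infsum_prod_r_wal:
  assumes "finite u" "b \<ge> 2" "\<beta> > 1"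
  shows "(\<Sum>\<^sub>\<infinity>h\<in>u \<rightarrow>\<^sub>E {1..}. \<Prod>j\<in>u. r_wal b \<beta> (h j)) = mu b \<beta> ^ card u"
  using infsum_prod_PiE[of u "\<lambda>_. r_wal b \<beta>" "\<lambda>_. {1..}", OF assms(1) r_wal_summable[OF assms(2,3)] prod_r_wal_summable[OF assms]]
  by (simp add: mu_def)

text \<open>A pair consists of the support \<open>u\<close> of a frequency vector and its positive
  entries on \<open>u\<close>, which flattens the nested sums of the kernel. The coefficients
  \<open>c\<close> and the exponent \<open>\<beta>\<close> stay free so that powers of the weights
  with exponent \<open>\<theta>\<close> have the same form.\<close>

definition wt :: "nat \<Rightarrow> real \<Rightarrow> (nat set \<Rightarrow> real) \<Rightarrow> nat set \<times> (nat \<Rightarrow> nat) \<Rightarrow> real" where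
  "wt b \<beta> c = (\<lambda>(u, h). c u * (\<Prod>j\<in>u. r_wal b \<beta> (h j)))"

abbreviation freqs :: "nat set set \<Rightarrow> (nat set \<times> (nat \<Rightarrow> nat)) set" where
  "freqs U \<equiv> SIGMA u:U. u \<rightarrow>\<^sub>E {1..}"

lemma wt_has_sum:
  assumes "b \<ge> 2" "\<beta> > 1" "finite U" "\<And>u. u \<in> U \<Longrightarrow> finite u" "\<And>u. u \<in> U \<Longrightarrow> c u \<ge> 0"
  shows "(wt b \<beta> c has_sum (\<Sum>u\<in>U. c u * mu b \<beta> ^ card u)) (freqs U)"
proof (rule has_sum_SigmaI)
  show h: "((\<lambda>h. wt b \<beta> c (u, h)) has_sum c u * mu b \<beta> ^ card u) (u \<rightarrow>\<^sub>E {1..})" if "u \<in> U" for u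
    unfolding wt_def prod.case infsum_prod_r_wal[OF assms(4)[OF that] assms(1,2), symmetric]
    by (intro has_sum_cmult_right has_sum_infsum prod_r_wal_summable assms that)
  show "((\<lambda>u. c u * mu b \<beta> ^ card u) has_sum (\<Sum>u\<in>U. c u * mu b \<beta> ^ card u)) U"
    using assms(3) by simp
  show "wt b \<beta> c summable_on freqs U"
  proof (rule summable_on_SigmaI[OF h])
    show "(\<lambda>u. c u * mu b \<beta> ^ card u) summable_on U" using assms(3) by simp
    show "0 \<le> wt b \<beta> c (u, h)" if "u \<in> U" for u h
      using assms(5)[OF that] by (simp add: wt_def prod_nonneg)
  qed
qed

section \<open>Multivariate Walsh functions and grid cells\<close>

definition walv :: "nat \<Rightarrow> nat set \<times> (nat \<Rightarrow> nat) \<Rightarrow> (nat \<Rightarrow> real) \<Rightarrow> complex" where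
  "walv b = (\<lambda>(u, h) x. \<Prod>j\<in>u. wal b (h j) (x j))"

definition trunc :: "nat \<Rightarrow> nat \<Rightarrow> nat \<Rightarrow> (nat \<Rightarrow> real) \<Rightarrow> nat \<Rightarrow> real" where
  "trunc b s n x = (\<lambda>j\<in>{1..s}. of_int \<lfloor>x j * real b ^ n\<rfloor> / real b ^ n)"

lemma trunc_in_grid:
  assumes b: "b > 0" and x: "x \<in> {0..<1}"
  shows "of_int \<lfloor>x * real b ^ n\<rfloor> / real b ^ n \<in> grid b n"
proof -
  have 0: "0 \<le> \<lfloor>x * real b ^ n\<rfloor>" using x by simp
  have "x * real b ^ n < 1 * real b ^ n" using x b by (intro mult_strict_right_mono) auto
  then have "\<lfloor>x * real b ^ n\<rfloor> < int (b ^ n)" by (simp add: floor_less_iff)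
  then have "nat \<lfloor>x * real b ^ n\<rfloor> < b ^ n" using 0 by linarith
  then show ?thesis unfolding grid_def using 0 by (intro image_eqI[of _ _ "nat \<lfloor>x * real b ^ n\<rfloor>"]) auto
qed

lemma trunc_eq_iff:
  assumes b: "b > 0" and z: "z \<in> grid b n"
  shows "x \<in> {0..<1} \<and> of_int \<lfloor>x * real b ^ n\<rfloor> / real b ^ n = z \<longleftrightarrow> x \<in> {z..<z + 1 / real b ^ n}"
proof -
  obtain k where k: "k < b ^ n" "z = real k / real b ^ n" using z by (auto simp: grid_def)
  have B: "real b ^ n > 0" using b by simp
  have kb: "real k + 1 \<le> real b ^ n"
    using k(1) by (metis Suc_leI of_nat_Suc of_nat_le_iff of_nat_power add.commute)
  have z1: "z + 1 / real b ^ n = (real k + 1) / real b ^ n"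
    by (simp add: k(2) add_divide_distrib)
  have "of_int \<lfloor>x * real b ^ n\<rfloor> / real b ^ n = z \<longleftrightarrow> \<lfloor>x * real b ^ n\<rfloor> = int k"
  proof -
    have "real_of_int \<lfloor>x * real b ^ n\<rfloor> = real k \<longleftrightarrow> \<lfloor>x * real b ^ n\<rfloor> = int k"
      by (metis of_int_eq_iff of_int_of_nat_eq)
    then show ?thesis using b k(2) by simp
  qed
  also have "\<dots> \<longleftrightarrow> real k \<le> x * real b ^ n \<and> x * real b ^ n < real k + 1"
    by (simp add: floor_eq_iff)
  also have "\<dots> \<longleftrightarrow> x \<in> {z..<z + 1 / real b ^ n}"
    unfolding z1 using b by (simp add: k(2) pos_divide_le_eq pos_less_divide_eq)
  finally have 1: "of_int \<lfloor>x * real b ^ n\<rfloor> / real b ^ n = z \<longleftrightarrow> x \<in> {z..<z + 1 / real b ^ n}" .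
  have "z \<ge> 0" "z + 1 / real b ^ n \<le> 1"
    unfolding z1 using b kb by (simp_all add: k(2) pos_divide_le_eq)
  then have "x \<in> {z..<z + 1 / real b ^ n} \<Longrightarrow> x \<in> {0..<1}" by auto
  with 1 show ?thesis by blast
qed

text \<open>As a box of half-open intervals of equal length, each cell is measurable in the product
  space and all cells of a level have the same volume.\<close>

lemma cell_eq:
  assumes b: "b > 0" and z: "z \<in> {1..s} \<rightarrow>\<^sub>E grid b n"
  shows "{x \<in> {1..s} \<rightarrow>\<^sub>E {0..<1}. trunc b s n x = z} = (\<Pi>\<^sub>E j\<in>{1..s}. {z j..<z j + 1 / real b ^ n})"
proof (rule Set.set_eqI)
  fix x
  have z0: "z j = undefined" if "j \<notin> {1..s}" for j using z that by (rule PiE_arb)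
  have zj: "z j \<in> grid b n" if "j \<in> {1..s}" for j using z that by (rule PiE_mem)
  have "trunc b s n x = z \<longleftrightarrow> (\<forall>j\<in>{1..s}. of_int \<lfloor>x j * real b ^ n\<rfloor> / real b ^ n = z j)"
  proof
    assume "trunc b s n x = z"
    then show "\<forall>j\<in>{1..s}. of_int \<lfloor>x j * real b ^ n\<rfloor> / real b ^ n = z j" by (force simp: trunc_def)
  next
    assume a: "\<forall>j\<in>{1..s}. of_int \<lfloor>x j * real b ^ n\<rfloor> / real b ^ n = z j"
    show "trunc b s n x = z"
    proof
      fix j show "trunc b s n x j = z j" using a z0[of j] by (simp add: trunc_def)
    qed
  qed
  then show "x \<in> {x \<in> {1..s} \<rightarrow>\<^sub>E {0..<1}. trunc b s n x = z} \<longleftrightarrow> x \<in> (\<Pi>\<^sub>E j\<in>{1..s}. {z j..<z j + 1 / real b ^ n})"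
    unfolding mem_Collect_eq PiE_iff using trunc_eq_iff[OF b zj] by blast
qed

lemma walv_trunc:
  assumes b: "b \<ge> 2" and u: "u \<subseteq> {1..s}"
  shows "\<forall>\<^sub>F n in sequentially. \<forall>x. walv b (u, h) (trunc b s n x) = walv b (u, h) x"
proof -
  have "finite u" using u finite_subset by blast
  then have "\<forall>\<^sub>F n in sequentially. \<forall>j\<in>u. psi b (h j) < n"
    by (intro eventually_ball_finite) (auto intro: eventually_gt_at_top)
  then show ?thesis
  proof eventually_elim
    case (elim n)
    have "wal b (h j) (trunc b s n x j) = wal b (h j) (x j)" if "j \<in> u" for j x
      using wal_trunc[OF b, of "h j" n] elim that u by (auto simp: trunc_def)
    then show ?case by (simp add: walv_def)
  qed
qed

text \<open>The sum over the product grid factors into one-dimensional sums, and a coordinate in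
  which the two frequencies differ contributes a factor 0.\<close>

lemma walv_orthogonal:
  assumes i: "i \<in> freqs (Pow {1..s})" and k: "k \<in> freqs (Pow {1..s})" and ik: "i \<noteq> k"
  shows "\<forall>\<^sub>F n in sequentially. (\<Sum>z\<in>{1..s} \<rightarrow>\<^sub>E grid CARD('p::prime_card) n.
    walv CARD('p) i z * cnj (walv CARD('p) k z)) = 0"
proof -
  obtain u h where uh: "i = (u, h)" "u \<subseteq> {1..s}" "h \<in> u \<rightarrow>\<^sub>E {1..}" using i by auto
  obtain v l where vl: "k = (v, l)" "v \<subseteq> {1..s}" "l \<in> v \<rightarrow>\<^sub>E {1..}" using k by auto
  \<comment> \<open>Extension by the frequency 0, whose Walsh function is 1, puts vectors with
    different supports on the common index set \<open>{1..s}\<close>.\<close>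
  define a where "a j = (if j \<in> u then h j else 0)" for j
  define c where "c j = (if j \<in> v then l j else 0)" for j
  have hj: "h j \<ge> 1" if "j \<in> u" for j using PiE_mem[OF uh(3) that] by simp
  have lj: "l j \<ge> 1" if "j \<in> v" for j using PiE_mem[OF vl(3) that] by simp
  have ext: "(\<Prod>j\<in>u. wal b (h j) (x j)) = (\<Prod>j\<in>{1..s}. wal b (a j) (x j))"
    "(\<Prod>j\<in>v. wal b (l j) (x j)) = (\<Prod>j\<in>{1..s}. wal b (c j) (x j))" for b x
    using uh(2) vl(2) by (auto intro!: prod.mono_neutral_cong_left simp: a_def c_def)
  \<comment> \<open>The entries on the supports are positive, so the extensions determine
    \<open>u\<close> and \<open>v\<close>; off the supports both functions are
    \<open>undefined\<close>.\<close>
  have "\<exists>j\<in>{1..s}. a j \<noteq> c j"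
  proof (rule ccontr)
    assume "\<not> (\<exists>j\<in>{1..s}. a j \<noteq> c j)"
    then have e: "a j = c j" for j using uh(2) vl(2) by (cases "j \<in> {1..s}") (auto simp: a_def c_def)
    have uv: "u = v"
    proof (rule Set.set_eqI)
      fix j show "j \<in> u \<longleftrightarrow> j \<in> v" using e[of j] hj[of j] lj[of j] by (auto simp: a_def c_def split: if_splits)
    qed
    have "h = l"
    proof
      fix j show "h j = l j"
        using e[of j] uv PiE_arb[OF uh(3), of j] PiE_arb[OF vl(3), of j]
        by (cases "j \<in> u") (auto simp: a_def c_def)
    qed
    with uv ik uh(1) vl(1) show False by simp
  qed
  then obtain j0 where j0: "j0 \<in> {1..s}" "a j0 \<noteq> c j0" by blast
  have "\<forall>\<^sub>F n in sequentially. psi CARD('p) (a j0) < n \<and> psi CARD('p) (c j0) < n"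
    by (intro eventually_conj eventually_gt_at_top)
  then show ?thesis
  proof eventually_elim
    case (elim n)
    have "(\<Sum>z\<in>{1..s} \<rightarrow>\<^sub>E grid CARD('p) n. walv CARD('p) i z * cnj (walv CARD('p) k z))
      = (\<Sum>z\<in>{1..s} \<rightarrow>\<^sub>E grid CARD('p) n. \<Prod>j\<in>{1..s}. wal CARD('p) (a j) (z j) * cnj (wal CARD('p) (c j) (z j)))"
      by (simp add: walv_def uh(1) vl(1) ext prod.distrib)
    also have "\<dots> = (\<Prod>j\<in>{1..s}. \<Sum>z\<in>grid CARD('p) n. wal CARD('p) (a j) z * cnj (wal CARD('p) (c j) z))"
      by (rule prod_sum_PiE[symmetric]) auto
    also have "\<dots> = 0"
      by (rule prod_zero[OF _ bexI[OF _ j0(1)]]) (use elim j0(2) in \<open>auto intro: wal_orthogonal\<close>)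
    finally show ?case .
  qed
qed

section \<open>Lattice nodes, the dual lattice and the error formula\<close>

lemma node_mem: "node m s g n \<in> {1..s} \<rightarrow>\<^sub>E {0..<1}"
proof -
  have "nu m v \<in> {0..<1}" for v :: "'a mod_ring poly"
  proof -
    have "real_of_int (nu_num m v) < real_of_int (int CARD('a) ^ m)" using nu_num_bounds(2)[of m v] by (simp only: of_int_less_iff)
    moreover have "real_of_int (nu_num m v) \<ge> 0" using nu_num_bounds(1)[of m v] by simp
    ultimately show ?thesis using card_p_ge2[where 'p = 'a] by (simp add: nu_eq)
  qed
  then show ?thesis by (auto simp: node_def)
qed

text \<open>Vanishing of all coefficients below \<open>m\<close> is the congruence to 0 modulo x^m
  that defines the dual lattice.\<close>

definition dual :: "nat \<Rightarrow> (nat \<Rightarrow> 'p::prime_card mod_ring poly) \<Rightarrow> nat set \<times> (nat \<Rightarrow> nat) \<Rightarrow> bool" where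
  "dual m g = (\<lambda>(u, h). \<forall>k<m. Polynomial.coeff (\<Sum>j\<in>u. tr m (h j) * g j) k = 0)"

text \<open>By \<open>wal_nu\<close> the product of Walsh values at a node is one character value,
  linear in the node polynomial \<open>n\<close>; orthogonality then detects membership in the dual
  lattice.\<close>

lemma lattice_walv:
  fixes g :: "nat \<Rightarrow> 'p::prime_card mod_ring poly"
  assumes m: "m > 0" and u: "u \<subseteq> {1..s}"
  shows "(\<Sum>n\<in>low_polys m. walv CARD('p) (u, h) (node m s g n)) / of_nat (card (low_polys m :: 'p mod_ring poly set))
    = of_bool (dual m g (u, h))"
proof -
  have "walv CARD('p) (u, h) (node m s g n)
      = chi (Polynomial.coeff (n * (\<Sum>j\<in>u. tr m (h j) * g j)) (m - 1))" for n
  proof -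
    have "walv CARD('p) (u, h) (node m s g n) = (\<Prod>j\<in>u. wal CARD('p) (h j) (nu m (n * g j)))"
      unfolding walv_def prod.case by (rule prod.cong) (use u in \<open>auto simp: node_def\<close>)
    also have "\<dots> = chi (Polynomial.coeff (\<Sum>j\<in>u. n * g j * tr m (h j)) (m - 1))"
      by (simp only: wal_nu[OF m] coeff_sum chi_sum)
    also have "(\<Sum>j\<in>u. n * g j * tr m (h j)) = n * (\<Sum>j\<in>u. tr m (h j) * g j)"
      unfolding sum_distrib_left by (simp add: mult_ac)
    finally show ?thesis .
  qed
  then show ?thesis
    using sum_chi_low_polys[OF m, of "\<Sum>j\<in>u. tr m (h j) * g j"] card_p_ge2[where 'p = 'p]
    by (simp add: dual_def card_low_polys[OF m])
qed

lemma walsh_kernel_quadrature: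
  fixes \<gamma> :: "nat set \<Rightarrow> real"
  assumes \<alpha>: "\<alpha> > 1" and \<gamma>: "\<And>u. finite u \<Longrightarrow> u \<subseteq> {1..} \<Longrightarrow> \<gamma> u > 0" and \<gamma>1: "\<gamma> {} = 1"
  shows "kernel_quadrature ({1..s} \<rightarrow>\<^sub>E {0..<1}) (freqs (Pow {1..s})) (wt CARD('p::prime_card) \<alpha> \<gamma>)
    (walv CARD('p)) (K_wal CARD('p) s \<alpha> \<gamma>) (\<lambda>n. {1..s} \<rightarrow>\<^sub>E grid CARD('p) n) (trunc CARD('p) s)
    (Pi\<^sub>M {1..s} (\<lambda>_. lborel)) ({}, \<lambda>_. undefined)"
proof -
  let ?b = "CARD('p)"
  have b: "?b \<ge> 2" by (rule card_p_ge2)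
  then have b0: "?b > 0" by simp
  have fin: "finite u" "u \<subseteq> {1..}" if "u \<in> Pow {1..s}" for u using that finite_subset by auto
  have \<gamma>p: "\<gamma> u > 0" if "u \<in> Pow {1..s}" for u using \<gamma>[OF fin[OF that]] .
  have wts: "(wt ?b \<alpha> \<gamma>) summable_on freqs (Pow {1..s})"
    by (rule has_sum_imp_summable, rule wt_has_sum[OF b \<alpha>]) (simp, (simp add: fin less_imp_le[OF \<gamma>p])+)
  have wtp: "wt ?b \<alpha> \<gamma> i > 0" if i: "i \<in> freqs (Pow {1..s})" for i
  proof -
    obtain u h where "i = (u, h)" "u \<in> Pow {1..s}" using i by (elim SigmaE)
    then show ?thesis by (simp add: wt_def \<gamma>p prod_pos r_wal_pos[OF b])
  qed
  have cardZ: "card ({1..s} \<rightarrow>\<^sub>E grid ?b n) = (?b ^ n) ^ s" for n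
    by (simp add: card_PiE card_grid)
  interpret P: product_sigma_finite "\<lambda>_::nat. lborel :: real measure"
    by unfold_locales
  show ?thesis
  proof unfold_locales
    fix i k :: "nat set \<times> (nat \<Rightarrow> nat)" and n :: nat
    assume i: "i \<in> freqs (Pow {1..s})"
    then show "wt ?b \<alpha> \<gamma> i > 0" by (rule wtp)
    show "\<forall>\<^sub>F n in sequentially. \<forall>x\<in>{1..s} \<rightarrow>\<^sub>E {0..<1}. walv ?b i (trunc ?b s n x) = walv ?b i x"
    proof -
      obtain u h where "i = (u, h)" "u \<subseteq> {1..s}" using i by auto
      then show ?thesis using walv_trunc[OF b, of u s h] by (auto elim: eventually_mono)
    qed
    show "cmod (walv ?b i x) = 1" for x
      by (cases i) (simp add: walv_def prod_norm[symmetric])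
    show "\<forall>\<^sub>F n in sequentially. (\<Sum>z\<in>{1..s} \<rightarrow>\<^sub>E grid ?b n. walv ?b i z * cnj (walv ?b k z)) = 0"
      if "k \<in> freqs (Pow {1..s})" "i \<noteq> k" using walv_orthogonal[OF i that] .
  next
    show "(wt ?b \<alpha> \<gamma>) summable_on freqs (Pow {1..s})" by (rule wts)
  next
    fix x y :: "nat \<Rightarrow> real"
    let ?F = "\<lambda>i. of_real (wt ?b \<alpha> \<gamma> i) * walv ?b i x * cnj (walv ?b i y)"
    have "?F summable_on freqs (Pow {1..s})"
    proof (rule abs_summable_summable, rule summable_on_comparison_test[OF wts])
      fix i assume "i \<in> freqs (Pow {1..s})"
      then have "wt ?b \<alpha> \<gamma> i \<ge> 0" by (rule less_imp_le[OF wtp])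
      then show "cmod (?F i) \<le> wt ?b \<alpha> \<gamma> i"
        by (cases i) (simp add: walv_def norm_mult prod_norm[symmetric])
    qed simp
    from infsum_Sigma_banach[OF this, symmetric]
    have "(\<Sum>\<^sub>\<infinity>i\<in>freqs (Pow {1..s}). ?F i) = (\<Sum>u\<in>Pow {1..s}. \<Sum>\<^sub>\<infinity>h\<in>u \<rightarrow>\<^sub>E {1..}. ?F (u, h))"
      by simp
    also have "\<dots> = (\<Sum>\<^sub>\<infinity>h\<in>{} \<rightarrow>\<^sub>E {1..}. ?F ({}, h)) + (\<Sum>u\<in>Pow {1..s} - {{}}. \<Sum>\<^sub>\<infinity>h\<in>u \<rightarrow>\<^sub>E {1..}. ?F (u, h))"
      by (rule sum.remove) auto
    \<comment> \<open>The only function on the empty set is \<open>\<lambda>_. undefined\<close>;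
      with \<open>\<gamma> {} = 1\<close> it accounts for the summand 1 of
      \<open>K_wal\<close>.\<close>
    also have "(\<Sum>\<^sub>\<infinity>h\<in>{} \<rightarrow>\<^sub>E {1..}. ?F ({}, h)) = 1"
      by (simp add: wt_def walv_def \<gamma>1)
    also have "(\<Sum>u\<in>Pow {1..s} - {{}}. \<Sum>\<^sub>\<infinity>h\<in>u \<rightarrow>\<^sub>E {1..}. ?F (u, h)) = (\<Sum>u\<in>Pow {1..s} - {{}}. of_real (\<gamma> u) *
           (\<Sum>\<^sub>\<infinity>h\<in>u \<rightarrow>\<^sub>E {1..}. of_real (\<Prod>j\<in>u. r_wal ?b \<alpha> (h j)) *
              (\<Prod>j\<in>u. wal ?b (h j) (x j)) * cnj (\<Prod>j\<in>u. wal ?b (h j) (y j))))"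
      unfolding infsum_cmult_right'[symmetric] wt_def walv_def prod.case of_real_mult by (simp only: mult.assoc)
    finally show "K_wal ?b s \<alpha> \<gamma> x y = (\<Sum>\<^sub>\<infinity>i\<in>freqs (Pow {1..s}). ?F i)"
      unfolding K_wal_def by (rule sym)
  next
    fix n
    show "finite ({1..s} \<rightarrow>\<^sub>E grid ?b n)" by (intro finite_PiE) auto
    show "({1..s} \<rightarrow>\<^sub>E grid ?b n) \<noteq> {}" 
    proof -
      have "grid ?b n \<noteq> {}" using card_grid[OF b0, of n] by auto
      then show ?thesis by (simp add: PiE_eq_empty_iff)
    qed
    show "({1..s} \<rightarrow>\<^sub>E grid ?b n) \<subseteq> {1..s} \<rightarrow>\<^sub>E {0..<1}" by (rule PiE_mono) (rule grid_subset[OF b0])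
    show "trunc ?b s n x \<in> {1..s} \<rightarrow>\<^sub>E grid ?b n" if "x \<in> {1..s} \<rightarrow>\<^sub>E {0..<1}" for x
      unfolding trunc_def using PiE_mem[OF that] trunc_in_grid[OF b0] by (intro restrict_PiE_iff[THEN iffD2]) blast
    fix z assume z: "z \<in> {1..s} \<rightarrow>\<^sub>E grid ?b n"
    show "{x \<in> {1..s} \<rightarrow>\<^sub>E {0..<1}. trunc ?b s n x = z} \<in> sets (Pi\<^sub>M {1..s} (\<lambda>_. lborel))"
      unfolding cell_eq[OF b0 z] by (intro sets_PiM_I_finite) auto
    show "emeasure (Pi\<^sub>M {1..s} (\<lambda>_. lborel)) {x \<in> {1..s} \<rightarrow>\<^sub>E {0..<1}. trunc ?b s n x = z}
        = ennreal (1 / real (card ({1..s} \<rightarrow>\<^sub>E grid ?b n)))"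
      unfolding cell_eq[OF b0 z] cardZ
      by (subst P.emeasure_PiM) (simp_all add: ennreal_power power_one_over)
  next
    show "({}, \<lambda>_. undefined) \<in> freqs (Pow {1..s})" by simp
    show "walv ?b ({}, \<lambda>_. undefined) x = 1" for x by (simp add: walv_def)
  qed
qed

theorem worst_case_error_formula:
  fixes \<gamma> :: "nat set \<Rightarrow> real" and g :: "nat \<Rightarrow> 'p::prime_card mod_ring poly"
  assumes \<alpha>: "\<alpha> > 1" and \<gamma>: "\<And>u. finite u \<Longrightarrow> u \<subseteq> {1..} \<Longrightarrow> \<gamma> u > 0" and \<gamma>1: "\<gamma> {} = 1"
    and m: "m > 0"
  shows "worst_case_error \<alpha> \<gamma> m s g
    = sqrt (\<Sum>\<^sub>\<infinity>i\<in>freqs (Pow {1..s} - {{}}). wt CARD('p) \<alpha> \<gamma> i * of_bool (dual m g i))"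
proof -
  let ?b = "CARD('p)" and ?D = "{1..s} \<rightarrow>\<^sub>E {0..<1::real}"
  interpret Q: kernel_quadrature ?D "freqs (Pow {1..s})" "wt ?b \<alpha> \<gamma>" "walv ?b" "K_wal ?b s \<alpha> \<gamma>"
    "\<lambda>n. {1..s} \<rightarrow>\<^sub>E grid ?b n" "trunc ?b s" "Pi\<^sub>M {1..s} (\<lambda>_. lborel)" "({}, \<lambda>_. undefined)"
    by (rule walsh_kernel_quadrature) fact+
  have ne: "(low_polys m :: 'p mod_ring poly set) \<noteq> {}" using m by (auto simp: low_polys_def intro!: exI[of _ 0])
  have "worst_case_error \<alpha> \<gamma> m s g = (SUP f\<in>rkhs_unit_ball ?D (K_wal ?b s \<alpha> \<gamma>).
     cmod ((LINT x|Pi\<^sub>M {1..s} (\<lambda>_. lborel). f x) - Q.qrule (low_polys m) (node m s g) f))"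
    unfolding worst_case_error_def
  proof (rule SUP_cong[OF refl])
    fix f assume "f \<in> rkhs_unit_ball ?D (K_wal ?b s \<alpha> \<gamma>)"
    then obtain H ip where "rkhs ?D (K_wal ?b s \<alpha> \<gamma>) H ip" "f \<in> H" unfolding rkhs_unit_ball_def by blast
    \<comment> \<open>Members of the space vanish off the half-open cube, so integrating over the
      closed cube and over the whole product space gives the same value.\<close>
    then have f0: "f x = 0" if "x \<notin> ?D" for x
      using that function_hilbert_space.vanish rkhs.axioms(1) by metis
    have "indicator ({1..s} \<rightarrow>\<^sub>E {0..1}) x *\<^sub>R f x = f x" for x
    proof (cases "x \<in> ?D")
      case True
      then have "x \<in> {1..s} \<rightarrow>\<^sub>E {0..1}" by (force simp: PiE_iff)
      then show ?thesis by simp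
    qed (simp add: f0)
    then have "(LINT x:({1..s} \<rightarrow>\<^sub>E {0..1})|Pi\<^sub>M {1..s} (\<lambda>_. lborel). f x) = (LINT x|Pi\<^sub>M {1..s} (\<lambda>_. lborel). f x)"
      by (simp add: set_lebesgue_integral_def)
    moreover have "lattice_rule m s g f = Q.qrule (low_polys m) (node m s g) f"
      unfolding lattice_rule_def Q.qrule_def card_low_polys[OF m, where 'p = 'p] by (simp add: low_polys_def)
    ultimately show "cmod ((LINT x:({1..s} \<rightarrow>\<^sub>E {0..1})|Pi\<^sub>M {1..s} (\<lambda>_. lborel). f x) - lattice_rule m s g f)
      = cmod ((LINT x|Pi\<^sub>M {1..s} (\<lambda>_. lborel). f x) - Q.qrule (low_polys m) (node m s g) f)" by simp
  qed
  also have "\<dots> = sqrt (Q.sqerr (low_polys m) (node m s g))"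
    by (rule Q.worst_case_error_formula[OF finite_low_polys[OF m] ne node_mem])
  also have "Q.sqerr (low_polys m) (node m s g)
     = (\<Sum>\<^sub>\<infinity>i\<in>freqs (Pow {1..s} - {{}}). wt ?b \<alpha> \<gamma> i * of_bool (dual m g i))"
    unfolding Q.sqerr_def
  proof (rule infsum_cong_neutral)
    fix i assume "i \<in> freqs (Pow {1..s}) - freqs (Pow {1..s} - {{}})"
    then have "i = ({}, \<lambda>_. undefined)" by auto
    then show "(if i = ({}, \<lambda>_. undefined) then 0
        else wt ?b \<alpha> \<gamma> i * (cmod (Q.qrule (low_polys m) (node m s g) (walv ?b i)))\<^sup>2) = 0" by simp
  next
    fix i assume i: "i \<in> freqs (Pow {1..s}) \<inter> freqs (Pow {1..s} - {{}})"
    then obtain u h where uh: "i = (u, h)" "u \<subseteq> {1..s}" "u \<noteq> {}" by auto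
    then have "Q.qrule (low_polys m) (node m s g) (walv ?b i) = of_bool (dual m g i)"
      unfolding Q.qrule_def uh(1) using lattice_walv[OF m uh(2)] by blast
    then show "(if i = ({}, \<lambda>_. undefined) then 0
        else wt ?b \<alpha> \<gamma> i * (cmod (Q.qrule (low_polys m) (node m s g) (walv ?b i)))\<^sup>2)
      = wt ?b \<alpha> \<gamma> i * of_bool (dual m g i)" using uh by simp
  qed auto
  finally show ?thesis .
qed

section \<open>Averaging over the last generator\<close>

text \<open>Being coprime to a positive power of the prime element x means not being divisible by x,
  that is, having a nonzero constant term.\<close>

lemma G_N_iff:
  fixes q :: "'p::prime_card mod_ring poly"
  assumes m: "m > 0"
  shows "q \<in> G_N m \<longleftrightarrow> q \<in> low_polys m \<and> Polynomial.coeff q 0 \<noteq> 0"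
proof -
  have X: "Polynomial.monom (1 :: 'p mod_ring) m = [:0, 1:] ^ m"
    by (simp add: monom_altdef)
  have "coprime q (Polynomial.monom 1 m) \<longleftrightarrow> coprime [:0, 1:] q"
    unfolding X using m by (simp add: coprime_commute)
  also have "\<dots> \<longleftrightarrow> \<not> [:0, 1:] dvd q"
  proof
    have p: "prime_elem ([:0, 1:] :: 'p mod_ring poly)" by (rule prime_elem_linear_field_poly) simp
    show "coprime [:0, 1:] q" if "\<not> [:0, 1:] dvd q" using prime_elem_imp_coprime[OF p that] .
    show "\<not> [:0, 1:] dvd q" if c: "coprime [:0, 1:] q"
    proof
      assume "[:0, 1:] dvd q"
      then have "is_unit ([:0, 1:] :: 'p mod_ring poly)" using c by (meson coprime_common_divisor dvd_refl)
      then show False using p by (simp add: prime_elem_def)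
    qed
  qed
  also have "\<dots> \<longleftrightarrow> Polynomial.coeff q 0 \<noteq> 0"
    using poly_eq_0_iff_dvd[of q 0] by (simp add: poly_0_coeff_0)
  finally show ?thesis by (auto simp: G_N_def low_polys_def)
qed

lemma finite_G_N: "m > 0 \<Longrightarrow> finite (G_N m :: 'p::prime_card mod_ring poly set)"
  by (rule finite_subset[OF _ finite_low_polys]) (auto simp: G_N_iff)

text \<open>Adding 1 sends the residues with constant term 0 injectively to units, so at least half
  of all residues are units. This is the origin of the factor 2 in the error bound.\<close>

lemma card_G_N:
  assumes m: "m > 0"
  shows "CARD('p::prime_card) ^ m \<le> 2 * card (G_N m :: 'p mod_ring poly set)"
proof -
  let ?G = "G_N m :: 'p mod_ring poly set"
  let ?Z = "{q \<in> low_polys m. Polynomial.coeff q 0 = 0} :: 'p mod_ring poly set"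
  have "card ?Z \<le> card ?G"
  proof (rule card_inj_on_le[of "\<lambda>q. q + 1"])
    show "(\<lambda>q. q + 1) ` ?Z \<subseteq> ?G"
    proof
      fix x assume "x \<in> (\<lambda>q. q + 1) ` ?Z"
      then obtain q where q: "q \<in> low_polys m" "Polynomial.coeff q 0 = 0" "x = q + 1" by auto
      have "x \<in> low_polys m"
        by (rule low_polysI[OF m]) (use m in \<open>simp add: q(3) coeff_low_poly[OF q(1)]\<close>)
      then show "x \<in> ?G" using q by (simp add: G_N_iff[OF m])
    qed
  qed (simp_all add: finite_G_N[OF m])
  moreover have "card (low_polys m :: 'p mod_ring poly set) = card ?G + card ?Z"
  proof -
    have "low_polys m = ?G \<union> ?Z" by (auto simp: G_N_iff[OF m])
    moreover have "?G \<inter> ?Z = {}" by (auto simp: G_N_iff[OF m])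
    ultimately show ?thesis
      using card_Un_disjoint[of ?G ?Z] finite_G_N[OF m, where 'p = 'p] finite_low_polys[OF m, where 'p = 'p] by auto
  qed
  ultimately show ?thesis by (simp add: card_low_polys[OF m])
qed

text \<open>The congruence \<open>tr m k * q + w \<equiv> 0 (mod x^m)\<close> forces \<open>tr m k\<close> and \<open>w\<close> to have the same
  \<open>x\<close>-adic valuation \<open>v\<close> because \<open>q\<close> is a unit, and then fixes \<open>q\<close> modulo \<open>x^(m - v)\<close>.\<close>

definition solutions ::
  "nat \<Rightarrow> 'p::prime_card mod_ring poly \<Rightarrow> nat \<Rightarrow> 'p mod_ring poly set" where
  "solutions m w k = {q \<in> G_N m. \<forall>i<m. Polynomial.coeff (tr m k * q + w) i = 0}"

text \<open>The x-adic valuation, capped at \<open>m\<close> because \<open>w\<close> matters only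
  modulo x^m.\<close>

definition val :: "nat \<Rightarrow> 'p::prime_card mod_ring poly \<Rightarrow> nat" where
  "val m w = (if \<forall>i<m. Polynomial.coeff w i = 0 then m else LEAST i. Polynomial.coeff w i \<noteq> 0)"

lemma val_le: "val m w \<le> m"
proof (cases "\<forall>i<m. Polynomial.coeff w i = 0")
  case False
  then obtain i where i: "i < m" "Polynomial.coeff w i \<noteq> 0" by blast
  have "(LEAST i. Polynomial.coeff w i \<noteq> 0) \<le> i" by (rule Least_le[of "\<lambda>i. Polynomial.coeff w i \<noteq> 0", OF i(2)])
  then show ?thesis using i(1) False by (simp add: val_def)
qed (simp add: val_def)

lemma coeff_below_val: "i < val m w \<Longrightarrow> Polynomial.coeff w i = 0"
  by (auto simp: val_def dest: not_less_Least split: if_splits)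

lemma coeff_val:
  assumes "val m w < m" shows "Polynomial.coeff w (val m w) \<noteq> 0"
proof -
  have "\<not> (\<forall>i<m. Polynomial.coeff w i = 0)"
  proof
    assume "\<forall>i<m. Polynomial.coeff w i = 0"
    then have "val m w = m" by (simp add: val_def)
    with assms show False by simp
  qed
  then show ?thesis using LeastI_ex[of "\<lambda>i. Polynomial.coeff w i \<noteq> 0"] by (auto simp: val_def)
qed

lemma coeff_mult_lowest:
  assumes "\<And>i. i < a \<Longrightarrow> Polynomial.coeff p i = 0" "\<And>i. i < c \<Longrightarrow> Polynomial.coeff q i = 0"
  shows "Polynomial.coeff (p * q) (a + c) = Polynomial.coeff p a * Polynomial.coeff (q :: 'a::comm_ring_1 poly) c"
proof -
  have "Polynomial.coeff (p * q) (a + c) = (\<Sum>i\<le>a + c. Polynomial.coeff p i * Polynomial.coeff q (a + c - i))"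
    by (rule coeff_mult)
  also have "\<dots> = (\<Sum>i\<in>{a}. Polynomial.coeff p i * Polynomial.coeff q (a + c - i))"
  proof (rule sum.mono_neutral_right)
    show "\<forall>i\<in>{..a + c} - {a}. Polynomial.coeff p i * Polynomial.coeff q (a + c - i) = 0"
    proof
      fix i assume "i \<in> {..a + c} - {a}"
      then have "i < a \<or> a + c - i < c" by auto
      then show "Polynomial.coeff p i * Polynomial.coeff q (a + c - i) = 0" using assms by auto
    qed
  qed auto
  finally show ?thesis by simp
qed

lemma coeff_tr_eq_0_iff:
  assumes "i < m"
  shows "Polynomial.coeff (tr m k :: 'p::prime_card mod_ring poly) i = 0 \<longleftrightarrow> nat_digit CARD('p) k i = 0"
proof
  assume "Polynomial.coeff (tr m k :: 'p mod_ring poly) i = 0"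
  then have "of_int (int (nat_digit CARD('p) k i)) = (0 :: 'p mod_ring)"
    using assms by (simp add: coeff_tr)
  then have "to_int_mod_ring (of_int (int (nat_digit CARD('p) k i)) :: 'p mod_ring) = to_int_mod_ring (of_int 0 :: 'p mod_ring)"
    by simp
  then show "nat_digit CARD('p) k i = 0" unfolding to_int_of_int nat_digit_def by (simp flip: zmod_int)
qed (simp add: coeff_tr)

lemma solutions_empty:
  fixes w :: "'p::prime_card mod_ring poly"
  assumes m: "m > 0" and k: "\<not> CARD('p) ^ val m w dvd k"
  shows "solutions m w k = {}"
proof -
  let ?b = "CARD('p)"
  have b: "?b > 0" using card_p_ge2[where 'p = 'p] by simp
  have "\<exists>i<val m w. nat_digit ?b k i \<noteq> 0"
  proof (rule ccontr)
    assume a: "\<not> (\<exists>i<val m w. nat_digit ?b k i \<noteq> 0)"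
    have "k mod ?b ^ n = 0" if "n \<le> val m w" for n
      using that
    proof (induction n)
      case (Suc n)
      then show ?case using a unfolding power_Suc2 mod_mult2_eq by (simp add: nat_digit_def)
    qed simp
    from this[OF order_refl] have "?b ^ val m w dvd k" by (rule mod_0_imp_dvd)
    with k show False ..
  qed
  \<comment> \<open>At the lowest nonzero digit of \<open>k\<close>, which lies below the valuation
    of \<open>w\<close>, the sum has the coefficient of \<open>tr m k\<close> times the constant
    term of \<open>q\<close>. Both factors are nonzero, so no unit \<open>q\<close> solves the
    congruence.\<close>
  define a where "a = (LEAST i. nat_digit ?b k i \<noteq> 0)"
  obtain i where i: "i < val m w" "nat_digit ?b k i \<noteq> 0" using \<open>\<exists>i<val m w. nat_digit ?b k i \<noteq> 0\<close> by blast
  have a: "nat_digit ?b k a \<noteq> 0" "a < val m w"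
    using LeastI[of "\<lambda>i. nat_digit ?b k i \<noteq> 0" i] Least_le[of "\<lambda>i. nat_digit ?b k i \<noteq> 0" i] i
    unfolding a_def by auto
  have am: "a < m" using a(2) val_le[of m w] by simp
  have below: "Polynomial.coeff (tr m k :: 'p mod_ring poly) i = 0" if "i < a" for i
    using not_less_Least[of i "\<lambda>i. nat_digit ?b k i \<noteq> 0"] that am coeff_tr_eq_0_iff[of i m k, where 'p = 'p]
    unfolding a_def by simp
  have "Polynomial.coeff (tr m k * q + w) a \<noteq> 0" if q: "q \<in> G_N m" for q :: "'p mod_ring poly"
  proof -
    have "Polynomial.coeff (tr m k * q) (a + 0) = Polynomial.coeff (tr m k) a * Polynomial.coeff q 0"
      by (rule coeff_mult_lowest) (use below in auto)
    moreover have "Polynomial.coeff q 0 \<noteq> 0" using q by (simp add: G_N_iff[OF m])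
    moreover have "Polynomial.coeff (tr m k :: 'p mod_ring poly) a \<noteq> 0"
      using a(1) coeff_tr_eq_0_iff[OF am, of k, where 'p = 'p] by simp
    ultimately show ?thesis using coeff_below_val[OF a(2)] by simp
  qed
  then show ?thesis unfolding solutions_def using am by blast
qed

lemma card_solutions:
  fixes w :: "'p::prime_card mod_ring poly"
  assumes m: "m > 0" and v: "val m w < m" and k: "CARD('p) ^ val m w dvd k"
  shows "card (solutions m w k) \<le> CARD('p) ^ val m w"
proof (cases "solutions m w k = {}")
  case False
  let ?b = "CARD('p)" and ?v = "val m w"
  let ?t = "tr m k :: 'p mod_ring poly"
  have below: "Polynomial.coeff ?t i = 0" if "i < ?v" for i
  proof -
    obtain l where l: "k = ?b ^ ?v * l" using k by (rule dvdE)
    have "k = ?b ^ i * (?b * (?b ^ (?v - Suc i) * l))"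
    proof -
      have "?b ^ ?v = ?b ^ i * (?b * ?b ^ (?v - Suc i))"
        unfolding power_Suc[symmetric] power_add[symmetric] using that by simp
      then show ?thesis using l by simp
    qed
    then have "nat_digit ?b k i = 0" by (simp add: nat_digit_def)
    then show ?thesis using coeff_tr_eq_0_iff[of i m k, where 'p = 'p] that v by simp
  qed
  \<comment> \<open>A single solution forces the coefficient of \<open>tr m k\<close> at the
    valuation of \<open>w\<close> to be nonzero, as it must cancel that of \<open>w\<close>.\<close>
  obtain q0 where q0: "q0 \<in> solutions m w k" using False by blast
  have "Polynomial.coeff (?t * q0) (?v + 0) = Polynomial.coeff ?t ?v * Polynomial.coeff q0 0"
    by (rule coeff_mult_lowest) (use below in auto)
  moreover have "Polynomial.coeff (?t * q0 + w) ?v = 0" using q0 v by (simp add: solutions_def)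
  ultimately have tv: "Polynomial.coeff ?t ?v \<noteq> 0" using coeff_val[OF v] by auto
  \<comment> \<open>The difference of two solutions is annihilated modulo x^m by
    \<open>tr m k\<close>, whose valuation is \<open>?v\<close>; its first \<open>m - ?v\<close>
    coefficients therefore vanish, and only the upper \<open>?v\<close> coefficients are
    free.\<close>
  let ?B = "{m - ?v..<m} \<rightarrow>\<^sub>E (UNIV :: 'p mod_ring set)"
  have "card (solutions m w k) \<le> card ?B"
  proof (rule card_inj_on_le)
    show "inj_on (\<lambda>q. \<lambda>i\<in>{m - ?v..<m}. Polynomial.coeff q i) (solutions m w k)"
    proof (rule inj_onI)
      fix x y assume x: "x \<in> solutions m w k" and y: "y \<in> solutions m w k"
        and e: "(\<lambda>i\<in>{m - ?v..<m}. Polynomial.coeff x i) = (\<lambda>i\<in>{m - ?v..<m}. Polynomial.coeff y i)"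
      let ?d = "x - y"
      have td: "Polynomial.coeff (?t * ?d) i = 0" if "i < m" for i
      proof -
        have "Polynomial.coeff (?t * x + w) i = 0" "Polynomial.coeff (?t * y + w) i = 0"
          using x y that by (simp_all add: solutions_def)
        then have "Polynomial.coeff ((?t * x + w) - (?t * y + w)) i = 0" unfolding coeff_diff by simp
        then show ?thesis by (simp add: right_diff_distrib)
      qed
      have low: "Polynomial.coeff ?d i = 0" if "i < m - ?v" for i
        using that
      proof (induction i rule: less_induct)
        case (less i)
        have "Polynomial.coeff (?t * ?d) (?v + i) = Polynomial.coeff ?t ?v * Polynomial.coeff ?d i"
          by (rule coeff_mult_lowest) (use below less in auto)
        moreover have "Polynomial.coeff (?t * ?d) (?v + i) = 0" using td less.prems by simp
        ultimately show ?case using tv by simp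
      qed
      show "x = y"
      proof (rule poly_eqI)
        fix i
        consider "i < m - ?v" | "i \<in> {m - ?v..<m}" | "i \<ge> m" by fastforce
        then show "Polynomial.coeff x i = Polynomial.coeff y i"
        proof cases
          case 1 then show ?thesis using low[of i] by simp
        next
          case 2 then show ?thesis using fun_cong[OF e, of i] by simp
        next
          case 3
          have "x \<in> low_polys m" "y \<in> low_polys m" using x y by (simp_all add: solutions_def G_N_iff[OF m])
          then show ?thesis using 3 by (simp add: coeff_low_poly)
        qed
      qed
    qed
    show "(\<lambda>q. \<lambda>i\<in>{m - ?v..<m}. Polynomial.coeff q i) ` solutions m w k \<subseteq> ?B" by auto
    show "finite ?B" by (rule finite_PiE) auto
  qed
  also have "card ?B = ?b ^ ?v" using v by (simp add: card_PiE)
  finally show ?thesis .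
qed simp

text \<open>Below valuation \<open>m\<close> the count \<open>CARD('p) ^ val m w\<close> is rescaled
  with \<open>card_G_N\<close>. At valuation \<open>m\<close> the right-hand side is twice the
  number of units, so the trivial bound suffices.\<close>

lemma card_solutions_le:
  fixes w :: "'p::prime_card mod_ring poly"
  assumes m: "m > 0"
  shows "real (card (solutions m w k))
    \<le> (if CARD('p) ^ val m w dvd k
       then 2 * real (card (G_N m :: 'p mod_ring poly set)) * real CARD('p) ^ val m w / real CARD('p) ^ m else 0)"
proof -
  let ?b = "CARD('p)" and ?v = "val m w" and ?g = "real (card (G_N m :: 'p mod_ring poly set))"
  have b: "real ?b ^ m > 0" using card_p_ge2[where 'p = 'p] by simp
  have G: "real ?b ^ m \<le> 2 * ?g"
    using card_G_N[OF m, where 'p = 'p] by (metis of_nat_le_iff of_nat_mult of_nat_numeral of_nat_power)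
  have "real (card (solutions m w k)) \<le> 2 * ?g * real ?b ^ ?v / real ?b ^ m" if k: "?b ^ ?v dvd k"
  proof (cases "?v < m")
    case True
    have "real (card (solutions m w k)) \<le> real ?b ^ ?v"
      using card_solutions[OF m True k] by (metis of_nat_le_iff of_nat_power)
    also have "\<dots> = real ?b ^ m * real ?b ^ ?v / real ?b ^ m" using b by simp
    also have "\<dots> \<le> 2 * ?g * real ?b ^ ?v / real ?b ^ m"
      by (intro divide_right_mono mult_right_mono G) auto
    finally show ?thesis .
  next
    case False
    then have v: "?v = m" using val_le[of m w] by simp
    have "card (solutions m w k) \<le> card (G_N m :: 'p mod_ring poly set)"
      by (rule card_mono[OF finite_G_N[OF m]]) (auto simp: solutions_def)
    moreover have "2 * ?g * real ?b ^ ?v / real ?b ^ m = 2 * ?g" using b v by simp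
    ultimately show ?thesis by simp
  qed
  then show ?thesis using solutions_empty[OF m, of w k] by simp
qed

section \<open>Weighted counts of solutions\<close>

lemma psi_power_mult:
  assumes "b \<ge> 2" "k \<ge> 1"
  shows "psi b (b ^ v * k) = v + psi b k"
proof (rule psi_eqI[OF assms(1)])
  show "b ^ (v + psi b k) \<le> b ^ v * k" "b ^ v * k < b ^ (v + psi b k + 1)"
    using psi_bounds[OF assms] assms(1) by (simp_all add: power_add)
qed

text \<open>Multiplication by \<open>b ^ v\<close> raises \<open>psi\<close> by \<open>v\<close>, so
  the multiples carry the total weight scaled by the power of \<open>b\<close> with exponent
  \<open>- \<beta> * v\<close>.\<close>

lemma r_wal_multiples_has_sum:
  assumes b: "b \<ge> 2" and \<beta>: "\<beta> > 1"
  shows "((\<lambda>k. if b ^ v dvd k then r_wal b \<beta> k else 0) has_sum real b powr (- \<beta> * real v) * mu b \<beta>) {1..}"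
proof -
  have "((\<lambda>k. real b powr (- \<beta> * real v) * r_wal b \<beta> k) has_sum real b powr (- \<beta> * real v) * mu b \<beta>) {1..}"
    unfolding mu_def by (intro has_sum_cmult_right has_sum_infsum r_wal_summable b \<beta>)
  also have "?this \<longleftrightarrow> ((r_wal b \<beta> \<circ> (\<lambda>k. b ^ v * k)) has_sum real b powr (- \<beta> * real v) * mu b \<beta>) {1..}"
  proof (rule has_sum_cong)
    fix k :: nat assume "k \<in> {1..}"
    then have "psi b (b ^ v * k) = v + psi b k" using psi_power_mult[OF b] by simp
    then show "real b powr (- \<beta> * real v) * r_wal b \<beta> k = (r_wal b \<beta> \<circ> (\<lambda>k. b ^ v * k)) k"
      by (simp add: r_wal_def powr_add[symmetric] algebra_simps)
  qed
  also have "\<dots> \<longleftrightarrow> (r_wal b \<beta> has_sum real b powr (- \<beta> * real v) * mu b \<beta>) ((\<lambda>k. b ^ v * k) ` {1..})"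
    by (rule has_sum_reindex[symmetric]) (use b in \<open>auto simp: inj_on_def\<close>)
  also have "\<dots> \<longleftrightarrow> ?thesis"
  proof (rule has_sum_cong_neutral)
    fix k assume "k \<in> {1..} - (\<lambda>k. b ^ v * k) ` {1..}"
    then have k: "k \<ge> 1" "\<And>l. l \<ge> 1 \<Longrightarrow> k \<noteq> b ^ v * l" by auto
    have "\<not> b ^ v dvd k"
    proof
      assume "b ^ v dvd k"
      then obtain l where l: "k = b ^ v * l" by (rule dvdE)
      then show False using k(1) k(2)[of l] by (cases l) auto
    qed
    then show "(if b ^ v dvd k then r_wal b \<beta> k else 0) = 0" by simp
  next
    fix k assume "k \<in> (\<lambda>k. b ^ v * k) ` {1..} - {1..}"
    then show "r_wal b \<beta> k = 0" using b by auto
  qed auto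
  finally show ?thesis .
qed

text \<open>The count grows with the valuation \<open>v\<close> of \<open>w\<close> like the power
  of the base with exponent \<open>v\<close>, while the admissible frequencies lose a factor with
  exponent \<open>- \<beta> * v\<close>. As \<open>\<beta> > 1\<close>, the product is at most its
  value at \<open>v = 0\<close>, uniformly in \<open>w\<close>.\<close>

lemma solutions_weighted_sum:
  fixes w :: "'p::prime_card mod_ring poly"
  assumes m: "m > 0" and \<beta>: "\<beta> > 1"
  shows "(\<Sum>\<^sub>\<infinity>k\<in>{1..}. r_wal CARD('p) \<beta> k * real (card (solutions m w k)))
    \<le> real (card (G_N m :: 'p mod_ring poly set)) * (2 * mu CARD('p) \<beta> / real CARD('p) ^ m)"
proof -
  let ?b = "CARD('p)" and ?v = "val m w" and ?g = "real (card (G_N m :: 'p mod_ring poly set))"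
  have b: "?b \<ge> 2" by (rule card_p_ge2)
  define C where "C = 2 * ?g * real ?b ^ ?v / real ?b ^ m"
  have C: "C \<ge> 0" by (simp add: C_def)
  have hs: "((\<lambda>k. (if ?b ^ ?v dvd k then r_wal ?b \<beta> k else 0) * C) has_sum
      real ?b powr (- \<beta> * real ?v) * mu ?b \<beta> * C) {1..}"
    by (rule has_sum_cmult_left[OF r_wal_multiples_has_sum[OF b \<beta>]])
  have le: "r_wal ?b \<beta> k * real (card (solutions m w k)) \<le> (if ?b ^ ?v dvd k then r_wal ?b \<beta> k else 0) * C" for k
    using mult_left_mono[OF card_solutions_le[OF m, of w k] r_wal_nonneg[of ?b \<beta> k]]
    by (simp add: C_def split: if_splits)
  have "(\<Sum>\<^sub>\<infinity>k\<in>{1..}. r_wal ?b \<beta> k * real (card (solutions m w k))) \<le> real ?b powr (- \<beta> * real ?v) * mu ?b \<beta> * C"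
    unfolding infsumI[OF hs, symmetric]
  proof (rule infsum_mono[OF _ has_sum_imp_summable[OF hs] le])
    show "(\<lambda>k. r_wal ?b \<beta> k * real (card (solutions m w k))) summable_on {1..}"
      by (rule summable_on_comparison_test[OF has_sum_imp_summable[OF hs] le]) simp
  qed
  also have "\<dots> = (real ?b powr (- \<beta> * real ?v) * real ?b powr real ?v) * (?g * (2 * mu ?b \<beta> / real ?b ^ m))"
    using b by (simp add: C_def powr_realpow)
  also have "\<dots> \<le> 1 * (?g * (2 * mu ?b \<beta> / real ?b ^ m))"
  proof (rule mult_right_mono)
    have "real ?b powr (- \<beta> * real ?v) * real ?b powr real ?v = real ?b powr ((1 - \<beta>) * real ?v)"
      by (simp add: powr_add[symmetric] algebra_simps)
    also have "\<dots> \<le> real ?b powr 0" using b \<beta> by (intro powr_mono) (auto simp: mult_nonpos_nonneg)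
    finally show "real ?b powr (- \<beta> * real ?v) * real ?b powr real ?v \<le> 1" using b by simp
    show "0 \<le> ?g * (2 * mu ?b \<beta> / real ?b ^ m)" by (simp add: mu_nonneg)
  qed
  finally show ?thesis by simp
qed

text \<open>The coordinate \<open>d\<close> is summed first, with a bound uniform in the other
  coordinates, which then contribute one factor \<open>infsum f A\<close> each. Boundedness of
  \<open>N\<close> secures the summability behind this exchange.\<close>

lemma infsum_PiE_split_le:
  fixes f :: "nat \<Rightarrow> real" and N :: "(nat \<Rightarrow> nat) \<Rightarrow> real"
  assumes u: "finite u" "d \<in> u" and f: "f summable_on A" "\<And>k. f k \<ge> 0"
    and N: "\<And>h. 0 \<le> N h" "\<And>h. N h \<le> B"
    and C: "\<And>h. (\<Sum>\<^sub>\<infinity>k\<in>A. f k * N (h(d := k))) \<le> C"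
  shows "(\<Sum>\<^sub>\<infinity>h\<in>u \<rightarrow>\<^sub>E A. (\<Prod>j\<in>u. f (h j)) * N h) \<le> C * infsum f A ^ (card u - 1)"
proof -
  define v where "v = u - {d}"
  have v: "finite v" "d \<notin> v" "insert d v = u" using u by (auto simp: v_def)
  let ?e = "\<lambda>(h, k). h(d := k)" and ?A = "\<lambda>_. A"
  let ?F = "\<lambda>h. (\<Prod>j\<in>u. f (h j)) * N h"
  have inj: "inj_on ?e ((v \<rightarrow>\<^sub>E A) \<times> A)" using inj_combinator'[OF v(2), of ?A] .
  have img: "u \<rightarrow>\<^sub>E A = ?e ` ((v \<rightarrow>\<^sub>E A) \<times> A)"
    unfolding v(3)[symmetric] PiE_insert_eq by (subst swap_product [symmetric]) (simp add: image_image case_prod_unfold)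
  have sF: "?F summable_on (u \<rightarrow>\<^sub>E A)"
    by (rule summable_on_comparison_test[OF summable_on_cmult_left[OF summable_on_prod_PiE[OF u(1) f], of B]])
      (simp_all add: mult_left_mono N f prod_nonneg)
  have Fe: "?F (?e (h, k)) = (\<Prod>j\<in>v. f (h j)) * (f k * N (h(d := k)))" for h k
  proof -
    have "(\<Prod>j\<in>u. f ((h(d := k)) j)) = f k * (\<Prod>j\<in>v. f ((h(d := k)) j))"
      unfolding v(3)[symmetric] using v(1,2) by simp
    also have "(\<Prod>j\<in>v. f ((h(d := k)) j)) = (\<Prod>j\<in>v. f (h j))"
      by (rule prod.cong) (use v(2) in auto)
    finally show ?thesis by simp
  qed
  have s2: "(?F \<circ> ?e) summable_on ((v \<rightarrow>\<^sub>E A) \<times> A)"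
    using sF unfolding img by (subst (asm) summable_on_reindex[OF inj])
  have inner: "(\<Sum>\<^sub>\<infinity>k\<in>A. (?F \<circ> ?e) (h, k)) = (\<Prod>j\<in>v. f (h j)) * (\<Sum>\<^sub>\<infinity>k\<in>A. f k * N (h(d := k)))" for h
    unfolding comp_def Fe by (rule infsum_cmult_right')
  have "infsum ?F (u \<rightarrow>\<^sub>E A) = infsum (?F \<circ> ?e) ((v \<rightarrow>\<^sub>E A) \<times> A)"
    unfolding img by (rule infsum_reindex[OF inj])
  also have "\<dots> = (\<Sum>\<^sub>\<infinity>h\<in>v \<rightarrow>\<^sub>E A. (\<Prod>j\<in>v. f (h j)) * (\<Sum>\<^sub>\<infinity>k\<in>A. f k * N (h(d := k))))"
    using infsum_Sigma_banach[OF s2] by (simp only: inner)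
  also have "\<dots> \<le> (\<Sum>\<^sub>\<infinity>h\<in>v \<rightarrow>\<^sub>E A. (\<Prod>j\<in>v. f (h j)) * C)"
  proof (rule infsum_mono)
    show "(\<lambda>h. (\<Prod>j\<in>v. f (h j)) * (\<Sum>\<^sub>\<infinity>k\<in>A. f k * N (h(d := k)))) summable_on v \<rightarrow>\<^sub>E A"
      using summable_on_Sigma_banach[of "\<lambda>h k. (?F \<circ> ?e) (h, k)" "v \<rightarrow>\<^sub>E A" ?A] s2 by (simp only: inner case_prod_eta)
    show "(\<lambda>h. (\<Prod>j\<in>v. f (h j)) * C) summable_on v \<rightarrow>\<^sub>E A"
      by (rule summable_on_cmult_left[OF summable_on_prod_PiE[OF v(1) f]])
  qed (simp add: mult_left_mono C prod_nonneg f)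
  also have "\<dots> = (\<Prod>j\<in>v. infsum f A) * C"
    using infsum_prod_PiE[of v "\<lambda>_. f" ?A, OF v(1) f(1) summable_on_prod_PiE[OF v(1) f]] infsum_cmult_left'
    by (simp add: infsum_cmult_left')
  also have "\<dots> = C * infsum f A ^ (card u - 1)"
    using u by (simp add: v_def card_Diff_singleton)
  finally show ?thesis .
qed

lemma dual_fun_upd:
  fixes G :: "nat \<Rightarrow> 'p::prime_card mod_ring poly"
  assumes u: "finite u" "d \<in> u"
  shows "dual m (G(d := q)) (u, h(d := k))
    \<longleftrightarrow> (\<forall>i<m. Polynomial.coeff (tr m k * q + (\<Sum>j\<in>u - {d}. tr m (h j) * G j)) i = 0)"
proof -
  have "(\<Sum>j\<in>u. tr m ((h(d := k)) j) * (G(d := q)) j)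
    = tr m k * q + (\<Sum>j\<in>u - {d}. tr m ((h(d := k)) j) * (G(d := q)) j)"
    using sum.remove[OF u, of "\<lambda>j. tr m ((h(d := k)) j) * (G(d := q)) j"] by simp
  also have "(\<Sum>j\<in>u - {d}. tr m ((h(d := k)) j) * (G(d := q)) j) = (\<Sum>j\<in>u - {d}. tr m (h j) * G j)"
    by (rule sum.cong) auto
  finally show ?thesis by (simp add: dual_def)
qed

text \<open>With the other frequencies fixed, varying the frequency and the generator at
  \<open>d\<close> leaves one congruence whose constant part \<open>w\<close> comes from the set
  \<open>u - {d}\<close>.\<close>

lemma average_bound_single:
  fixes G :: "nat \<Rightarrow> 'p::prime_card mod_ring poly"
  assumes m: "m > 0" and \<beta>: "\<beta> > 1" and u: "finite u" "d \<in> u"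
  shows "(\<Sum>\<^sub>\<infinity>h\<in>u \<rightarrow>\<^sub>E {1..}. (\<Prod>j\<in>u. r_wal CARD('p) \<beta> (h j)) * real (card {q \<in> G_N m. dual m (G(d := q)) (u, h)}))
    \<le> real (card (G_N m :: 'p mod_ring poly set)) * (2 * mu CARD('p) \<beta> ^ card u / real CARD('p) ^ m)"
proof -
  let ?b = "CARD('p)" and ?g = "real (card (G_N m :: 'p mod_ring poly set))"
  let ?N = "\<lambda>h. real (card {q \<in> G_N m. dual m (G(d := q)) (u, h)})"
  have b: "?b \<ge> 2" by (rule card_p_ge2)
  have NB: "?N h \<le> ?g" for h using card_mono[OF finite_G_N[OF m], of "{q \<in> G_N m. dual m (G(d := q)) (u, h)}"] by auto
  have "(\<Sum>\<^sub>\<infinity>k\<in>{1..}. r_wal ?b \<beta> k * ?N (h(d := k))) \<le> ?g * (2 * mu ?b \<beta> / real ?b ^ m)" for h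
    using solutions_weighted_sum[OF m \<beta>, of "\<Sum>j\<in>u - {d}. tr m (h j) * G j"]
    by (simp only: solutions_def dual_fun_upd[OF u])
  from infsum_PiE_split_le[where N = ?N, OF u r_wal_summable[OF b \<beta>] r_wal_nonneg of_nat_0_le_iff NB this]
  have "(\<Sum>\<^sub>\<infinity>h\<in>u \<rightarrow>\<^sub>E {1..}. (\<Prod>j\<in>u. r_wal ?b \<beta> (h j)) * ?N h) \<le> ?g * (2 * mu ?b \<beta> / real ?b ^ m) * mu ?b \<beta> ^ (card u - 1)"
    by (simp only: mu_def)
  also have "\<dots> = ?g * (2 * (mu ?b \<beta> * mu ?b \<beta> ^ (card u - 1)) / real ?b ^ m)" by simp
  also have "mu ?b \<beta> * mu ?b \<beta> ^ (card u - 1) = mu ?b \<beta> ^ card u"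
    using u by (metis card_gt_0_iff empty_iff power_Suc Suc_pred')
  finally show ?thesis .
qed

section \<open>The successive coordinate search\<close>

text \<open>After division by \<open>x + y\<close> both parts lie in the unit interval, where a
  number is at most its power with exponent \<open>\<theta> \<le> 1\<close>.\<close>

lemma powr_add_le_add_powr:
  fixes x y :: real
  assumes "x \<ge> 0" "y \<ge> 0" "0 < \<theta>" "\<theta> \<le> 1"
  shows "(x + y) powr \<theta> \<le> x powr \<theta> + y powr \<theta>"
proof (cases "x + y = 0")
  case True
  then show ?thesis using assms by simp
next
  case False
  define s where "s = x + y"
  have s: "s > 0" using assms False by (simp add: s_def)
  have *: "z / s \<le> (z / s) powr \<theta>" if "0 \<le> z" "z \<le> s" for z
    using powr_mono'[of \<theta> 1 "z / s"] assms that s by simp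
  have "1 = x / s + y / s" using s by (simp add: s_def add_divide_distrib[symmetric])
  also have "\<dots> \<le> (x / s) powr \<theta> + (y / s) powr \<theta>"
    using assms by (intro add_mono *) (auto simp: s_def)
  also have "\<dots> = (x powr \<theta> + y powr \<theta>) / s powr \<theta>"
    using assms s by (simp add: powr_divide add_divide_distrib)
  finally have "s powr \<theta> \<le> x powr \<theta> + y powr \<theta>" using s by (simp add: field_simps)
  then show ?thesis by (simp add: s_def)
qed

lemma powr_sum_le_sum_powr:
  fixes f :: "'i \<Rightarrow> real"
  assumes "\<And>i. i \<in> A \<Longrightarrow> f i \<ge> 0" "0 < \<theta>" "\<theta> \<le> 1"
  shows "(\<Sum>i\<in>A. f i) powr \<theta> \<le> (\<Sum>i\<in>A. f i powr \<theta>)"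
  using assms
proof (induction A rule: infinite_finite_induct)
  case (insert i A)
  have "(f i + (\<Sum>i\<in>A. f i)) powr \<theta> \<le> f i powr \<theta> + (\<Sum>i\<in>A. f i) powr \<theta>"
    by (rule powr_add_le_add_powr) (use insert.prems in \<open>auto intro: sum_nonneg\<close>)
  also have "\<dots> \<le> f i powr \<theta> + (\<Sum>i\<in>A. f i powr \<theta>)" using insert by simp
  finally show ?case using insert.hyps by simp
qed auto

text \<open>Jensen's inequality for series. Each finite sum is bounded by
  \<open>?S powr (1 / \<theta>)\<close>, the series inherits this bound, and the power is taken at
  the end.\<close>

lemma powr_infsum_le_infsum_powr:
  fixes f :: "'i \<Rightarrow> real"
  assumes f: "\<And>i. i \<in> A \<Longrightarrow> f i \<ge> 0" and \<theta>: "0 < \<theta>" "\<theta> \<le> 1"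
    and s: "f summable_on A" and sp: "(\<lambda>i. f i powr \<theta>) summable_on A"
  shows "(\<Sum>\<^sub>\<infinity>i\<in>A. f i) powr \<theta> \<le> (\<Sum>\<^sub>\<infinity>i\<in>A. f i powr \<theta>)"
proof -
  let ?S = "\<Sum>\<^sub>\<infinity>i\<in>A. f i powr \<theta>"
  have S: "?S \<ge> 0" by (rule infsum_nonneg) simp
  have "(\<Sum>\<^sub>\<infinity>i\<in>A. f i) \<le> ?S powr (1 / \<theta>)"
  proof (rule infsum_le_finite_sums[OF s])
    fix F assume F: "finite F" "F \<subseteq> A"
    have "(\<Sum>i\<in>F. f i) powr \<theta> \<le> (\<Sum>i\<in>F. f i powr \<theta>)"
      by (rule powr_sum_le_sum_powr) (use f F \<theta> in auto)
    also have "\<dots> \<le> ?S" by (rule finite_sum_le_infsum[OF sp F]) simp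
    finally have "((\<Sum>i\<in>F. f i) powr \<theta>) powr (1 / \<theta>) \<le> ?S powr (1 / \<theta>)"
      using \<theta> by (intro powr_mono2) auto
    moreover have "(\<Sum>i\<in>F. f i) \<ge> 0" using F f by (intro sum_nonneg) auto
    ultimately show "(\<Sum>i\<in>F. f i) \<le> ?S powr (1 / \<theta>)" using \<theta> by (simp add: powr_powr)
  qed
  then have "(\<Sum>\<^sub>\<infinity>i\<in>A. f i) powr \<theta> \<le> (?S powr (1 / \<theta>)) powr \<theta>"
    using \<theta> f by (intro powr_mono2 infsum_nonneg) auto
  then show ?thesis using \<theta> S by (simp add: powr_powr)
qed

section \<open>Parts of the squared error and their averages\<close>

text \<open>For \<open>\<beta> = \<alpha>\<close>, \<open>c = \<gamma>\<close> and all nonempty sets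
  this is the squared worst-case error. Restricting \<open>U\<close> isolates the part that one step
  of the search controls.\<close>

definition dual_sum ::
  "real \<Rightarrow> (nat set \<Rightarrow> real) \<Rightarrow> nat \<Rightarrow> nat set set \<Rightarrow> (nat \<Rightarrow> 'p::prime_card mod_ring poly) \<Rightarrow> real" where
  "dual_sum \<beta> c m U g = (\<Sum>\<^sub>\<infinity>i\<in>freqs U. wt CARD('p) \<beta> c i * of_bool (dual m g i))"

lemma wt_nonneg: "(\<And>u. u \<in> U \<Longrightarrow> c u \<ge> 0) \<Longrightarrow> i \<in> freqs U \<Longrightarrow> wt b \<beta> c i \<ge> 0"
  by (cases i) (simp add: wt_def prod_nonneg)

lemma dual_sum_nonneg: "(\<And>u. u \<in> U \<Longrightarrow> c u \<ge> 0) \<Longrightarrow> dual_sum \<beta> c m U g \<ge> 0"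
  unfolding dual_sum_def by (intro infsum_nonneg mult_nonneg_nonneg wt_nonneg) auto

lemma wt_bounded_summable:
  assumes "b \<ge> 2" "\<beta> > 1" "finite U" "\<And>u. u \<in> U \<Longrightarrow> finite u" "\<And>u. u \<in> U \<Longrightarrow> c u \<ge> 0"
    and x: "\<And>i. 0 \<le> x i" "\<And>i. x i \<le> B"
  shows "(\<lambda>i. wt b \<beta> c i * x i) summable_on freqs U"
proof (rule summable_on_comparison_test)
  show "(\<lambda>i. wt b \<beta> c i * B) summable_on freqs U"
    by (rule summable_on_cmult_left[OF has_sum_imp_summable[OF wt_has_sum[OF assms(1-5)]]])
  fix i assume "i \<in> freqs U"
  then have w: "wt b \<beta> c i \<ge> 0" using wt_nonneg assms(5) by blast
  show "wt b \<beta> c i * x i \<le> wt b \<beta> c i * B" by (rule mult_left_mono[OF x(2) w])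
  show "0 \<le> wt b \<beta> c i * x i" by (rule mult_nonneg_nonneg[OF w x(1)])
qed

lemma dual_sum_summable:
  assumes "\<beta> > 1" "finite U" "\<And>u. u \<in> U \<Longrightarrow> finite u" "\<And>u. u \<in> U \<Longrightarrow> c u \<ge> 0"
  shows "(\<lambda>i. wt CARD('p::prime_card) \<beta> c i * of_bool (dual m (g :: nat \<Rightarrow> 'p mod_ring poly) i)) summable_on freqs U"
  by (rule wt_bounded_summable[where B = 1, OF card_p_ge2 assms]) simp_all

lemma dual_cong:
  assumes "\<And>j. j \<in> u \<Longrightarrow> g j = g' j"
  shows "dual m g (u, h) = dual m g' (u, h)"
proof -
  have "(\<Sum>j\<in>u. tr m (h j) * g j) = (\<Sum>j\<in>u. tr m (h j) * g' j)" by (rule sum.cong) (simp_all add: assms)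
  then show ?thesis by (simp add: dual_def)
qed

lemma dual_sum_cong:
  assumes "\<And>u j. u \<in> U \<Longrightarrow> j \<in> u \<Longrightarrow> g j = g' j"
  shows "dual_sum \<beta> c m U g = dual_sum \<beta> c m U g'"
  unfolding dual_sum_def
proof (rule infsum_cong)
  fix i assume "i \<in> freqs U"
  then obtain u h where "i = (u, h)" "u \<in> U" by (elim SigmaE)
  then show "wt CARD('a) \<beta> c i * of_bool (dual m g i) = wt CARD('a) \<beta> c i * of_bool (dual m g' i)"
    using dual_cong[of u g g' m h] assms by simp
qed

lemma dual_sum_UN:
  fixes g :: "nat \<Rightarrow> 'p::prime_card mod_ring poly"
  assumes "\<beta> > 1" "finite D" "\<And>d. d \<in> D \<Longrightarrow> finite (U d)"
    "\<And>d u. d \<in> D \<Longrightarrow> u \<in> U d \<Longrightarrow> finite u" "\<And>d u. d \<in> D \<Longrightarrow> u \<in> U d \<Longrightarrow> c u \<ge> 0"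
    "\<And>d e. d \<in> D \<Longrightarrow> e \<in> D \<Longrightarrow> d \<noteq> e \<Longrightarrow> U d \<inter> U e = {}"
  shows "dual_sum \<beta> c m (\<Union>d\<in>D. U d) g = (\<Sum>d\<in>D. dual_sum \<beta> c m (U d) g)"
proof -
  have "(\<Sum>d\<in>D. dual_sum \<beta> c m (U d) g)
    = (\<Sum>\<^sub>\<infinity>i\<in>(\<Union>d\<in>D. freqs (U d)). wt CARD('p) \<beta> c i * of_bool (dual m g i))"
    unfolding dual_sum_def
  proof (rule sum_infsum[OF assms(2)])
    show "(\<lambda>i. wt CARD('p) \<beta> c i * of_bool (dual m g i)) summable_on freqs (U d)" if "d \<in> D" for d
      by (rule dual_sum_summable) (use assms(1,3,4,5) that in auto)
    show "freqs (U d) \<inter> freqs (U e) = {}" if "d \<in> D" "e \<in> D" "d \<noteq> e" for d e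
      using assms(6)[OF that] by blast
  qed
  moreover have "(\<Union>d\<in>D. freqs (U d)) = freqs (\<Union>d\<in>D. U d)" by blast
  ultimately show ?thesis unfolding dual_sum_def by simp
qed

text \<open>By Jensen's inequality the power moves inside the sum, where it turns the exponent into
  \<open>\<alpha> * \<theta>\<close>, still above 1, and leaves the indicator of the dual lattice
  unchanged.\<close>

lemma dual_sum_powr_le:
  fixes g :: "nat \<Rightarrow> 'p::prime_card mod_ring poly"
  assumes \<alpha>: "\<alpha> > 1" and \<theta>: "1 / \<alpha> < \<theta>" "\<theta> \<le> 1" and U: "finite U" "\<And>u. u \<in> U \<Longrightarrow> finite u"
    and c: "\<And>u. u \<in> U \<Longrightarrow> c u \<ge> 0"
  shows "dual_sum \<alpha> c m U g powr \<theta> \<le> dual_sum (\<alpha> * \<theta>) (\<lambda>u. c u powr \<theta>) m U g"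
proof -
  have \<theta>0: "\<theta> > 0" using \<alpha> \<theta>(1) by (meson divide_pos_pos less_trans zero_less_one)
  have \<alpha>\<theta>: "\<alpha> * \<theta> > 1" using \<alpha> \<theta>(1) by (simp add: field_simps)
  have e: "(wt CARD('p) \<alpha> c i * of_bool (dual m g i)) powr \<theta>
      = wt CARD('p) (\<alpha> * \<theta>) (\<lambda>u. c u powr \<theta>) i * of_bool (dual m g i)" for i
    using \<theta>0 by (cases i) (simp add: wt_def powr_mult prod_powr_distrib r_wal_powr)
  show ?thesis
    unfolding dual_sum_def e[symmetric]
  proof (rule powr_infsum_le_infsum_powr[OF _ \<theta>0 \<theta>(2)])
    show "0 \<le> wt CARD('p) \<alpha> c i * of_bool (dual m g i)" if "i \<in> freqs U" for i
      using wt_nonneg[OF c that] by simp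
    show "(\<lambda>i. wt CARD('p) \<alpha> c i * of_bool (dual m g i)) summable_on freqs U"
      by (rule dual_sum_summable[OF \<alpha> U c])
    show "(\<lambda>i. (wt CARD('p) \<alpha> c i * of_bool (dual m g i)) powr \<theta>) summable_on freqs U"
      unfolding e by (rule dual_sum_summable[OF \<alpha>\<theta> U]) simp_all
  qed
qed

text \<open>Exchanging the sums over \<open>q\<close> and over the frequencies counts, for each
  frequency, the generators that put it into the dual lattice.\<close>

lemma average_bound:
  fixes G :: "nat \<Rightarrow> 'p::prime_card mod_ring poly"
  assumes m: "m > 0" and \<beta>: "\<beta> > 1" and U: "finite U" "\<And>u. u \<in> U \<Longrightarrow> finite u" "\<And>u. u \<in> U \<Longrightarrow> d \<in> u"
    and c: "\<And>u. u \<in> U \<Longrightarrow> c u \<ge> 0"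
  shows "(\<Sum>q\<in>G_N m. dual_sum \<beta> c m U (G(d := q)))
    \<le> real (card (G_N m :: 'p mod_ring poly set)) * (\<Sum>u\<in>U. c u * (2 * mu CARD('p) \<beta> ^ card u / real CARD('p) ^ m))"
proof -
  let ?b = "CARD('p)" and ?g = "real (card (G_N m :: 'p mod_ring poly set))"
  let ?N = "\<lambda>i. real (card {q \<in> G_N m. dual m (G(d := q)) i})"
  have b: "?b \<ge> 2" by (rule card_p_ge2)
  have NB: "?N i \<le> ?g" for i using card_mono[OF finite_G_N[OF m], of "{q \<in> G_N m. dual m (G(d := q)) i}"] by auto
  have sN: "(\<lambda>i. wt ?b \<beta> c i * ?N i) summable_on freqs U"
    by (rule wt_bounded_summable[where B = ?g, OF b \<beta> U(1,2) c _ NB]) simp_all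
  have "((\<lambda>i. \<Sum>q\<in>G_N m. wt ?b \<beta> c i * of_bool (dual m (G(d := q)) i)) has_sum
      (\<Sum>q\<in>G_N m. dual_sum \<beta> c m U (G(d := q)))) (freqs U)"
    unfolding dual_sum_def
    by (intro has_sum_sum finite_G_N m has_sum_infsum dual_sum_summable \<beta> U(1,2) c)
  moreover have "(\<Sum>q\<in>G_N m. wt ?b \<beta> c i * of_bool (dual m (G(d := q)) i)) = wt ?b \<beta> c i * ?N i" for i
    using finite_G_N[OF m, where 'p = 'p]
    by (simp add: sum_distrib_left[symmetric] of_bool_def sum.If_cases Int_def)
  ultimately have "(\<Sum>q\<in>G_N m. dual_sum \<beta> c m U (G(d := q))) = (\<Sum>\<^sub>\<infinity>i\<in>freqs U. wt ?b \<beta> c i * ?N i)"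
    by (simp add: infsumI)
  also have "\<dots> = (\<Sum>u\<in>U. \<Sum>\<^sub>\<infinity>h\<in>u \<rightarrow>\<^sub>E {1..}. wt ?b \<beta> c (u, h) * ?N (u, h))"
    using infsum_Sigma_banach[OF sN] U(1) by simp
  also have "\<dots> = (\<Sum>u\<in>U. c u * (\<Sum>\<^sub>\<infinity>h\<in>u \<rightarrow>\<^sub>E {1..}. (\<Prod>j\<in>u. r_wal ?b \<beta> (h j)) * ?N (u, h)))"
    unfolding wt_def prod.case mult.assoc infsum_cmult_right' ..
  also have "\<dots> \<le> (\<Sum>u\<in>U. c u * (?g * (2 * mu ?b \<beta> ^ card u / real ?b ^ m)))"
    by (intro sum_mono mult_left_mono average_bound_single[OF m \<beta>] U c)
  also have "\<dots> = ?g * (\<Sum>u\<in>U. c u * (2 * mu ?b \<beta> ^ card u / real ?b ^ m))"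
    by (simp add: sum_distrib_left mult_ac)
  finally show ?thesis .
qed

text \<open>A minimum is at most a mean, applied after raising to the power \<open>\<theta>\<close>.
  Minimality refers to the sum with exponent \<open>\<alpha>\<close> and does not involve
  \<open>\<theta>\<close>, so one choice of generator serves all \<open>\<theta>\<close>.\<close>

lemma minimizer_bound:
  fixes G :: "nat \<Rightarrow> 'p::prime_card mod_ring poly"
  assumes \<alpha>: "\<alpha> > 1" and \<theta>: "1 / \<alpha> < \<theta>" "\<theta> \<le> 1" and m: "m > 0"
    and U: "finite U" "\<And>u. u \<in> U \<Longrightarrow> finite u" "\<And>u. u \<in> U \<Longrightarrow> d \<in> u"
    and c: "\<And>u. u \<in> U \<Longrightarrow> c u \<ge> 0"
    and min: "\<And>q. q \<in> G_N m \<Longrightarrow> dual_sum \<alpha> c m U (G(d := q0)) \<le> dual_sum \<alpha> c m U (G(d := q))"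
  shows "dual_sum \<alpha> c m U (G(d := q0)) powr \<theta>
    \<le> (\<Sum>u\<in>U. c u powr \<theta> * (2 * mu CARD('p) (\<alpha> * \<theta>) ^ card u / real CARD('p) ^ m))"
proof -
  let ?g = "real (card (G_N m :: 'p mod_ring poly set))"
  have \<theta>0: "\<theta> > 0" using \<alpha> \<theta>(1) by (meson divide_pos_pos less_trans zero_less_one)
  have \<alpha>\<theta>: "\<alpha> * \<theta> > 1" using \<alpha> \<theta>(1) by (simp add: field_simps)
  have "?g * dual_sum \<alpha> c m U (G(d := q0)) powr \<theta> = (\<Sum>q\<in>(G_N m :: 'p mod_ring poly set). dual_sum \<alpha> c m U (G(d := q0)) powr \<theta>)"
    by simp
  also have "\<dots> \<le> (\<Sum>q\<in>(G_N m :: 'p mod_ring poly set). dual_sum (\<alpha> * \<theta>) (\<lambda>u. c u powr \<theta>) m U (G(d := q)))"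
  proof (rule sum_mono)
    fix q :: "'p mod_ring poly" assume q: "q \<in> G_N m"
    have "dual_sum \<alpha> c m U (G(d := q0)) powr \<theta> \<le> dual_sum \<alpha> c m U (G(d := q)) powr \<theta>"
      using \<theta>0 by (intro powr_mono2 min q dual_sum_nonneg c) auto
    also have "\<dots> \<le> dual_sum (\<alpha> * \<theta>) (\<lambda>u. c u powr \<theta>) m U (G(d := q))"
      by (rule dual_sum_powr_le[OF \<alpha> \<theta> U(1,2) c])
    finally show "dual_sum \<alpha> c m U (G(d := q0)) powr \<theta> \<le> dual_sum (\<alpha> * \<theta>) (\<lambda>u. c u powr \<theta>) m U (G(d := q))" .
  qed
  also have "\<dots> \<le> ?g * (\<Sum>u\<in>U. c u powr \<theta> * (2 * mu CARD('p) (\<alpha> * \<theta>) ^ card u / real CARD('p) ^ m))"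
    by (rule average_bound[OF m \<alpha>\<theta> U]) simp_all
  finally show ?thesis
  proof (rule mult_left_le_imp_le)
    have "0 < card (G_N m :: 'p mod_ring poly set)"
    proof (rule ccontr)
      assume "\<not> 0 < card (G_N m :: 'p mod_ring poly set)"
      then show False using card_G_N[OF m, where 'p = 'p] card_p_ge2[where 'p = 'p] by simp
    qed
    then show "0 < ?g" by simp
  qed
qed

section \<open>Analysis of the search\<close>

text \<open>The condition at \<open>d\<close> depends on \<open>g\<close> only below
  \<open>d\<close>, so minimizers can be chosen recursively; they exist because the set of units is
  finite and contains 1.\<close>

lemma scs_exists:
  fixes g0 :: "nat \<Rightarrow> 'p::prime_card mod_ring poly"
  assumes m: "m > 0"
  shows "\<exists>g. scs_output \<alpha> \<gamma> m s g0 g"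
proof -
  let ?P = "\<lambda>f d r. is_arg_min (\<lambda>q. (worst_case_error \<alpha> \<gamma> m s
      (\<lambda>j. if j < d then f j else if j = d then q else g0 j))\<^sup>2) (\<lambda>q. q \<in> G_N m) r"
  have "\<exists>g. \<forall>d. ?P g d (g d)"
  proof (rule dependent_wellorder_choice)
    fix r :: "'p mod_ring poly" and f g :: "nat \<Rightarrow> 'p mod_ring poly" and d :: nat
    assume "\<And>j. j < d \<Longrightarrow> f j = g j"
    then have "(\<lambda>j. if j < d then f j else if j = d then q else g0 j) = (\<lambda>j. if j < d then g j else if j = d then q else g0 j)"
      for q by (simp add: fun_eq_iff)
    then show "?P f d r = ?P g d r" by simp
  next
    fix d :: nat and f :: "nat \<Rightarrow> 'p mod_ring poly"
    have "(1 :: 'p mod_ring poly) \<in> G_N m" using m by (simp add: G_N_def)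
    then show "\<exists>r. ?P f d r" by (intro ex_is_arg_min_if_finite finite_G_N m) auto
  qed
  then show ?thesis unfolding scs_output_def by blast
qed

text \<open>Sets without \<open>d\<close> contribute the same amount for every candidate, so a
  minimizer of the whole error also minimizes the part over sets containing
  \<open>d\<close>.\<close>

lemma scs_partial_minimizer:
  fixes g0 g :: "nat \<Rightarrow> 'p::prime_card mod_ring poly"
  assumes \<alpha>: "\<alpha> > 1" and \<gamma>: "\<And>u. finite u \<Longrightarrow> u \<subseteq> {1..} \<Longrightarrow> \<gamma> u > 0" and \<gamma>1: "\<gamma> {} = 1"
    and m: "m > 0" and scs: "scs_output \<alpha> \<gamma> m s g0 g" and d: "d \<in> {1..s}" and q: "q \<in> G_N m"
  defines "G \<equiv> \<lambda>j. if j < d then g j else g0 j"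
  shows "dual_sum \<alpha> \<gamma> m {u \<in> Pow {1..s}. d \<in> u} (G(d := g d))
    \<le> dual_sum \<alpha> \<gamma> m {u \<in> Pow {1..s}. d \<in> u} (G(d := q))"
proof -
  have fin: "finite u" "u \<subseteq> {1..}" if "u \<in> Pow {1..s}" for u using that finite_subset by auto
  have \<gamma>p: "\<gamma> u \<ge> 0" if "u \<in> Pow {1..s}" for u using less_imp_le[OF \<gamma>[OF fin[OF that]]] .
  let ?A = "{u \<in> Pow {1..s}. d \<in> u}" and ?B = "{u \<in> Pow {1..s}. u \<noteq> {} \<and> d \<notin> u}"
  have vec: "(\<lambda>j. if j < d then g j else if j = d then x else g0 j) = G(d := x)" for x
    by (simp add: G_def fun_eq_iff)
  have err: "(worst_case_error \<alpha> \<gamma> m s v)\<^sup>2 = dual_sum \<alpha> \<gamma> m (Pow {1..s} - {{}}) v"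
    for v :: "nat \<Rightarrow> 'p mod_ring poly"
  proof -
    have "worst_case_error \<alpha> \<gamma> m s v = sqrt (dual_sum \<alpha> \<gamma> m (Pow {1..s} - {{}}) v)"
      unfolding dual_sum_def by (rule worst_case_error_formula) fact+
    moreover have "dual_sum \<alpha> \<gamma> m (Pow {1..s} - {{}}) v \<ge> 0" by (rule dual_sum_nonneg) (simp add: \<gamma>p)
    ultimately show ?thesis by simp
  qed
  have split: "dual_sum \<alpha> \<gamma> m (Pow {1..s} - {{}}) v = dual_sum \<alpha> \<gamma> m ?A v + dual_sum \<alpha> \<gamma> m ?B v"
    for v :: "nat \<Rightarrow> 'p mod_ring poly"
  proof -
    have "Pow {1..s} - {{}} = (\<Union>t\<in>UNIV. if t then ?A else ?B)" by (auto simp: UNIV_bool)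
    then have "dual_sum \<alpha> \<gamma> m (Pow {1..s} - {{}}) v = (\<Sum>t\<in>UNIV. dual_sum \<alpha> \<gamma> m (if t then ?A else ?B) v)"
      by (simp only:) (rule dual_sum_UN[OF \<alpha>]; auto split: if_splits simp: fin \<gamma>p)
    then show ?thesis by (simp add: UNIV_bool add.commute)
  qed
  have rest: "dual_sum \<alpha> \<gamma> m ?B (G(d := g d)) = dual_sum \<alpha> \<gamma> m ?B (G(d := q))"
    by (rule dual_sum_cong) auto
  have "is_arg_min (\<lambda>q. (worst_case_error \<alpha> \<gamma> m s (G(d := q)))\<^sup>2) (\<lambda>q. q \<in> G_N m) (g d)"
    using scs d unfolding scs_output_def vec[symmetric] by blast
  then have "(worst_case_error \<alpha> \<gamma> m s (G(d := g d)))\<^sup>2 \<le> (worst_case_error \<alpha> \<gamma> m s (G(d := q)))\<^sup>2"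
    using q unfolding is_arg_min_def by (meson not_le)
  then show ?thesis unfolding err split rest by simp
qed

lemma scs_error_bound:
  fixes g0 g :: "nat \<Rightarrow> 'p::prime_card mod_ring poly"
  assumes \<alpha>: "\<alpha> > 1" and \<gamma>: "\<And>u. finite u \<Longrightarrow> u \<subseteq> {1..} \<Longrightarrow> \<gamma> u > 0" and \<gamma>1: "\<gamma> {} = 1"
    and m: "m > 0" and scs: "scs_output \<alpha> \<gamma> m s g0 g" and \<theta>: "\<theta> \<in> {1 / \<alpha><..1}"
  shows "(worst_case_error \<alpha> \<gamma> m s g)\<^sup>2
    \<le> (\<Sum>u\<in>Pow {1..s} - {{}}. real (card u) * \<gamma> u powr \<theta> *
          (2 * mu CARD('p) (\<alpha> * \<theta>) ^ card u / real CARD('p) ^ m)) powr (1 / \<theta>)"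
proof -
  let ?b = "CARD('p)"
  have \<theta>': "1 / \<alpha> < \<theta>" "\<theta> \<le> 1" using \<theta> by auto
  have \<theta>0: "\<theta> > 0" using \<alpha> \<theta>'(1) by (meson divide_pos_pos less_trans zero_less_one)
  have fin: "finite u" "u \<subseteq> {1..}" if "u \<in> Pow {1..s}" for u using that finite_subset by auto
  have \<gamma>p: "\<gamma> u \<ge> 0" if "u \<in> Pow {1..s}" for u using less_imp_le[OF \<gamma>[OF fin[OF that]]] .
  \<comment> \<open>The vector after step \<open>d\<close>: generators up to \<open>d\<close> are
    final, the later ones still initial.\<close>
  define G where "G d = (\<lambda>j. if j < d then g j else g0 j)(d := g d)" for d
  define A where "A d = {u \<in> Pow {1..s}. d \<in> u}" for d
  \<comment> \<open>Sorting the sets by largest element makes the families disjoint, and on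
    \<open>X d\<close> the vectors \<open>g\<close> and \<open>G d\<close> agree. Enlarging
    \<open>X d\<close> to \<open>A d\<close> then gives the quantity that step \<open>d\<close>
    minimizes.\<close>
  define X where "X d = {u \<in> Pow {1..s} - {{}}. Max u = d}" for d
  define F where "F u = \<gamma> u powr \<theta> * (2 * mu ?b (\<alpha> * \<theta>) ^ card u / real ?b ^ m)" for u
  let ?E = "dual_sum \<alpha> \<gamma> m (Pow {1..s} - {{}}) g"
  have E0: "?E \<ge> 0" by (rule dual_sum_nonneg) (simp add: \<gamma>p)
  have "worst_case_error \<alpha> \<gamma> m s g = sqrt ?E"
    unfolding dual_sum_def by (rule worst_case_error_formula) fact+
  then have err: "(worst_case_error \<alpha> \<gamma> m s g)\<^sup>2 = ?E" using E0 by simp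
  have XA: "X d \<subseteq> A d" for d using fin by (auto simp: X_def A_def intro!: Max_in)
  have Un: "Pow {1..s} - {{}} = (\<Union>d\<in>{1..s}. X d)"
  proof
    show "Pow {1..s} - {{}} \<subseteq> (\<Union>d\<in>{1..s}. X d)"
    proof
      fix u assume u: "u \<in> Pow {1..s} - {{}}"
      then have "Max u \<in> u" using fin by (intro Max_in) auto
      then show "u \<in> (\<Union>d\<in>{1..s}. X d)" using u by (auto simp: X_def)
    qed
  qed (auto simp: X_def)
  have part: "dual_sum \<alpha> \<gamma> m (X d) g \<le> dual_sum \<alpha> \<gamma> m (A d) (G d)" for d
  proof -
    have "dual_sum \<alpha> \<gamma> m (X d) g = dual_sum \<alpha> \<gamma> m (X d) (G d)"
    proof (rule dual_sum_cong)
      fix u j assume u: "u \<in> X d" and j: "j \<in> u"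
      have "j \<le> d" using u j fin by (auto simp: X_def)
      then show "g j = G d j" by (simp add: G_def)
    qed
    also have "\<dots> \<le> dual_sum \<alpha> \<gamma> m (A d) (G d)"
      unfolding dual_sum_def
    proof (rule infsum_mono2)
      show "(\<lambda>i. wt ?b \<alpha> \<gamma> i * of_bool (dual m (G d) i)) summable_on freqs (X d)"
        by (rule dual_sum_summable[OF \<alpha>]) (auto simp: X_def fin \<gamma>p)
      show "(\<lambda>i. wt ?b \<alpha> \<gamma> i * of_bool (dual m (G d) i)) summable_on freqs (A d)"
        by (rule dual_sum_summable[OF \<alpha>]) (auto simp: A_def fin \<gamma>p)
      show "freqs (X d) \<subseteq> freqs (A d)" using XA[of d] by blast
      show "0 \<le> wt ?b \<alpha> \<gamma> i * of_bool (dual m (G d) i)" if "i \<in> freqs (A d) - freqs (X d)" for i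
        using wt_nonneg[of "A d" \<gamma> i ?b \<alpha>] that by (auto simp: A_def \<gamma>p)
    qed
    finally show ?thesis .
  qed
  have bound: "dual_sum \<alpha> \<gamma> m (A d) (G d) powr \<theta> \<le> (\<Sum>u\<in>A d. F u)" if d: "d \<in> {1..s}" for d
    unfolding F_def G_def
  proof (rule minimizer_bound[OF \<alpha> \<theta>' m])
    fix q :: "'p mod_ring poly" assume q: "q \<in> G_N m"
    show "dual_sum \<alpha> \<gamma> m (A d) ((\<lambda>j. if j < d then g j else g0 j)(d := g d))
        \<le> dual_sum \<alpha> \<gamma> m (A d) ((\<lambda>j. if j < d then g j else g0 j)(d := q))"
      unfolding A_def by (rule scs_partial_minimizer) fact+
  qed (auto simp: A_def fin \<gamma>p)
  have "?E = (\<Sum>d\<in>{1..s}. dual_sum \<alpha> \<gamma> m (X d) g)"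
    unfolding Un by (rule dual_sum_UN[OF \<alpha>]) (auto simp: X_def fin \<gamma>p)
  also have "\<dots> \<le> (\<Sum>d\<in>{1..s}. dual_sum \<alpha> \<gamma> m (A d) (G d))" by (rule sum_mono[OF part])
  finally have "?E powr \<theta> \<le> (\<Sum>d\<in>{1..s}. dual_sum \<alpha> \<gamma> m (A d) (G d)) powr \<theta>"
    using \<theta>0 E0 by (intro powr_mono2) auto
  also have "\<dots> \<le> (\<Sum>d\<in>{1..s}. dual_sum \<alpha> \<gamma> m (A d) (G d) powr \<theta>)"
    by (rule powr_sum_le_sum_powr[OF dual_sum_nonneg \<theta>0 \<theta>'(2)]) (simp add: A_def \<gamma>p)
  also have "\<dots> \<le> (\<Sum>d\<in>{1..s}. \<Sum>u\<in>A d. F u)" by (rule sum_mono[OF bound])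
  \<comment> \<open>Each \<open>u\<close> lies in \<open>A d\<close> once for every
    \<open>d \<in> u\<close>, which produces the factor \<open>card u\<close>.\<close>
  also have "\<dots> = (\<Sum>u\<in>Pow {1..s}. \<Sum>d\<in>{d \<in> {1..s}. d \<in> u}. F u)"
    unfolding A_def by (rule sum.swap_restrict) auto
  also have "\<dots> = (\<Sum>u\<in>Pow {1..s}. real (card u) * F u)"
  proof (rule sum.cong[OF refl])
    fix u assume "u \<in> Pow {1..s}"
    then have "{d \<in> {1..s}. d \<in> u} = u" by auto
    then show "(\<Sum>d\<in>{d \<in> {1..s}. d \<in> u}. F u) = real (card u) * F u" by simp
  qed
  also have "\<dots> = (\<Sum>u\<in>Pow {1..s} - {{}}. real (card u) * F u)"
    by (rule sum.mono_neutral_right) auto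
  finally have "(?E powr \<theta>) powr (1 / \<theta>) \<le> (\<Sum>u\<in>Pow {1..s} - {{}}. real (card u) * F u) powr (1 / \<theta>)"
    using \<theta>0 by (intro powr_mono2) auto
  then show ?thesis
    unfolding err F_def using \<theta>0 E0 by (simp add: powr_powr mult.assoc)
qed

section \<open>The rate of convergence\<close>

lemma worst_case_error_nonneg:
  fixes g :: "nat \<Rightarrow> 'p::prime_card mod_ring poly"
  assumes "\<alpha> > 1" "\<And>u. finite u \<Longrightarrow> u \<subseteq> {1..} \<Longrightarrow> \<gamma> u > 0" "\<gamma> {} = 1" "m > 0"
  shows "worst_case_error \<alpha> \<gamma> m s g \<ge> 0"
proof -
  have "\<gamma> u \<ge> 0" if "u \<in> Pow {1..s} - {{}}" for u
    by (rule less_imp_le[OF assms(2)]) (use that finite_subset in auto)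
  then have "dual_sum \<alpha> \<gamma> m (Pow {1..s} - {{}}) g \<ge> 0" by (rule dual_sum_nonneg)
  moreover have "worst_case_error \<alpha> \<gamma> m s g = sqrt (dual_sum \<alpha> \<gamma> m (Pow {1..s} - {{}}) g)"
    unfolding dual_sum_def by (rule worst_case_error_formula) fact+
  ultimately show ?thesis by simp
qed

text \<open>The quantity whose supremum over \<open>s\<close> is \<open>C_const\<close>, named so
  that the constant for fixed \<open>s\<close> and the uniform constant come from one
  estimate.\<close>

definition rate_sum :: "nat \<Rightarrow> real \<Rightarrow> (nat set \<Rightarrow> real) \<Rightarrow> real \<Rightarrow> nat \<Rightarrow> real" where
  "rate_sum b \<alpha> \<gamma> \<delta> s = 2 * (\<Sum>u\<in>Pow {1..s} - {{}}.
     real (card u) * \<gamma> u powr (1 / (\<alpha> - 2 * \<delta>)) * mu b (\<alpha> / (\<alpha> - 2 * \<delta>)) ^ card u)"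

lemma rate_sum_nonneg: "rate_sum b \<alpha> \<gamma> \<delta> s \<ge> 0"
  unfolding rate_sum_def by (intro mult_nonneg_nonneg sum_nonneg) (auto simp: mu_nonneg)

lemma scs_rate:
  fixes g0 g :: "nat \<Rightarrow> 'p::prime_card mod_ring poly"
  assumes \<alpha>: "\<alpha> > 1" and \<gamma>: "\<And>u. finite u \<Longrightarrow> u \<subseteq> {1..} \<Longrightarrow> \<gamma> u > 0" and \<gamma>1: "\<gamma> {} = 1"
    and m: "m > 0" and scs: "scs_output \<alpha> \<gamma> m s g0 g" and \<delta>: "\<delta> \<in> {0<..(\<alpha> - 1) / 2}"
  shows "worst_case_error \<alpha> \<gamma> m s g
    \<le> rate_sum CARD('p) \<alpha> \<gamma> \<delta> s powr (\<alpha> / 2 - \<delta>) * real (CARD('p) ^ m) powr (- \<alpha> / 2 + \<delta>)"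
proof -
  let ?b = "CARD('p)" and ?S = "rate_sum CARD('p) \<alpha> \<gamma> \<delta> s" and ?e = "worst_case_error \<alpha> \<gamma> m s g"
  \<comment> \<open>This choice gives the squared error the exponent
    \<open>\<alpha> - 2 * \<delta>\<close>, which the square root halves. The range of
    \<open>\<delta>\<close> makes the denominator at least 1 and below \<open>\<alpha>\<close>, so
    \<open>\<theta>\<close> is admissible.\<close>
  define \<theta> where "\<theta> = 1 / (\<alpha> - 2 * \<delta>)"
  have a: "\<alpha> - 2 * \<delta> \<ge> 1" "\<alpha> - 2 * \<delta> < \<alpha>" using \<delta> by (auto simp: field_simps)
  have \<theta>: "\<theta> \<in> {1 / \<alpha><..1}"
    using a \<alpha> by (auto simp: \<theta>_def intro!: divide_strict_left_mono mult_pos_pos)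
  have B: "real ?b ^ m > 0" using card_p_ge2[where 'p = 'p] by simp
  have "?e\<^sup>2 \<le> (\<Sum>u\<in>Pow {1..s} - {{}}. real (card u) * \<gamma> u powr \<theta> *
          (2 * mu ?b (\<alpha> * \<theta>) ^ card u / real ?b ^ m)) powr (1 / \<theta>)"
    by (rule scs_error_bound) fact+
  also have "(\<Sum>u\<in>Pow {1..s} - {{}}. real (card u) * \<gamma> u powr \<theta> *
          (2 * mu ?b (\<alpha> * \<theta>) ^ card u / real ?b ^ m)) = ?S / real ?b ^ m"
    unfolding rate_sum_def sum_distrib_left sum_divide_distrib \<theta>_def by (intro sum.cong refl) simp
  also have "1 / \<theta> = \<alpha> - 2 * \<delta>" by (simp add: \<theta>_def)
  finally have "?e\<^sup>2 \<le> (?S / real ?b ^ m) powr (\<alpha> - 2 * \<delta>)" .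
  then have "?e \<le> sqrt ((?S / real ?b ^ m) powr (\<alpha> - 2 * \<delta>))" by (rule real_le_rsqrt)
  also have "\<dots> = (?S / real ?b ^ m) powr (\<alpha> / 2 - \<delta>)"
    by (simp add: powr_half_sqrt[symmetric] powr_powr diff_divide_distrib)
  also have "\<dots> = ?S powr (\<alpha> / 2 - \<delta>) / (real ?b ^ m) powr (\<alpha> / 2 - \<delta>)"
    using rate_sum_nonneg B by (simp add: powr_divide)
  also have "\<dots> = ?S powr (\<alpha> / 2 - \<delta>) * real (?b ^ m) powr (- (\<alpha> / 2 - \<delta>))"
    by (simp only: powr_minus divide_inverse of_nat_power)
  also have "- (\<alpha> / 2 - \<delta>) = - \<alpha> / 2 + \<delta>" by simp
  finally show ?thesis .
qed

theorem theorem13: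
  fixes \<alpha> :: real and \<gamma> :: "nat set \<Rightarrow> real"
  assumes "\<alpha> > 1"
    and "\<And>u. finite u \<Longrightarrow> u \<subseteq> {1..} \<Longrightarrow> \<gamma> u > 0"
    and "\<gamma> {} = 1"
  shows
    "(\<forall>m\<ge>1. \<forall>s\<ge>1. \<forall>g0 :: nat \<Rightarrow> 'p::prime_card mod_ring poly.
        (\<exists>g. scs_output \<alpha> \<gamma> m s g0 g) \<and>
        (\<forall>g. scs_output \<alpha> \<gamma> m s g0 g \<longrightarrow>
          (\<forall>\<theta>\<in>{1 / \<alpha><..1}.
            (worst_case_error \<alpha> \<gamma> m s g)\<^sup>2
              \<le> (\<Sum>u\<in>Pow {1..s} - {{}}. real (card u) * \<gamma> u powr \<theta> *
                    (2 * mu CARD('p) (\<alpha> * \<theta>) ^ card u / real CARD('p) ^ m)) powr (1 / \<theta>))))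
     \<and>
     (\<forall>\<delta>\<in>{0<..(\<alpha> - 1) / 2}.
        (\<forall>s\<ge>1. \<forall>g0 g :: nat \<Rightarrow> nat \<Rightarrow> 'p mod_ring poly.
          (\<forall>m\<ge>1. scs_output \<alpha> \<gamma> m s (g0 m) (g m)) \<longrightarrow>
          (\<lambda>m. worst_case_error \<alpha> \<gamma> m s (g m))
            \<in> O(\<lambda>m. real (CARD('p) ^ m) powr (- \<alpha> / 2 + \<delta>)))
        \<and>
        (C_const CARD('p) \<alpha> \<gamma> \<delta> < \<infinity> \<longrightarrow>
          (\<exists>c. \<forall>s\<ge>1. \<forall>m\<ge>1. \<forall>g0 g :: nat \<Rightarrow> 'p mod_ring poly.
            scs_output \<alpha> \<gamma> m s g0 g \<longrightarrow>
            worst_case_error \<alpha> \<gamma> m s g \<le> c * real (CARD('p) ^ m) powr (- \<alpha> / 2 + \<delta>))))"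
proof (intro conjI allI impI ballI)
  fix m s :: nat and g0 :: "nat \<Rightarrow> 'p mod_ring poly" assume "1 \<le> m"
  then show "\<exists>g. scs_output \<alpha> \<gamma> m s g0 g" by (intro scs_exists) simp
next
  fix m s :: nat and g0 g :: "nat \<Rightarrow> 'p mod_ring poly" and \<theta> :: real
  assume m: "1 \<le> m" and *: "scs_output \<alpha> \<gamma> m s g0 g" "\<theta> \<in> {1 / \<alpha><..1}"
  have m0: "m > 0" using m by simp
  show "(worst_case_error \<alpha> \<gamma> m s g)\<^sup>2
      \<le> (\<Sum>u\<in>Pow {1..s} - {{}}. real (card u) * \<gamma> u powr \<theta> *
            (2 * mu CARD('p) (\<alpha> * \<theta>) ^ card u / real CARD('p) ^ m)) powr (1 / \<theta>)"
    by (rule scs_error_bound) fact+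
next
  fix \<delta> s and g0 g :: "nat \<Rightarrow> nat \<Rightarrow> 'p mod_ring poly"
  assume \<delta>: "\<delta> \<in> {0<..(\<alpha> - 1) / 2}" and scs: "\<forall>m\<ge>1. scs_output \<alpha> \<gamma> m s (g0 m) (g m)"
  show "(\<lambda>m. worst_case_error \<alpha> \<gamma> m s (g m)) \<in> O(\<lambda>m. real (CARD('p) ^ m) powr (- \<alpha> / 2 + \<delta>))"
  proof (rule bigoI)
    show "\<forall>\<^sub>F m in sequentially. norm (worst_case_error \<alpha> \<gamma> m s (g m))
        \<le> rate_sum CARD('p) \<alpha> \<gamma> \<delta> s powr (\<alpha> / 2 - \<delta>) * norm (real (CARD('p) ^ m) powr (- \<alpha> / 2 + \<delta>))"
      using eventually_gt_at_top[of 0]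
    proof eventually_elim
      case (elim m)
      have scsm: "scs_output \<alpha> \<gamma> m s (g0 m) (g m)" using scs elim by simp
      have "worst_case_error \<alpha> \<gamma> m s (g m) \<ge> 0"
        by (rule worst_case_error_nonneg) fact+
      moreover have "worst_case_error \<alpha> \<gamma> m s (g m)
        \<le> rate_sum CARD('p) \<alpha> \<gamma> \<delta> s powr (\<alpha> / 2 - \<delta>) * real (CARD('p) ^ m) powr (- \<alpha> / 2 + \<delta>)"
        by (rule scs_rate) fact+
      ultimately show ?case by simp
    qed
  qed
next
  fix \<delta> assume \<delta>: "\<delta> \<in> {0<..(\<alpha> - 1) / 2}" and fin: "C_const CARD('p) \<alpha> \<gamma> \<delta> < \<infinity>"
  \<comment> \<open>The conversion is faithful: the supremum is finite by assumption and lies above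
    a real number by \<open>upper\<close>.\<close>
  define C where "C = real_of_ereal (C_const CARD('p) \<alpha> \<gamma> \<delta>)"
  have upper: "ereal (rate_sum CARD('p) \<alpha> \<gamma> \<delta> s) \<le> C_const CARD('p) \<alpha> \<gamma> \<delta>" if "s \<ge> 1" for s
    unfolding C_const_def rate_sum_def by (rule SUP_upper) (use that in simp)
  have C: "rate_sum CARD('p) \<alpha> \<gamma> \<delta> s \<le> C" if "s \<ge> 1" for s
    using upper[OF that] fin unfolding C_def by (cases "C_const CARD('p) \<alpha> \<gamma> \<delta>") auto
  have "\<alpha> / 2 - \<delta> \<ge> 0" using \<delta> by (simp add: field_simps)
  have "worst_case_error \<alpha> \<gamma> m s g \<le> C powr (\<alpha> / 2 - \<delta>) * real (CARD('p) ^ m) powr (- \<alpha> / 2 + \<delta>)"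
    if s: "s \<ge> 1" and m: "m \<ge> 1" and scs: "scs_output \<alpha> \<gamma> m s g0 g"
    for s m and g0 g :: "nat \<Rightarrow> 'p mod_ring poly"
  proof -
    have m0: "m > 0" using m by simp
    have "worst_case_error \<alpha> \<gamma> m s g
        \<le> rate_sum CARD('p) \<alpha> \<gamma> \<delta> s powr (\<alpha> / 2 - \<delta>) * real (CARD('p) ^ m) powr (- \<alpha> / 2 + \<delta>)"
      by (rule scs_rate) fact+
    also have "\<dots> \<le> C powr (\<alpha> / 2 - \<delta>) * real (CARD('p) ^ m) powr (- \<alpha> / 2 + \<delta>)"
      by (intro mult_right_mono powr_mono2 C s rate_sum_nonneg) (use \<open>\<alpha> / 2 - \<delta> \<ge> 0\<close> in auto)
    finally show ?thesis .
  qed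
  then show "\<exists>c. \<forall>s\<ge>1. \<forall>m\<ge>1. \<forall>g0 g :: nat \<Rightarrow> 'p mod_ring poly.
      scs_output \<alpha> \<gamma> m s g0 g \<longrightarrow>
      worst_case_error \<alpha> \<gamma> m s g \<le> c * real (CARD('p) ^ m) powr (- \<alpha> / 2 + \<delta>)" by blast
qed

end
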